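(* Let $s_0\in\mathcal{X}$ and suppose that for each $n$ the observations $X_{t_{0,n}},\ldots,X_{t_{n,n}}$, $t_{i,n}=i/n$, come from the process $dX_t=s_0(t)\,dW_t$, $X_0=0$, $t\in[0,1]$. Let $(\widetilde{\varepsilon}_n)$ be a sequence of positive numbers with $\widetilde{\varepsilon}_n\asymp n^{-1/3}\log n$, and let $\Pi$ be a prior on $\mathcal{X}$ such that $$\Pi( V_{s_0,\widetilde{\varepsilon}_n} ) \gtrsim e^{- \overline{C} n \widetilde{\varepsilon}_n^2}$$ for some constant $\overline{C}>0$ independent of $n$. Then for a large enough constant $\widetilde{M}>0$ (independent of $n$), and with $\varepsilon_n=\widetilde{M}\widetilde{\varepsilon}_n$, $$\Pi(U_{s_0,\varepsilon_n}^c\,|\,X_{t_{0,n}},\ldots,X_{t_{n,n}})\longrightarrow 0\quad\text{in } \mathbb{P}_{s_0}\text{-probability as } n\to\infty .$$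
   Context: Fix constants $0<\kappa<\mathcal{K}<\infty$ and $0<M<\infty$. $\mathcal{X}$ is the set of all differentiable functions $s:[0,1]\to[\kappa,\mathcal{K}]$ with $\|s'\|_\infty\le M$, equipped with the Borel $\sigma$-algebra of the supremum norm; a prior is a probability measure on $\mathcal{X}$. For $s\in\mathcal{X}$, $\mathbb{P}_s$ denotes the law of the process $X$ solving $dX_t=s(t)\,dW_t$, $X_0=0$, $t\in[0,1]$, with $W$ a standard Brownian motion. Likelihood: with $\psi(u)=\exp(-u^2/2)$, $$L_n(s)=\prod_{i=1}^{n} \left\{ \frac{1}{\sqrt{2\pi\int_{t_{i-1,n}}^{t_{i,n}}s^2(u)du}}\,\psi\left( \frac{X_{t_{i,n}}-X_{t_{i-1,n}}}{\sqrt{\int_{t_{i-1,n}}^{t_{i,n}}s^2(u)du}} \right) \right\}.$$ Posterior: for measurable $\mathcal{S}\subset\mathcal{X}$, $$\Pi(\mathcal{S}|X_{t_{0,n}},\ldots,X_{t_{n,n}})=\frac{\int_{\mathcal{S}} L_n(s)\, \Pi(d s)}{ \int_{\mathcal{X}} L_n(s)\, \Pi(ds) }.$$ Neighbourhoods: for $\varepsilon>0$, $U_{s_0,\varepsilon}=\{ s\in\mathcal{X}:\|s-s_0\|_2<\varepsilon \}$ and $V_{s_0,\varepsilon}=\{ s\in\mathcal{X}: \| s-s_0\|_{\infty} <\varepsilon \}$, where $\|\cdot\|_2$ is the $L_2([0,1])$-norm; complements are taken in $\mathcal{X}$. Comparison notation: $a_n\gtrsim b_n$ means there is a constant $A>0$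 independent of $n$ with $Aa_n\ge b_n$ for all $n$. For positive sequences, $a_n\asymp b_n$ means $0<\liminf_{n\to\infty} a_n/b_n\le\limsup_{n\to\infty} a_n/b_n<\infty$. *)

theory Defs
  imports "HOL-Probability.Probability"
begin

text \<open>
  The space C[0,1] with the supremum metric. Its elements are functions on the reals that are
  \<^const>\<open>undefined\<close> outside [0,1], so that equality is equality on [0,1].
\<close>

definition C01 :: "(real \<Rightarrow> real) metric" where
  "C01 = cfunspace (top_of_set {0..1}) euclidean_metric"

text \<open>At 0 and 1 the derivative is one-sided.\<close>

definition vol_class :: "real \<Rightarrow> real \<Rightarrow> real \<Rightarrow> (real \<Rightarrow> real) set" where
  "vol_class \<kappa> K M =
     {s \<in> {0..1} \<rightarrow>\<^sub>E {\<kappa>..K}.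
        \<forall>t\<in>{0..1}. \<exists>D. (s has_real_derivative D) (at t within {0..1}) \<and> \<bar>D\<bar> \<le> M}"

text \<open>The Borel sigma-algebra; as a measure this is null, only its \<^const>\<open>sets\<close> matter.\<close>

definition vol_borel :: "real \<Rightarrow> real \<Rightarrow> real \<Rightarrow> (real \<Rightarrow> real) measure" where
  "vol_borel \<kappa> K M =
     sigma (vol_class \<kappa> K M)
       {U. openin (mtopology_of (submetric C01 (vol_class \<kappa> K M))) U}"

definition prior :: "real \<Rightarrow> real \<Rightarrow> real \<Rightarrow> (real \<Rightarrow> real) measure \<Rightarrow> bool" where
  "prior \<kappa> K M \<pi> \<longleftrightarrow> prob_space \<pi> \<and> sets \<pi> = sets (vol_borel \<kappa> K M)"

definition L2_norm01 :: "(real \<Rightarrow> real) \<Rightarrow> real" where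
  "L2_norm01 f = sqrt (LBINT u:{0..1}. (f u)\<^sup>2)"

definition U_nbhd :: "real \<Rightarrow> real \<Rightarrow> real \<Rightarrow> (real \<Rightarrow> real) \<Rightarrow> real \<Rightarrow> (real \<Rightarrow> real) set" where
  "U_nbhd \<kappa> K M s\<^sub>0 \<epsilon> = {s \<in> vol_class \<kappa> K M. L2_norm01 (\<lambda>u. s u - s\<^sub>0 u) < \<epsilon>}"

definition V_nbhd :: "real \<Rightarrow> real \<Rightarrow> real \<Rightarrow> (real \<Rightarrow> real) \<Rightarrow> real \<Rightarrow> (real \<Rightarrow> real) set" where
  "V_nbhd \<kappa> K M s\<^sub>0 \<epsilon> = {s \<in> vol_class \<kappa> K M. mdist C01 s s\<^sub>0 < \<epsilon>}"

definition std_brownian_motion :: "'w measure \<Rightarrow> (real \<Rightarrow> 'w \<Rightarrow> real) \<Rightarrow> bool" where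
  "std_brownian_motion \<Omega> W \<longleftrightarrow>
     prob_space \<Omega> \<and>
     (\<forall>t\<in>{0..1}. W t \<in> borel_measurable \<Omega>) \<and>
     (AE \<omega> in \<Omega>. W 0 \<omega> = 0) \<and>
     (\<forall>r t. 0 \<le> r \<and> r < t \<and> t \<le> 1 \<longrightarrow>
        distributed \<Omega> lborel (\<lambda>\<omega>. W t \<omega> - W r \<omega>) (normal_density 0 (sqrt (t - r)))) \<and>
     (\<forall>k p. mono_on {..k} p \<and> p ` {..k} \<subseteq> {0..1} \<longrightarrow>
        prob_space.indep_vars \<Omega> (\<lambda>_. borel) (\<lambda>i \<omega>. W (p (Suc i)) \<omega> - W (p i) \<omega>) {..<k::nat}) \<and>
     (AE \<omega> in \<Omega>. continuous_on {0..1} (\<lambda>t. W t \<omega>))"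

text \<open>
  The step function with value \<open>c i\<close> on \<open>]p i, p (i + 1)]\<close> for \<open>i < k\<close>, and its integral
  against \<open>W\<close>.
\<close>

definition step_fun :: "nat \<Rightarrow> (nat \<Rightarrow> real) \<Rightarrow> (nat \<Rightarrow> real) \<Rightarrow> real \<Rightarrow> real" where
  "step_fun k p c u = (\<Sum>i<k. c i * indicator {p i<..p (Suc i)} u)"

definition step_integral ::
  "(real \<Rightarrow> 'w \<Rightarrow> real) \<Rightarrow> nat \<Rightarrow> (nat \<Rightarrow> real) \<Rightarrow> (nat \<Rightarrow> real) \<Rightarrow> 'w \<Rightarrow> real" where
  "step_integral W k p c \<omega> = (\<Sum>i<k. c i * (W (p (Suc i)) \<omega> - W (p i) \<omega>))"

text \<open>
  \<open>Y\<close> is (a version of) the stochastic integral of the deterministic function \<open>f\<close> against \<open>W\<close>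
  over \<open>[0,t]\<close>: the limit in mean square of the integrals of step functions that approximate
  \<open>f\<close> in \<open>L\<^sup>2([0,t])\<close>.
\<close>

definition is_wiener_integral ::
  "'w measure \<Rightarrow> (real \<Rightarrow> 'w \<Rightarrow> real) \<Rightarrow> (real \<Rightarrow> real) \<Rightarrow> real \<Rightarrow> ('w \<Rightarrow> real) \<Rightarrow> bool" where
  "is_wiener_integral \<Omega> W f t Y \<longleftrightarrow>
     Y \<in> borel_measurable \<Omega> \<and>
     (\<exists>k p c.
        (\<forall>j. mono_on {..k j} (p j) \<and> p j 0 = 0 \<and> p j (k j) = t) \<and>
        ((\<lambda>j. \<integral>\<^sup>+u\<in>{0..t}. ennreal ((step_fun (k j) (p j) (c j) u - f u)\<^sup>2) \<partial>lborel) \<longlonglongrightarrow> 0) \<and>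
        ((\<lambda>j. \<integral>\<^sup>+\<omega>. ennreal ((step_integral W (k j) (p j) (c j) \<omega> - Y \<omega>)\<^sup>2) \<partial>\<Omega>) \<longlonglongrightarrow> 0))"

text \<open>\<open>X\<close> solves \<open>dX\<^sub>t = s(t) dW\<^sub>t\<close>, \<open>X\<^sub>0 = 0\<close>, on \<open>[0,1]\<close>.\<close>

definition solves_sde ::
  "'w measure \<Rightarrow> (real \<Rightarrow> 'w \<Rightarrow> real) \<Rightarrow> (real \<Rightarrow> real) \<Rightarrow> (real \<Rightarrow> 'w \<Rightarrow> real) \<Rightarrow> bool" where
  "solves_sde \<Omega> W s X \<longleftrightarrow>
     (AE \<omega> in \<Omega>. X 0 \<omega> = 0) \<and>
     (\<forall>t\<in>{0..1}. is_wiener_integral \<Omega> W s t (X t)) \<and>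
     (AE \<omega> in \<Omega>. continuous_on {0..1} (\<lambda>t. X t \<omega>))"

definition path_law :: "'w measure \<Rightarrow> (real \<Rightarrow> 'w \<Rightarrow> real) \<Rightarrow> (real \<Rightarrow> real) measure" where
  "path_law \<Omega> X = distr \<Omega> (PiM {0..1} (\<lambda>_. borel)) (\<lambda>\<omega>. \<lambda>t\<in>{0..1}. X t \<omega>)"

definition psi :: "real \<Rightarrow> real" where
  "psi u = exp (- u\<^sup>2 / 2)"

text \<open>Here \<open>x\<close> is a path, evaluated only at the observation times \<open>i / n\<close>, \<open>0 \<le> i \<le> n\<close>.\<close>

definition likelihood :: "nat \<Rightarrow> (real \<Rightarrow> real) \<Rightarrow> (real \<Rightarrow> real) \<Rightarrow> real" where
  "likelihood n x s =
     (\<Prod>i=1..n.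
        let v = (LBINT u:{(real i - 1) / real n..real i / real n}. (s u)\<^sup>2)
        in 1 / sqrt (2 * pi * v) *
           psi ((x (real i / real n) - x ((real i - 1) / real n)) / sqrt v))"

definition posterior ::
  "(real \<Rightarrow> real) measure \<Rightarrow> nat \<Rightarrow> (real \<Rightarrow> real) \<Rightarrow> (real \<Rightarrow> real) set \<Rightarrow> real" where
  "posterior \<pi> n x S =
     (LINT s:S|\<pi>. likelihood n x s) / (LINT s|\<pi>. likelihood n x s)"

definition gtrsim :: "(nat \<Rightarrow> real) \<Rightarrow> (nat \<Rightarrow> real) \<Rightarrow> bool" where
  "gtrsim a b \<longleftrightarrow> (\<exists>A>0. \<forall>n\<ge>1. A * a n \<ge> b n)"

definition same_order :: "(nat \<Rightarrow> real) \<Rightarrow> (nat \<Rightarrow> real) \<Rightarrow> bool" where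
  "same_order a b \<longleftrightarrow>
     0 < liminf (\<lambda>n. ereal (a n / b n)) \<and> limsup (\<lambda>n. ereal (a n / b n)) < \<infinity>"

definition tendsto_in_prob :: "'a measure \<Rightarrow> (nat \<Rightarrow> 'a \<Rightarrow> real) \<Rightarrow> real \<Rightarrow> bool" where
  "tendsto_in_prob P Z z \<longleftrightarrow>
     (\<forall>n. Z n \<in> borel_measurable P) \<and>
     (\<forall>\<eta>>0. (\<lambda>n. measure P {\<omega> \<in> space P. \<bar>Z n \<omega> - z\<bar> > \<eta>}) \<longlonglongrightarrow> 0)"

end

theory Submission
  imports Defs "HOL-Real_Asymp.Real_Asymp"
begin

text \<open>
  Write \<open>R(s)\<close> for the likelihood ratio of \<open>s\<close> against \<open>s\<^sub>0\<close>. The posterior mass of a set \<open>S\<close> is the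
  ratio of the integrals of \<open>R\<close> over \<open>S\<close> and over the whole class. Instead of tests, take
  \<open>\<phi> = \<Sum>\<^sub>t sqrt (R(t))\<close>, where \<open>t\<close> runs over a finite sup-norm net of \<open>S\<close> with mesh of order \<open>\<epsilon>\<^sub>n\<close>. If \<open>S\<close> lies
  at \<open>L\<^sup>2\<close> distance at least \<open>Mt \<epsilon>\<^sub>n\<close> from \<open>s\<^sub>0\<close>, then the mean of \<open>\<phi>\<close> and the means of \<open>R(s) / \<phi>\<close>, \<open>s \<in> S\<close>,
  are exponentially small in \<open>n \<epsilon>\<^sub>n\<^sup>2\<close>, because the Lipschitz class has entropy at most \<open>n \<epsilon>\<^sub>n\<^sup>2\<close> at
  scale \<open>\<epsilon>\<^sub>n\<close>, even when it is counted with a superfluous logarithm. Near \<open>s\<^sub>0\<close> the mean of \<open>1 / R(s)\<close>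
  is at most \<open>exp (C n \<epsilon>\<^sub>n\<^sup>2)\<close>, which bounds the evidence from below. Markov's inequality combines
  the three bounds.

  All of these means are means of products over the cells of functions \<open>c exp (l \<Delta>\<^sup>2)\<close> of the
  increments \<open>\<Delta>\<close> of \<open>X\<close>, and only upper bounds for them are needed. So it suffices to approximate
  the increments by Wiener integrals of step functions with the correct variances, which are
  independent and normal, and to apply Fatou's lemma.
\<close>

section \<open>The class of volatilities\<close>

text \<open>The square root lets \<phi> serve both sides. Under \<open>s\<^sub>0\<close> the mean of
  \<open>sqrt (R(t))\<close> is a Hellinger affinity, and so is the mean of
  \<open>R(t) / sqrt (R(t))\<close>. As \<phi> dominates each of its summands, the latter controls
  \<open>R(s) / \<phi>\<close> once it is stable under moving the net point \<open>t\<close> to a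
  nearby \<open>s\<close>. Only the mean of \<phi> pays for the size of the net. The move costs an
  exponent of order n times the squared mesh, a fixed multiple of n \<epsilon>^2, while the
  separation gains a multiple of Mt^2 n \<epsilon>^2, so a large Mt wins. The data see
  \<open>s\<close> only through the integrals of its square over the cells, so part of the distance
  from \<open>s\<^sub>0\<close> can be hidden. By the Lipschitz bound this costs O(1/n) in the sum
  of squared differences of cell averages, which is harmless once n \<epsilon>^2 is at least 1. For
  \<epsilon> of order n^(-1/3) log n, n \<epsilon>^2 is of order n^(1/3) (log n)^2, whereas the
  entropy bound (1/\<epsilon>) log(1/\<epsilon>) is only of order n^(1/3).\<close>

lemma vol_class_bounds:
  assumes "s \<in> vol_class \<kappa> K M" "u \<in> {0..1}"
  shows "\<kappa> \<le> s u" "s u \<le> K"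
  using assms unfolding vol_class_def by (auto simp: PiE_def Pi_def)

lemma vol_class_Lipschitz:
  assumes "s \<in> vol_class \<kappa> K M" "u \<in> {0..1}" "v \<in> {0..1}"
  shows "\<bar>s u - s v\<bar> \<le> M * \<bar>u - v\<bar>"
proof -
  have "\<forall>t\<in>{0..1}. \<exists>D. (s has_real_derivative D) (at t within {0..1}) \<and> \<bar>D\<bar> \<le> M"
    using assms(1) unfolding vol_class_def by blast
  then obtain D where D: "\<And>t. t \<in> {0..1} \<Longrightarrow> (s has_real_derivative D t) (at t within {0..1})"
      "\<And>t. t \<in> {0..1} \<Longrightarrow> \<bar>D t\<bar> \<le> M"
    by metis
  have "norm (s u - s v) \<le> M * norm (u - v)"
    by (rule field_differentiable_bound[where S="{0..1}" and f'=D]) (use D assms in auto)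
  then show ?thesis by simp
qed

lemma vol_class_continuous_on:
  assumes "s \<in> vol_class \<kappa> K M" shows "continuous_on {0..1} s"
proof -
  have "\<forall>t\<in>{0..1}. \<exists>D. (s has_real_derivative D) (at t within {0..1})"
    using assms unfolding vol_class_def by blast
  then show ?thesis
    by (meson DERIV_continuous continuous_on_eq_continuous_within)
qed

lemma vol_class_subset_C01: "vol_class \<kappa> K M \<subseteq> mspace C01"
proof
  fix s assume s: "s \<in> vol_class \<kappa> K M"
  have "s \<in> extensional {0..1}"
    using s unfolding vol_class_def by (auto simp: PiE_def)
  moreover have "bounded (s ` {0..1})"
    using vol_class_continuous_on[OF s] compact_continuous_image compact_imp_bounded compact_Icc by blast
  ultimately show "s \<in> mspace C01"
    using vol_class_continuous_on[OF s] by (simp add: C01_def)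
qed

lemma C01_mdist:
  assumes "s \<in> vol_class \<kappa> K M" "s' \<in> vol_class \<kappa> K M" "u \<in> {0..1}"
  shows "\<bar>s u - s' u\<bar> \<le> mdist C01 s s'"
proof -
  have "s \<in> mspace C01" "s' \<in> mspace C01"
    using assms vol_class_subset_C01 by auto
  then have "mdist euclidean_metric (s u) (s' u) \<le> mdist C01 s s'"
    unfolding C01_def by (rule mdist_cfunspace_imp_mdist_le) (use assms in auto)
  then show ?thesis by (simp add: dist_real_def)
qed

section \<open>Borel measurability of functionals on the class\<close>

lemma space_vol_borel: "space (vol_borel \<kappa> K M) = vol_class \<kappa> K M"
  unfolding vol_borel_def by (simp add: space_measure_of_conv)

text \<open>Cell variances and the squared L2 distance become Borel measurable through this:
  Lipschitz for the sup norm means continuous for the metric. The hypothesis speaks of any pointwise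
  bound \<open>d\<close>, so that its users never have to compute the distance in
  \<open>C01\<close>.\<close>

lemma sup_Lipschitz_measurable:
  fixes F :: "(real \<Rightarrow> real) \<Rightarrow> real"
  assumes "0 \<le> C"
    and F: "\<And>s s' d. \<lbrakk>s \<in> vol_class \<kappa> K M; s' \<in> vol_class \<kappa> K M;
              \<And>u. u \<in> {0..1} \<Longrightarrow> \<bar>s u - s' u\<bar> \<le> d\<rbrakk> \<Longrightarrow> \<bar>F s - F s'\<bar> \<le> C * d"
  shows "F \<in> borel_measurable (vol_borel \<kappa> K M)"
proof (rule borel_measurableI)
  fix S :: "real set" assume "open S"
  let ?X = "vol_class \<kappa> K M"
  interpret X: Metric_space ?X "mdist C01"
    using Metric_space.subspace[OF Metric_space_mspace_mdist vol_class_subset_C01] .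
  have eq: "mtopology_of (submetric C01 ?X) = X.mtopology"
    using inf_absorb1[OF vol_class_subset_C01] by (simp add: mtopology_of_def)
  have "openin X.mtopology (F -` S \<inter> ?X)"
    unfolding X.openin_mtopology
  proof (intro conjI allI impI)
    fix s assume s: "s \<in> F -` S \<inter> ?X"
    then obtain e where e: "0 < e" "\<And>y. dist y (F s) < e \<Longrightarrow> y \<in> S"
      using \<open>open S\<close> unfolding open_dist by blast
    show "\<exists>r>0. X.mball s r \<subseteq> F -` S \<inter> ?X"
    proof (intro exI conjI subsetI)
      \<comment> \<open>Dividing by \<open>C + 1\<close> instead of \<open>C\<close> covers
        \<open>C = 0\<close>.\<close>
      show "e / (C + 1) > 0" using e assms by simp
      fix s' assume s': "s' \<in> X.mball s (e / (C + 1))"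
      then have d: "mdist C01 s s' < e / (C + 1)" and s'X: "s' \<in> ?X" by auto
      have "mdist C01 s s' * (C + 1) < e"
        using d assms(1) by (simp add: pos_less_divide_eq)
      moreover have "\<bar>F s - F s'\<bar> \<le> C * mdist C01 s s'"
        by (rule F[OF _ s'X C01_mdist[OF _ s'X]]) (use s in auto)
      moreover have "0 \<le> mdist C01 s s'" by simp
      ultimately have "dist (F s') (F s) < e"
        unfolding dist_real_def distrib_left mult.commute[of _ C] by linarith
      then show "s' \<in> F -` S \<inter> ?X" using e s'X by auto
    qed
  qed auto
  then have "F -` S \<inter> ?X \<in> sets (vol_borel \<kappa> K M)"
    unfolding vol_borel_def eq
    by (subst sets_measure_of) (use openin_subset[of X.mtopology] in force)+
  then show "F -` S \<inter> space (vol_borel \<kappa> K M) \<in> sets (vol_borel \<kappa> K M)"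
    by (simp add: space_vol_borel)
qed

text \<open>The variance of the increment over \<open>[a, b]\<close> of the process with volatility
  \<open>s\<close>.\<close>

definition ivar :: "(real \<Rightarrow> real) \<Rightarrow> real \<Rightarrow> real \<Rightarrow> real" where
  "ivar s a b = integral {a..b} (\<lambda>u. (s u)\<^sup>2)"

lemma LBINT_eq_integral:
  fixes f :: "real \<Rightarrow> real"
  assumes "continuous_on {a..b} f"
  shows "(LBINT u:{a..b}. f u) = integral {a..b} f"
  using set_borel_integral_eq_integral(2)[OF borel_integrable_atLeastAtMost'[OF assms]] .

lemma vol_class_continuous_subinterval:
  assumes "s \<in> vol_class \<kappa> K M" "0 \<le> a" "b \<le> 1"
  shows "continuous_on {a..b} s"
  using continuous_on_subset[OF vol_class_continuous_on[OF assms(1)]] assms by auto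

lemma LBINT_eq_ivar:
  assumes "s \<in> vol_class \<kappa> K M" "0 \<le> a" "b \<le> 1"
  shows "(LBINT u:{a..b}. (s u)\<^sup>2) = ivar s a b"
  unfolding ivar_def
  by (intro LBINT_eq_integral continuous_intros vol_class_continuous_subinterval[OF assms])

lemma ivar_integrable:
  assumes "s \<in> vol_class \<kappa> K M" "0 \<le> a" "b \<le> 1"
  shows "(\<lambda>u. (s u)\<^sup>2) integrable_on {a..b}"
  by (intro integrable_continuous_interval continuous_intros vol_class_continuous_subinterval[OF assms])

lemma ivar_bounds:
  assumes s: "s \<in> vol_class \<kappa> K M" and ab: "0 \<le> a" "a \<le> b" "b \<le> 1" and "0 \<le> \<kappa>"
  shows "\<kappa>\<^sup>2 * (b - a) \<le> ivar s a b" "ivar s a b \<le> K\<^sup>2 * (b - a)"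
proof -
  have k: "\<kappa> \<le> s u \<and> s u \<le> K" if "u \<in> {a..b}" for u
    using vol_class_bounds[OF s] that ab by simp
  have "integral {a..b} (\<lambda>u. \<kappa>\<^sup>2) \<le> ivar s a b"
    unfolding ivar_def using k \<open>0 \<le> \<kappa>\<close>
    by (intro integral_le ivar_integrable[OF s] ab power_mono) (auto intro: ab)
  then show "\<kappa>\<^sup>2 * (b - a) \<le> ivar s a b" using ab by (simp add: mult.commute)
  have "ivar s a b \<le> integral {a..b} (\<lambda>u. K\<^sup>2)"
    unfolding ivar_def using k \<open>0 \<le> \<kappa>\<close>
    by (intro integral_le ivar_integrable[OF s] ab power_mono) (auto intro: ab order_trans)
  then show "ivar s a b \<le> K\<^sup>2 * (b - a)" using ab by (simp add: mult.commute)
qed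

lemma square_diff_le:
  fixes x y :: real
  assumes "0 \<le> x" "x \<le> K" "0 \<le> y" "y \<le> K" "\<bar>x - y\<bar> \<le> d"
  shows "\<bar>x\<^sup>2 - y\<^sup>2\<bar> \<le> 2 * K * d"
proof -
  have "\<bar>x\<^sup>2 - y\<^sup>2\<bar> = (x + y) * \<bar>x - y\<bar>"
    using assms by (simp add: power2_eq_square square_diff_square_factored abs_mult)
  also have "\<dots> \<le> (2 * K) * d" using assms by (intro mult_mono) auto
  finally show ?thesis .
qed

lemma ivar_diff_le:
  assumes s: "s \<in> vol_class \<kappa> K M" "s' \<in> vol_class \<kappa> K M"
    and ab: "0 \<le> a" "a \<le> b" "b \<le> 1" and "0 \<le> \<kappa>"
    and d: "\<And>u. u \<in> {0..1} \<Longrightarrow> \<bar>s u - s' u\<bar> \<le> d"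
  shows "\<bar>ivar s a b - ivar s' a b\<bar> \<le> 2 * K * d * (b - a)"
proof -
  have "ivar s a b - ivar s' a b = integral {a..b} (\<lambda>u. (s u)\<^sup>2 - (s' u)\<^sup>2)"
    unfolding ivar_def by (intro integral_diff[symmetric] ivar_integrable[OF s(1)] ivar_integrable[OF s(2)] ab)
  moreover have "\<bar>(s u)\<^sup>2 - (s' u)\<^sup>2\<bar> \<le> 2 * K * d" if "u \<in> {a..b}" for u
    using vol_class_bounds[OF s(1), of u] vol_class_bounds[OF s(2), of u] that ab d[of u] \<open>0 \<le> \<kappa>\<close>
    by (intro square_diff_le) auto
  then have "norm (integral {a..b} (\<lambda>u. (s u)\<^sup>2 - (s' u)\<^sup>2)) \<le> (2 * K * d) * (b - a)"
    by (intro integral_bound ab continuous_intros vol_class_continuous_subinterval[OF s(1)]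
        vol_class_continuous_subinterval[OF s(2)]) auto
  ultimately show ?thesis by simp
qed

text \<open>Used to see that a coefficient built from the mean of the squared volatility over a cell
  is a value of the volatility in that cell, so that the Lipschitz bound applies to it.\<close>

lemma ivar_mean_value:
  assumes s: "s \<in> vol_class \<kappa> K M" and ab: "0 \<le> a" "a < b" "b \<le> 1"
  obtains \<xi> where "\<xi> \<in> {a..b}" "ivar s a b = (b - a) * (s \<xi>)\<^sup>2"
proof -
  have c: "continuous_on {a..b} (\<lambda>u. (s u)\<^sup>2)"
    by (intro continuous_intros vol_class_continuous_subinterval[OF s]) (use ab in auto)
  let ?F = "\<lambda>x. integral {a..x} (\<lambda>u. (s u)\<^sup>2)"
  have "(?F has_real_derivative (s x)\<^sup>2) (at x within {a..b})" if "a \<le> x" "x \<le> b" for x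
    using integral_has_vector_derivative[OF c, of x] that
    by (simp add: has_real_derivative_iff_has_vector_derivative)
  then have "(?F has_derivative (\<lambda>h. h * (s x)\<^sup>2)) (at x within {a..b})" if "a \<le> x" "x \<le> b" for x
    using that unfolding has_field_derivative_def by (simp add: mult_commute_abs)
  from mvt_very_simple[OF less_imp_le[OF ab(2)] this]
  obtain \<xi> where "\<xi> \<in> {a..b}" "?F b - ?F a = (b - a) * (s \<xi>)\<^sup>2" by blast
  then show ?thesis using that by (simp add: ivar_def)
qed

lemma ivar_combine:
  assumes s: "s \<in> vol_class \<kappa> K M" and ab: "0 \<le> a" "a \<le> b" "b \<le> c" "c \<le> 1"
  shows "ivar s a b + ivar s b c = ivar s a c"
  unfolding ivar_def by (rule Henstock_Kurzweil_Integration.integral_combine) (use ab ivar_integrable[OF s, of a c] in auto)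

text \<open>The squared distance is treated, since it is Lipschitz for the sup norm: all values in
  the class lie between 0 and \<open>K\<close>. The root is composed afterwards.\<close>

lemma U_nbhd_compl_measurable:
  assumes s0: "s\<^sub>0 \<in> vol_class \<kappa> K M" and \<kappa>: "0 < \<kappa>"
  shows "vol_class \<kappa> K M - U_nbhd \<kappa> K M s\<^sub>0 r \<in> sets (vol_borel \<kappa> K M)"
proof -
  let ?X = "vol_class \<kappa> K M"
  define F where "F s = integral {0..1} (\<lambda>u. (s u - s\<^sub>0 u)\<^sup>2)" for s
  have K: "0 \<le> K" using vol_class_bounds[OF s0, of 0] \<kappa> by auto
  have [measurable]: "F \<in> borel_measurable (vol_borel \<kappa> K M)"
  proof (rule sup_Lipschitz_measurable)
    show "0 \<le> 2 * K" using K by simp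
    fix s s' d
    assume s: "s \<in> ?X" and s': "s' \<in> ?X" and d: "\<And>u. u \<in> {0..1} \<Longrightarrow> \<bar>s u - s' u\<bar> \<le> d"
    have c: "continuous_on {0..1} (\<lambda>u. (s u - s\<^sub>0 u)\<^sup>2)" "continuous_on {0..1} (\<lambda>u. (s' u - s\<^sub>0 u)\<^sup>2)"
      by (intro continuous_intros vol_class_continuous_on[OF s] vol_class_continuous_on[OF s']
          vol_class_continuous_on[OF s0])+
    have "F s - F s' = integral {0..1} (\<lambda>u. (s u - s\<^sub>0 u)\<^sup>2 - (s' u - s\<^sub>0 u)\<^sup>2)"
      unfolding F_def by (intro integral_diff[symmetric] integrable_continuous_interval c)
    moreover have "\<bar>(s u - s\<^sub>0 u)\<^sup>2 - (s' u - s\<^sub>0 u)\<^sup>2\<bar> \<le> 2 * K * d" if u: "u \<in> {0..1}" for u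
    proof -
      have "\<bar>s u - s\<^sub>0 u\<bar> \<le> K" "\<bar>s' u - s\<^sub>0 u\<bar> \<le> K"
        using vol_class_bounds[OF s u] vol_class_bounds[OF s' u] vol_class_bounds[OF s0 u] \<kappa> by linarith+
      moreover have "\<bar>\<bar>s u - s\<^sub>0 u\<bar> - \<bar>s' u - s\<^sub>0 u\<bar>\<bar> \<le> d"
        using d[OF u] by linarith
      ultimately show ?thesis
        using square_diff_le[of "\<bar>s u - s\<^sub>0 u\<bar>" K "\<bar>s' u - s\<^sub>0 u\<bar>" d] by simp
    qed
    then have "norm (integral {0..1} (\<lambda>u. (s u - s\<^sub>0 u)\<^sup>2 - (s' u - s\<^sub>0 u)\<^sup>2)) \<le> (2 * K * d) * (1 - 0)"
      by (intro integral_bound continuous_on_diff c) auto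
    ultimately show "\<bar>F s - F s'\<bar> \<le> 2 * K * d" by simp
  qed
  have "L2_norm01 (\<lambda>u. s u - s\<^sub>0 u) = sqrt (F s)" if "s \<in> ?X" for s
    unfolding L2_norm01_def F_def
    by (subst LBINT_eq_integral) (intro continuous_intros vol_class_continuous_on[OF that]
          vol_class_continuous_on[OF s0] | simp)+
  then have "?X - U_nbhd \<kappa> K M s\<^sub>0 r = {s \<in> space (vol_borel \<kappa> K M). \<not> sqrt (F s) < r}"
    unfolding U_nbhd_def space_vol_borel by auto
  also have "\<dots> \<in> sets (vol_borel \<kappa> K M)" by measurable
  finally show ?thesis .
qed

section \<open>From the L2 distance to differences of cell variances\<close>

lemma sum_of_cell_integrals:
  fixes f :: "real \<Rightarrow> real"
  assumes "continuous_on {0..1} f" "k \<le> n" "1 \<le> n"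
  shows "(\<Sum>i=1..k. integral {(real i - 1) / real n..real i / real n} f) = integral {0..real k / real n} f"
  using assms(2)
proof (induction k)
  case (Suc k)
  have "f integrable_on {0..real (Suc k) / real n}"
    using Suc.prems assms by (intro integrable_continuous_interval continuous_on_subset[OF assms(1)]) auto
  then have "integral {0..real k / real n} f + integral {real k / real n..real (Suc k) / real n} f
      = integral {0..real (Suc k) / real n} f"
    by (intro Henstock_Kurzweil_Integration.integral_combine) (auto simp: divide_right_mono)
  then show ?case using Suc by simp
qed simp

text \<open>On a cell of length \<open>1 / n\<close> the Lipschitz bound keeps the difference
  \<open>f\<close> of the squared volatilities close to its cell average \<open>d i\<close>, and
  dividing \<open>f\<close> by \<open>s + s\<^sub>0\<close>, which is at least
  \<open>2 * \<kappa>\<close>, recovers \<open>s - s\<^sub>0\<close>. The remainder is what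
  averaging over cells may hide.\<close>

lemma L2_dist_le_sum_ivar:
  assumes s: "s \<in> vol_class \<kappa> K M" "s\<^sub>0 \<in> vol_class \<kappa> K M" and \<kappa>: "0 < \<kappa>" and n: "1 \<le> n" and M: "0 \<le> M"
  shows "2 * \<kappa>\<^sup>2 * (L2_norm01 (\<lambda>u. s u - s\<^sub>0 u))\<^sup>2 * real n \<le>
      (\<Sum>i=1..n. (real n * (ivar s ((real i - 1) / real n) (real i / real n)
                        - ivar s\<^sub>0 ((real i - 1) / real n) (real i / real n)))\<^sup>2) + 16 * K\<^sup>2 * M\<^sup>2 / real n"
proof -
  define a where "a i = (real i - 1) / real n" for i :: nat
  define b where "b i = real i / real n" for i :: nat
  define f where "f u = (s u)\<^sup>2 - (s\<^sub>0 u)\<^sup>2" for u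
  define d where "d i = real n * (ivar s (a i) (b i) - ivar s\<^sub>0 (a i) (b i))" for i
  \<comment> \<open>Each of the two squared volatilities oscillates on a cell by at most
    \<open>2 * K * M / n\<close>, hence \<open>f\<close> by at most \<open>C\<close>.\<close>
  define C where "C = 4 * K * M / real n"
  have c: "continuous_on {0..1} s" "continuous_on {0..1} s\<^sub>0"
    using s by (auto intro: vol_class_continuous_on)
  have K: "0 \<le> K" using vol_class_bounds[OF s(1), of 0] \<kappa> by auto
  have cell: "integral {a i..b i} (\<lambda>u. (s u - s\<^sub>0 u)\<^sup>2) \<le> (2 * (d i)\<^sup>2 + 2 * C\<^sup>2) / (4 * \<kappa>\<^sup>2) / real n"
    if i: "i \<in> {1..n}" for i
  proof -
    have ab: "0 \<le> a i" "a i \<le> b i" "b i \<le> 1" "b i - a i = 1 / real n"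
      using i n by (auto simp: a_def b_def field_simps)
    have cf: "continuous_on {a i..b i} f"
      unfolding f_def by (intro continuous_intros continuous_on_subset[OF c(1)] continuous_on_subset[OF c(2)])
        (use ab in auto)
    have d: "d i = real n * integral {a i..b i} f"
      unfolding d_def ivar_def f_def
      by (subst integral_diff) (use ivar_integrable[OF s(1)] ivar_integrable[OF s(2)] ab in auto)
    have lip: "\<bar>f u - f v\<bar> \<le> C" if u: "u \<in> {a i..b i}" and v: "v \<in> {a i..b i}" for u v
    proof -
      have uv: "u \<in> {0..1}" "v \<in> {0..1}" using u v ab by auto
      have "M * \<bar>u - v\<bar> \<le> M * (1 / real n)"
        using u v ab M by (intro mult_left_mono) auto
      then have "\<bar>s u - s v\<bar> \<le> M / real n" "\<bar>s\<^sub>0 u - s\<^sub>0 v\<bar> \<le> M / real n"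
        using vol_class_Lipschitz[OF s(1) uv] vol_class_Lipschitz[OF s(2) uv] by auto
      then have "\<bar>(s u)\<^sup>2 - (s v)\<^sup>2\<bar> \<le> 2 * K * (M / real n)" "\<bar>(s\<^sub>0 u)\<^sup>2 - (s\<^sub>0 v)\<^sup>2\<bar> \<le> 2 * K * (M / real n)"
        using vol_class_bounds[OF s(1) uv(1)] vol_class_bounds[OF s(1) uv(2)] \<kappa>
          vol_class_bounds[OF s(2) uv(1)] vol_class_bounds[OF s(2) uv(2)]
        by (intro square_diff_le; simp)+
      then show ?thesis unfolding f_def C_def by (simp add: abs_le_iff)
    qed
    have near: "\<bar>f u - d i\<bar> \<le> C" if u: "u \<in> {a i..b i}" for u
    proof -
      have "integral {a i..b i} (\<lambda>v. f u - f v) = f u * (b i - a i) - integral {a i..b i} f"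
        using integrable_continuous_interval[OF cf] ab by (subst integral_diff) (auto simp: mult.commute)
      moreover have "norm (integral {a i..b i} (\<lambda>v. f u - f v)) \<le> C * (b i - a i)"
        using lip[OF u] by (intro integral_bound ab continuous_intros cf) auto
      ultimately have "\<bar>f u / real n - integral {a i..b i} f\<bar> \<le> C / real n"
        using ab by simp
      then show ?thesis using n unfolding d by (simp add: abs_le_iff field_simps)
    qed
    have "(s u - s\<^sub>0 u)\<^sup>2 \<le> (2 * (d i)\<^sup>2 + 2 * C\<^sup>2) / (4 * \<kappa>\<^sup>2)" if u: "u \<in> {a i..b i}" for u
    proof -
      have u01: "u \<in> {0..1}" using u ab by auto
      have "f u = (s u + s\<^sub>0 u) * (s u - s\<^sub>0 u)"
        by (simp add: f_def power2_eq_square algebra_simps)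
      then have "(f u)\<^sup>2 = (s u + s\<^sub>0 u)\<^sup>2 * (s u - s\<^sub>0 u)\<^sup>2" by (simp add: power_mult_distrib)
      moreover have "(2 * \<kappa>)\<^sup>2 \<le> (s u + s\<^sub>0 u)\<^sup>2"
        using vol_class_bounds[OF s(1) u01] vol_class_bounds[OF s(2) u01] \<kappa> by (intro power_mono) auto
      ultimately have "4 * \<kappa>\<^sup>2 * (s u - s\<^sub>0 u)\<^sup>2 \<le> (f u)\<^sup>2"
        by (simp add: mult_right_mono)
      moreover have "(f u)\<^sup>2 \<le> 2 * (d i)\<^sup>2 + 2 * C\<^sup>2"
      proof -
        have "(f u - d i)\<^sup>2 \<le> C\<^sup>2" using near[OF u] by (simp add: abs_le_square_iff[symmetric])
        \<comment> \<open>This square is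
          \<open>2 * (f u - d i)\<^sup>2 + 2 * (d i)\<^sup>2 - (f u)\<^sup>2\<close>.\<close>
        moreover have "0 \<le> (f u - 2 * d i)\<^sup>2" by simp
        ultimately show ?thesis by (simp add: power2_eq_square algebra_simps)
      qed
      ultimately show ?thesis using \<kappa> by (simp add: field_simps)
    qed
    then have "integral {a i..b i} (\<lambda>u. (s u - s\<^sub>0 u)\<^sup>2) \<le> integral {a i..b i} (\<lambda>u. (2 * (d i)\<^sup>2 + 2 * C\<^sup>2) / (4 * \<kappa>\<^sup>2))"
      by (intro integral_le integrable_continuous_interval continuous_intros
          continuous_on_subset[OF c(1)] continuous_on_subset[OF c(2)]) (use ab in auto)
    then show ?thesis using ab by (simp add: mult.commute)
  qed
  have cd: "continuous_on {0..1} (\<lambda>u. (s u - s\<^sub>0 u)\<^sup>2)" by (intro continuous_intros c)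
  have "0 \<le> integral {0..1} (\<lambda>u. (s u - s\<^sub>0 u)\<^sup>2)"
    by (intro integral_nonneg integrable_continuous_interval cd) auto
  then have "(L2_norm01 (\<lambda>u. s u - s\<^sub>0 u))\<^sup>2 = integral {0..1} (\<lambda>u. (s u - s\<^sub>0 u)\<^sup>2)"
    unfolding L2_norm01_def LBINT_eq_integral[OF cd] by simp
  also have "\<dots> = (\<Sum>i=1..n. integral {a i..b i} (\<lambda>u. (s u - s\<^sub>0 u)\<^sup>2))"
    using sum_of_cell_integrals[OF cd, of n n] n by (simp add: a_def b_def)
  also have "\<dots> \<le> (\<Sum>i=1..n. (2 * (d i)\<^sup>2 + 2 * C\<^sup>2) / (4 * \<kappa>\<^sup>2) / real n)"
    by (intro sum_mono cell)
  also have "\<dots> = (2 * (\<Sum>i=1..n. (d i)\<^sup>2) + real n * (2 * C\<^sup>2)) / (4 * \<kappa>\<^sup>2) / real n"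
    by (simp add: sum_divide_distrib[symmetric] sum.distrib sum_distrib_left)
  finally have "2 * \<kappa>\<^sup>2 * (L2_norm01 (\<lambda>u. s u - s\<^sub>0 u))\<^sup>2 * real n \<le> (\<Sum>i=1..n. (d i)\<^sup>2) + real n * C\<^sup>2"
    using \<kappa> n by (simp add: field_simps)
  also have "real n * C\<^sup>2 = 16 * K\<^sup>2 * M\<^sup>2 / real n"
    using n by (simp add: C_def power2_eq_square field_simps)
  finally show ?thesis unfolding d_def a_def b_def .
qed

section \<open>Gaussian moments of likelihood ratios\<close>

text \<open>The ratio at \<open>x\<close> of the centred normal densities with variances
  \<open>w\<close> and \<open>v\<close>.\<close>

definition lr :: "real \<Rightarrow> real \<Rightarrow> real \<Rightarrow> real" where
  "lr v w x = sqrt (v / w) * exp (- x\<^sup>2 * (1 / w - 1 / v) / 2)"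

lemma lr_pos: "0 < v \<Longrightarrow> 0 < w \<Longrightarrow> 0 < lr v w x"
  by (simp add: lr_def)

text \<open>The Gaussian means below contain roots of roots, but their fourth powers are rational in
  the variances, so that \<open>1 + z \<le> exp z\<close> can be applied there.\<close>

lemma one_plus_le_exp4:
  fixes a z :: real
  assumes "0 \<le> a" "a ^ 4 \<le> 1 + z" "z \<le> 4 * y"
  shows "a \<le> exp y"
proof -
  have "a ^ 4 \<le> exp (4 * y)"
    using assms exp_ge_add_one_self[of z] by (meson exp_le_cancel_iff order_trans)
  also have "\<dots> = exp y ^ 4" using exp_of_nat_mult[of 4 y] by simp
  finally show ?thesis by (rule power_le_imp_le_base[of _ 3, simplified]) simp
qed

lemma sqrt_lr_eq:
  assumes "0 < v" "0 < w"
  shows "sqrt (lr v w x) = sqrt (sqrt (v / w)) * exp (- (1 / w - 1 / v) / 4 * x\<^sup>2)"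
proof -
  have "exp (- a * t / 2) = (exp (- t / 4 * a))\<^sup>2" for a t :: real
    by (simp add: exp_double[symmetric] mult.commute)
  from this[of "x\<^sup>2" "1 / w - 1 / v"] show ?thesis
    unfolding lr_def real_sqrt_mult by (simp only: real_sqrt_abs abs_exp_cancel)
qed

text \<open>If \<open>Y\<close> is centred normal with variance \<open>v\<close>, then
  \<open>c / sqrt (1 - 2 * l * v)\<close> is the mean of \<open>c * exp (l * Y\<^sup>2)\<close>,
  here the Hellinger affinity of the two normal laws. Its fourth power is
  \<open>4 * v * w / (v + w)\<^sup>2\<close>, that is,
  \<open>1 - ((w - v) / (w + v))\<^sup>2\<close>.\<close>

lemma sqrt_lr_moment:
  assumes "0 < v" "0 < w"
  obtains c l where "0 \<le> c" "2 * l * v < 1" "\<And>x. sqrt (lr v w x) = c * exp (l * x\<^sup>2)"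
    "c / sqrt (1 - 2 * l * v) \<le> exp (- ((w - v) / (w + v))\<^sup>2 / 4)"
proof
  let ?c = "sqrt (sqrt (v / w))" and ?l = "- (1 / w - 1 / v) / 4"
  show "0 \<le> ?c" using assms by simp
  have e: "1 - 2 * ?l * v = (w + v) / (2 * w)" using assms by (simp add: field_simps)
  have pos: "1 - 2 * ?l * v > 0" unfolding e using assms by simp
  then show "2 * ?l * v < 1" by linarith
  show "sqrt (lr v w x) = ?c * exp (?l * x\<^sup>2)" for x
    using sqrt_lr_eq[OF assms] .
  show "?c / sqrt (1 - 2 * ?l * v) \<le> exp (- ((w - v) / (w + v))\<^sup>2 / 4)"
  proof (rule one_plus_le_exp4)
    have "(?c / sqrt (1 - 2 * ?l * v)) ^ 4 = ((?c\<^sup>2)\<^sup>2) / ((sqrt (1 - 2 * ?l * v))\<^sup>2)\<^sup>2"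
      by (simp add: power_divide)
    also have "\<dots> = (v / w) / ((w + v) / (2 * w))\<^sup>2"
      unfolding e using assms by simp
    also have "\<dots> = 1 + - ((w - v) / (w + v))\<^sup>2"
    proof -
      have "(w + v)\<^sup>2 > 0" using assms by simp
      then show ?thesis using assms
        by (simp add: power_divide field_simps) (simp add: power2_eq_square algebra_simps)
    qed
    finally show "(?c / sqrt (1 - 2 * ?l * v)) ^ 4 \<le> 1 + - ((w - v) / (w + v))\<^sup>2" by simp
    show "0 \<le> ?c / sqrt (1 - 2 * ?l * v)" unfolding e using assms by simp
  qed simp
qed

text \<open>With \<open>q = w / w'\<close> and \<open>y = w' / v - 1\<close> the fourth power of the
  mean is \<open>(1 + y) / D\<^sup>2\<close>, where \<open>D = 1 + q * y / 2\<close>. At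
  \<open>q = 1\<close> this is the affinity for \<open>v\<close> and \<open>w'\<close>. Moving
  \<open>w\<close> away from \<open>w'\<close> creates the cross term \<open>(1 - q) * y\<close>,
  which half of the gain quadratic in \<open>y\<close> absorbs at a loss of order
  \<open>(1 - q)\<^sup>2\<close>.\<close>

lemma lr_div_sqrt_lr_moment:
  assumes pos: "0 < v" "0 < w" "0 < w'" and q: "\<bar>w / w' - 1\<bar> \<le> 1 / 2" and B: "w' / v \<le> B"
  obtains c l where "0 \<le> c" "2 * l * v < 1" "\<And>x. lr v w x / sqrt (lr v w' x) = c * exp (l * x\<^sup>2)"
    "c / sqrt (1 - 2 * l * v) \<le> exp (32 * (w / w' - 1)\<^sup>2 - (w' / v - 1)\<^sup>2 / (128 * (1 + B)\<^sup>2))"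
proof
  let ?c = "sqrt (v / w) / sqrt (sqrt (v / w'))" and ?l = "- (1 / w - 1 / v) / 2 + (1 / w' - 1 / v) / 4"
  define q y where "q = w / w'" and "y = w' / v - 1"
  define D where "D = 1 + q * y / 2"
  have qb: "1 / 2 \<le> q" "q \<le> 3 / 2" using q unfolding q_def by linarith+
  have yb: "- 1 < y" "y \<le> B - 1" using pos B unfolding y_def by auto
  have "q * (y + 1) > 0" using yb qb by (intro mult_pos_pos) auto
  \<comment> \<open>\<open>D\<close> equals \<open>1 - q / 2 + q * (y + 1) / 2\<close>, so
    \<open>q \<le> 3 / 2\<close> keeps it away from 0.\<close>
  then have D1: "1 / 4 \<le> D" unfolding D_def using qb by (simp add: algebra_simps)
  have "q * (y + 1) \<le> 3 / 2 * B" using yb qb by (intro mult_mono) auto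
  then have D2: "D \<le> 1 + B" unfolding D_def using qb yb by (simp add: algebra_simps)
  show "0 \<le> ?c" using pos by simp
  have e: "1 - 2 * ?l * v = v / w * D" unfolding D_def q_def y_def using pos
    by (simp add: field_simps)
  have p: "1 - 2 * ?l * v > 0" unfolding e using pos D1 by simp
  then show "2 * ?l * v < 1" by simp
  show "lr v w x / sqrt (lr v w' x) = ?c * exp (?l * x\<^sup>2)" for x
  proof -
    have "sqrt (lr v w' x) = sqrt (sqrt (v / w')) * exp (- (1 / w' - 1 / v) / 4 * x\<^sup>2)"
      using sqrt_lr_eq[OF pos(1,3)] .
    moreover have "exp (- a * t / 2) = exp ((- t / 2 + t' / 4) * a) * exp (- t' / 4 * a)" for a t t' :: real
      by (simp add: exp_add[symmetric] algebra_simps)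
    then have "exp (- x\<^sup>2 * (1 / w - 1 / v) / 2) = exp (?l * x\<^sup>2) * exp (- (1 / w' - 1 / v) / 4 * x\<^sup>2)" .
    ultimately show ?thesis unfolding lr_def by simp
  qed
  let ?num = "(1 - q) * y - q\<^sup>2 * y\<^sup>2 / 4"
  show "?c / sqrt (1 - 2 * ?l * v) \<le> exp (32 * (w / w' - 1)\<^sup>2 - (w' / v - 1)\<^sup>2 / (128 * (1 + B)\<^sup>2))"
  proof (rule one_plus_le_exp4)
    have "(?c / sqrt (1 - 2 * ?l * v)) ^ 4
       = (((sqrt (v / w))\<^sup>2)\<^sup>2 / ((sqrt (sqrt (v / w')))\<^sup>2)\<^sup>2) / ((sqrt (1 - 2 * ?l * v))\<^sup>2)\<^sup>2"
      by (simp add: power_divide power_mult_distrib)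
    also have "\<dots> = ((v / w)\<^sup>2 / (v / w')) / (v / w * D)\<^sup>2"
      using pos p by (simp only: e real_sqrt_pow2 real_sqrt_ge_zero less_imp_le divide_pos_pos)
    also have "\<dots> = (1 + y) / D\<^sup>2"
      using pos D1 by (simp add: y_def power_divide power_mult_distrib field_simps)
    also have "\<dots> = 1 + ?num / D\<^sup>2"
    proof -
      have "1 + y = D\<^sup>2 + ?num" by (simp add: D_def power2_eq_square algebra_simps)
      moreover have "D\<^sup>2 \<noteq> 0" using D1 by simp
      ultimately show ?thesis by (simp add: add_divide_distrib del: power_eq_0_iff)
    qed
    finally show "(?c / sqrt (1 - 2 * ?l * v)) ^ 4 \<le> 1 + ?num / D\<^sup>2" by simp
    have q2: "1 / 4 \<le> q\<^sup>2" using power_mono[of "1/2" q 2] qb by (simp add: power2_eq_square)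
    \<comment> \<open>Young's inequality, weighted so that the cross term uses up exactly half of
      \<open>q\<^sup>2 * y\<^sup>2 / 4\<close>.\<close>
    have "0 \<le> (q * y / 4 - (1 - q) / q)\<^sup>2" by simp
    also have "\<dots> = q\<^sup>2 * y\<^sup>2 / 16 - (1 - q) * y / 2 + (1 - q)\<^sup>2 / q\<^sup>2"
      using qb by (simp add: power2_diff power_mult_distrib power_divide)
    finally have "?num \<le> 2 * ((1 - q)\<^sup>2 / q\<^sup>2) - q\<^sup>2 * y\<^sup>2 / 8" by simp
    moreover have "(1 - q)\<^sup>2 / q\<^sup>2 \<le> (1 - q)\<^sup>2 / (1 / 4)"
      using q2 by (intro divide_left_mono) auto
    moreover have "1 / 4 * y\<^sup>2 \<le> q\<^sup>2 * y\<^sup>2" using q2 by (intro mult_right_mono) auto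
    ultimately have "?num \<le> 8 * (1 - q)\<^sup>2 - y\<^sup>2 / 32" by simp
    then have "?num / D\<^sup>2 \<le> (8 * (1 - q)\<^sup>2 - y\<^sup>2 / 32) / D\<^sup>2"
      by (rule divide_right_mono) simp
    also have "\<dots> = 8 * (1 - q)\<^sup>2 / D\<^sup>2 - y\<^sup>2 / 32 / D\<^sup>2" by (simp add: diff_divide_distrib)
    also have "\<dots> \<le> 8 * (1 - q)\<^sup>2 / (1 / 4)\<^sup>2 - y\<^sup>2 / 32 / (1 + B)\<^sup>2"
      using D1 D2 by (intro diff_mono divide_left_mono power_mono) auto
    \<comment> \<open>The \<open>128\<close> is \<open>8 * 16\<close>, from
      \<open>D \<ge> 1 / 4\<close>. A quarter of both terms gives the constants of the
      exponent.\<close>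
    finally have "?num / D\<^sup>2 \<le> 128 * (1 - q)\<^sup>2 - y\<^sup>2 / (32 * (1 + B)\<^sup>2)"
      by (simp add: power2_eq_square)
    then show "?num / D\<^sup>2 \<le> 4 * (32 * (w / w' - 1)\<^sup>2 - (w' / v - 1)\<^sup>2 / (128 * (1 + B)\<^sup>2))"
      by (simp add: q_def[symmetric] y_def[symmetric] power2_commute[of 1 q])
    show "0 \<le> ?c / sqrt (1 - 2 * ?l * v)" unfolding e using pos D1 by simp
  qed
qed

text \<open>The mean is one plus the chi-square divergence of the two normal laws; with
  \<open>z = v / w - 1\<close> it is \<open>1 / sqrt (1 - z\<^sup>2)\<close>. There is no linear
  term in \<open>z\<close>, which is why the evidence loses only a factor exponential in
  \<open>n\<close> times a squared distance. The bound on \<open>z\<close> keeps the mean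
  finite.\<close>

lemma inverse_lr_moment:
  assumes pos: "0 < v" "0 < w" and q: "\<bar>v / w - 1\<bar> \<le> 1 / 2"
  obtains c l where "0 \<le> c" "2 * l * v < 1" "\<And>x. 1 / lr v w x = c * exp (l * x\<^sup>2)"
    "c / sqrt (1 - 2 * l * v) \<le> exp ((v / w - 1)\<^sup>2)"
proof
  let ?c = "1 / sqrt (v / w)" and ?l = "(1 / w - 1 / v) / 2"
  define z where "z = v / w - 1"
  have z: "- (1 / 2) \<le> z" "z \<le> 1 / 2" using q unfolding z_def by linarith+
  show "0 \<le> ?c" using pos by simp
  have e: "1 - 2 * ?l * v = 1 - z" unfolding z_def using pos by (simp add: field_simps)
  then show "2 * ?l * v < 1" using z by simp
  show "1 / lr v w x = ?c * exp (?l * x\<^sup>2)" for x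
  proof -
    have "exp (t / 2 * a) * exp (- a * t / 2) = 1" for a t :: real
      by (simp add: exp_add[symmetric] mult.commute)
    then have "1 / exp (- x\<^sup>2 * (1 / w - 1 / v) / 2) = exp (?l * x\<^sup>2)"
      by (simp add: divide_eq_eq)
    then show ?thesis unfolding lr_def by (metis mult_1_right times_divide_times_eq)
  qed
  have vw: "v / w = 1 + z" by (simp add: z_def)
  have z2: "z\<^sup>2 \<le> 1 / 4"
    using power_mono[of "\<bar>z\<bar>" "1 / 2" 2] z by (simp add: power_divide abs_le_iff)
  show "?c / sqrt (1 - 2 * ?l * v) \<le> exp ((v / w - 1)\<^sup>2)"
  proof (rule one_plus_le_exp4)
    have "(?c / sqrt (1 - 2 * ?l * v)) ^ 4 = 1 / ((sqrt (v / w))\<^sup>2)\<^sup>2 / ((sqrt (1 - 2 * ?l * v))\<^sup>2)\<^sup>2"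
      by (simp add: power_divide power_mult_distrib)
    also have "\<dots> = 1 / (1 - z\<^sup>2)\<^sup>2"
      using z unfolding e vw by (simp add: power_mult_distrib[symmetric]) (simp add: algebra_simps power2_eq_square)
    also have "\<dots> \<le> 1 + 4 * z\<^sup>2"
    proof -
      define t where "t = z\<^sup>2"
      have t: "0 \<le> t" "t \<le> 1 / 4" using z2 by (auto simp: t_def)
      have "(1 + 4 * t) * (1 - t)\<^sup>2 - 1 = t * (2 - 7 * t + 4 * t\<^sup>2)"
        by (simp add: power2_eq_square algebra_simps)
      also have "\<dots> \<ge> 0"
        using t zero_le_power2[of t] by (intro mult_nonneg_nonneg) linarith+
      finally show ?thesis using t unfolding t_def[symmetric] by (simp add: pos_divide_le_eq)
    qed
    finally show "(?c / sqrt (1 - 2 * ?l * v)) ^ 4 \<le> 1 + 4 * z\<^sup>2" .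
    show "0 \<le> ?c / sqrt (1 - 2 * ?l * v)" unfolding e using pos z by simp
  qed (simp add: z_def)
qed

text \<open>Tilting the density by \<open>exp (l * x\<^sup>2)\<close> gives \<open>1 / r\<close>
  times the centred normal density with deviation \<open>\<sigma> / r\<close>.\<close>

lemma normal_exp_square_moment:
  assumes D: "distributed P lborel Y (normal_density 0 \<sigma>)" and \<sigma>: "0 < \<sigma>" and l: "2 * l * \<sigma>\<^sup>2 < 1" and "0 \<le> c"
  shows "(\<integral>\<^sup>+\<omega>. ennreal (c * exp (l * (Y \<omega>)\<^sup>2)) \<partial>P) = ennreal (c / sqrt (1 - 2 * l * \<sigma>\<^sup>2))"
proof -
  define r where "r = sqrt (1 - 2 * l * \<sigma>\<^sup>2)"
  have r: "0 < r" "r\<^sup>2 = 1 - 2 * l * \<sigma>\<^sup>2" using l by (auto simp: r_def)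
  define \<tau> where "\<tau> = \<sigma> / r"
  have \<tau>: "0 < \<tau>" using r \<sigma> by (simp add: \<tau>_def)
  have eq: "normal_density 0 \<sigma> x * (c * exp (l * x\<^sup>2)) = c / r * normal_density 0 \<tau> x" for x
  proof -
    have "- x\<^sup>2 / (2 * \<sigma>\<^sup>2) + l * x\<^sup>2 = - x\<^sup>2 / (2 * \<tau>\<^sup>2)"
    proof -
      have "- x\<^sup>2 / (2 * \<tau>\<^sup>2) = - x\<^sup>2 * r\<^sup>2 / (2 * \<sigma>\<^sup>2)"
        using \<sigma> r(1) by (simp add: \<tau>_def power_divide)
      then show ?thesis unfolding r(2) using \<sigma> by (simp add: field_simps)
    qed
    then have "exp (- x\<^sup>2 / (2 * \<sigma>\<^sup>2)) * exp (l * x\<^sup>2) = exp (- x\<^sup>2 / (2 * \<tau>\<^sup>2))"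
      by (simp add: exp_add[symmetric])
    moreover have "sqrt (2 * pi * \<sigma>\<^sup>2) = r * sqrt (2 * pi * \<tau>\<^sup>2)"
      using \<sigma> r(1) by (simp add: \<tau>_def real_sqrt_mult)
    ultimately show ?thesis unfolding normal_density_def using r by (simp add: field_simps)
  qed
  have "(\<integral>\<^sup>+\<omega>. ennreal (c * exp (l * (Y \<omega>)\<^sup>2)) \<partial>P)
      = (\<integral>\<^sup>+x. ennreal (normal_density 0 \<sigma> x) * ennreal (c * exp (l * x\<^sup>2)) \<partial>lborel)"
    by (rule distributed_nn_integral[OF D, symmetric]) simp
  also have "\<dots> = (\<integral>\<^sup>+x. ennreal (c / r) * ennreal (normal_density 0 \<tau> x) \<partial>lborel)"
    using r \<open>0 \<le> c\<close> by (simp add: ennreal_mult'[symmetric] ennreal_mult''[symmetric] eq)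
  also have "\<dots> = ennreal (c / r) * (\<integral>\<^sup>+x. ennreal (normal_density 0 \<tau> x) \<partial>lborel)"
    by (rule nn_integral_cmult) simp
  also have "(\<integral>\<^sup>+x. ennreal (normal_density 0 \<tau> x) \<partial>lborel) = 1"
    using \<tau> by (subst nn_integral_eq_integral) auto
  finally show ?thesis by (simp add: r_def)
qed

section \<open>Deterministic integrands and the isometry\<close>

text \<open>A list of pairs stands for a linear combination of indicators of intervals that all
  start at 0. Differences are then list operations, without a common refinement of
  partitions.\<close>

definition elem_fun :: "(real \<times> real) list \<Rightarrow> real \<Rightarrow> real" where
  "elem_fun xs u = (\<Sum>(a, t)\<leftarrow>xs. a * indicator {0<..t} u)"

definition elem_int :: "(real \<Rightarrow> 'w \<Rightarrow> real) \<Rightarrow> (real \<times> real) list \<Rightarrow> 'w \<Rightarrow> real" where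
  "elem_int W xs \<omega> = (\<Sum>(a, t)\<leftarrow>xs. a * W t \<omega>)"

definition elem_diff :: "(real \<times> real) list \<Rightarrow> (real \<times> real) list \<Rightarrow> (real \<times> real) list" where
  "elem_diff xs ys = xs @ map (\<lambda>(a, t). (- a, t)) ys"

lemma elem_simps [simp]:
  "elem_fun [] u = 0" "elem_fun ((a, t) # xs) u = a * indicator {0<..t} u + elem_fun xs u"
  "elem_int W [] \<omega> = 0" "elem_int W ((a, t) # xs) \<omega> = a * W t \<omega> + elem_int W xs \<omega>"
  by (simp_all add: elem_fun_def elem_int_def)

lemma elem_append [simp]:
  "elem_fun (xs @ ys) u = elem_fun xs u + elem_fun ys u"
  "elem_int W (xs @ ys) \<omega> = elem_int W xs \<omega> + elem_int W ys \<omega>"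
  by (simp_all add: elem_fun_def elem_int_def)

lemma elem_diff_simps [simp]:
  "elem_fun (elem_diff xs ys) u = elem_fun xs u - elem_fun ys u"
  "elem_int W (elem_diff xs ys) \<omega> = elem_int W xs \<omega> - elem_int W ys \<omega>"
  "snd ` set (elem_diff xs ys) = snd ` set xs \<union> snd ` set ys"
proof -
  have "elem_fun (map (\<lambda>(a, t). (- a, t)) ys) u = - elem_fun ys u" by (induction ys) auto
  then show "elem_fun (elem_diff xs ys) u = elem_fun xs u - elem_fun ys u" by (simp add: elem_diff_def)
  have "elem_int W (map (\<lambda>(a, t). (- a, t)) ys) \<omega> = - elem_int W ys \<omega>" by (induction ys) auto
  then show "elem_int W (elem_diff xs ys) \<omega> = elem_int W xs \<omega> - elem_int W ys \<omega>" by (simp add: elem_diff_def)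
  show "snd ` set (elem_diff xs ys) = snd ` set xs \<union> snd ` set ys"
    by (force simp: elem_diff_def image_iff)
qed

lemma elem_fun_measurable [measurable]: "elem_fun xs \<in> borel_measurable borel"
proof (induction xs)
  case Nil
  then show ?case by (simp add: elem_fun_def)
next
  case (Cons x xs)
  obtain a t where x: "x = (a, t)" by (cases x)
  have "elem_fun (x # xs) = (\<lambda>u. a * indicator {0<..t} u + elem_fun xs u)"
    by (simp add: x fun_eq_iff)
  then show ?case using Cons by simp
qed

text \<open>Each cell contributes two entries, the indicator of \<open>{p k<..p (Suc k)}\<close>
  being a difference of indicators of intervals from 0. The two integrals agree at every outcome,
  not just almost surely.\<close>

lemma step_fun_as_elem:
  assumes "mono_on {..k} p" "0 \<le> p 0"
  obtains xs where "snd ` set xs \<subseteq> p ` {..k}" "elem_fun xs = step_fun k p c"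
    "\<And>W :: real \<Rightarrow> 'w \<Rightarrow> real. elem_int W xs = step_integral W k p c"
proof -
  have "\<exists>xs. snd ` set xs \<subseteq> p ` {..k} \<and> elem_fun xs = step_fun k p c \<and>
    (\<forall>W :: real \<Rightarrow> 'w \<Rightarrow> real. elem_int W xs = step_integral W k p c)"
    using assms(1)
  proof (induction k)
    case 0
    show ?case by (intro exI[of _ "[]"]) (auto simp: step_fun_def step_integral_def)
  next
    case (Suc k)
    have "mono_on {..k} p" using Suc.prems by (rule mono_on_subset) auto
    from Suc.IH[OF this] obtain xs where xs: "snd ` set xs \<subseteq> p ` {..k}" "elem_fun xs = step_fun k p c"
      "\<And>W :: real \<Rightarrow> 'w \<Rightarrow> real. elem_int W xs = step_integral W k p c" by blast
    have le: "p 0 \<le> p k" "p k \<le> p (Suc k)"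
      using Suc.prems by (auto intro: mono_onD)
    have ind: "(indicator {p k<..p (Suc k)} u :: real)
        = indicator {0<..p (Suc k)} u - indicator {0<..p k} u" for u
      using le assms(2) by (auto simp: indicator_def)
    show ?case
    proof (intro exI[of _ "(c k, p (Suc k)) # (- c k, p k) # xs"] conjI allI ext)
      show "snd ` set ((c k, p (Suc k)) # (- c k, p k) # xs) \<subseteq> p ` {..Suc k}"
        using xs(1) by (auto simp: atMost_Suc)
      show "elem_fun ((c k, p (Suc k)) # (- c k, p k) # xs) u = step_fun (Suc k) p c u" for u
        using xs(2) by (simp add: step_fun_def ind algebra_simps)
      show "elem_int W ((c k, p (Suc k)) # (- c k, p k) # xs) \<omega> = step_integral W (Suc k) p c \<omega>"
        for W :: "real \<Rightarrow> 'w \<Rightarrow> real" and \<omega>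
        using xs(3) by (simp add: step_integral_def algebra_simps)
    qed
  qed
  then show ?thesis using that by blast
qed

section \<open>Second moments of Brownian motion and the isometry\<close>

lemma std_brownian_motionD:
  assumes "std_brownian_motion \<Omega> W"
  shows "prob_space \<Omega>" "t \<in> {0..1} \<Longrightarrow> W t \<in> borel_measurable \<Omega>" "AE \<omega> in \<Omega>. W 0 \<omega> = 0"
    "\<lbrakk>0 \<le> r; r < t; t \<le> 1\<rbrakk> \<Longrightarrow>
       distributed \<Omega> lborel (\<lambda>\<omega>. W t \<omega> - W r \<omega>) (normal_density 0 (sqrt (t - r)))"
    "\<lbrakk>mono_on {..k} p; p ` {..k} \<subseteq> {0..1}\<rbrakk> \<Longrightarrow>
       prob_space.indep_vars \<Omega> (\<lambda>_. borel) (\<lambda>i \<omega>. W (p (Suc i)) \<omega> - W (p i) \<omega>) {..<k::nat}"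
  using assms unfolding std_brownian_motion_def by blast+

lemma centred_normal_moments:
  assumes D: "distributed P lborel Y (normal_density 0 \<sigma>)" and \<sigma>: "0 < \<sigma>"
  shows "integrable P Y" "(\<integral>\<omega>. Y \<omega> \<partial>P) = 0" "integrable P (\<lambda>\<omega>. (Y \<omega>)\<^sup>2)" "(\<integral>\<omega>. (Y \<omega>)\<^sup>2 \<partial>P) = \<sigma>\<^sup>2"
proof -
  show "integrable P Y"
    using distributed_integrable[OF D, of "\<lambda>x. x"] integrable_normal_moment[OF \<sigma>, of 0 1] by simp
  show "(\<integral>\<omega>. Y \<omega> \<partial>P) = 0"
    using distributed_integral[OF D, of "\<lambda>x. x"] integral_normal_moment_nz_1[OF \<sigma>, of 0] by simp
  show "integrable P (\<lambda>\<omega>. (Y \<omega>)\<^sup>2)"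
    using distributed_integrable[OF D, of "\<lambda>x. x\<^sup>2"] integrable_normal_moment[OF \<sigma>, of 0 2] by simp
  show "(\<integral>\<omega>. (Y \<omega>)\<^sup>2 \<partial>P) = \<sigma>\<^sup>2"
    using distributed_integral[OF D, of "\<lambda>x. x\<^sup>2"] integral_normal_moment_even[OF \<sigma>, of 0 1] \<sigma>
    by (simp add: fact_numeral)
qed

lemma brownian_second_moment:
  assumes W: "std_brownian_motion \<Omega> W" and t: "t \<in> {0..1}"
  shows "integrable \<Omega> (\<lambda>\<omega>. (W t \<omega>)\<^sup>2)" "(\<integral>\<omega>. (W t \<omega>)\<^sup>2 \<partial>\<Omega>) = t"
proof -
  note [measurable] = std_brownian_motionD(2)[OF W]
  note W0 = std_brownian_motionD(3)[OF W]
  have m: "W t \<in> borel_measurable \<Omega>" "W 0 \<in> borel_measurable \<Omega>" using t by auto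
  have "integrable \<Omega> (\<lambda>\<omega>. (W t \<omega>)\<^sup>2) \<and> (\<integral>\<omega>. (W t \<omega>)\<^sup>2 \<partial>\<Omega>) = t"
  \<comment> \<open>Normality is available only for increments over intervals of positive
    length.\<close>
  proof (cases "t = 0")
    case True
    have "AE \<omega> in \<Omega>. (W t \<omega>)\<^sup>2 = 0" using W0 True by auto
    then have "integrable \<Omega> (\<lambda>\<omega>. (W t \<omega>)\<^sup>2) \<longleftrightarrow> integrable \<Omega> (\<lambda>\<omega>. 0 :: real)"
      "(\<integral>\<omega>. (W t \<omega>)\<^sup>2 \<partial>\<Omega>) = (\<integral>\<omega>. 0 \<partial>\<Omega>)"
      by (intro integrable_cong_AE integral_cong_AE; use m in simp)+
    then show ?thesis using True by simp
  next
    case False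
    then have t0: "0 < t" using t by auto
    note mom = centred_normal_moments[OF std_brownian_motionD(4)[OF W order.refl t0]]
    have "AE \<omega> in \<Omega>. (W t \<omega>)\<^sup>2 = (W t \<omega> - W 0 \<omega>)\<^sup>2" using W0 by auto
    then have "integrable \<Omega> (\<lambda>\<omega>. (W t \<omega>)\<^sup>2) \<longleftrightarrow> integrable \<Omega> (\<lambda>\<omega>. (W t \<omega> - W 0 \<omega>)\<^sup>2)"
      "(\<integral>\<omega>. (W t \<omega>)\<^sup>2 \<partial>\<Omega>) = (\<integral>\<omega>. (W t \<omega> - W 0 \<omega>)\<^sup>2 \<partial>\<Omega>)"
      by (intro integrable_cong_AE integral_cong_AE; use m in simp)+
    then show ?thesis using mom(3,4) t t0 by simp
  qed
  then show "integrable \<Omega> (\<lambda>\<omega>. (W t \<omega>)\<^sup>2)" "(\<integral>\<omega>. (W t \<omega>)\<^sup>2 \<partial>\<Omega>) = t" by auto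
qed

lemma integrable_mult_L2:
  fixes f g :: "'a \<Rightarrow> real"
  assumes [measurable]: "f \<in> borel_measurable P" "g \<in> borel_measurable P"
    and "integrable P (\<lambda>x. (f x)\<^sup>2)" "integrable P (\<lambda>x. (g x)\<^sup>2)"
  shows "integrable P (\<lambda>x. f x * g x)"
proof (rule Bochner_Integration.integrable_bound)
  show "integrable P (\<lambda>x. (f x)\<^sup>2 + (g x)\<^sup>2)" using assms by simp
  show "AE x in P. norm (f x * g x) \<le> norm ((f x)\<^sup>2 + (g x)\<^sup>2)"
  proof (intro AE_I2)
    fix x
    have "0 \<le> (\<bar>f x\<bar> - \<bar>g x\<bar>)\<^sup>2" by simp
    then have "2 * (\<bar>f x\<bar> * \<bar>g x\<bar>) \<le> (f x)\<^sup>2 + (g x)\<^sup>2" by (simp add: power2_diff)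
    moreover have "0 \<le> \<bar>f x\<bar> * \<bar>g x\<bar>" by simp
    ultimately show "norm (f x * g x) \<le> norm ((f x)\<^sup>2 + (g x)\<^sup>2)"
      unfolding real_norm_def abs_mult by linarith
  qed
qed simp

text \<open>For \<open>s < t\<close>, almost surely \<open>W s * W t\<close> is
  \<open>(W s - W 0) * (W t - W s)\<close> plus the square of \<open>W s\<close>, and the product of
  the independent centred increments has mean 0.\<close>

lemma brownian_covariance:
  assumes W: "std_brownian_motion \<Omega> W" and st: "s \<in> {0..1}" "t \<in> {0..1}"
  shows "integrable \<Omega> (\<lambda>\<omega>. W s \<omega> * W t \<omega>)" "(\<integral>\<omega>. W s \<omega> * W t \<omega> \<partial>\<Omega>) = min s t"
proof -
  interpret prob_space \<Omega> using std_brownian_motionD(1)[OF W] .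
  have int: "integrable \<Omega> (\<lambda>\<omega>. W s \<omega> * W t \<omega>)" if "s \<in> {0..1}" "t \<in> {0..1}" for s t
    using that by (intro integrable_mult_L2 brownian_second_moment[OF W] std_brownian_motionD(2)[OF W])
  then show "integrable \<Omega> (\<lambda>\<omega>. W s \<omega> * W t \<omega>)" using st .
  have *: "(\<integral>\<omega>. W s \<omega> * W t \<omega> \<partial>\<Omega>) = s" if st: "s \<in> {0..1}" "t \<in> {0..1}" "s < t" for s t
  proof -
    have m: "W s \<in> borel_measurable \<Omega>" "W t \<in> borel_measurable \<Omega>" "W 0 \<in> borel_measurable \<Omega>"
      using st std_brownian_motionD(2)[OF W] by auto
    have D: "distributed \<Omega> lborel (\<lambda>\<omega>. W t \<omega> - W s \<omega>) (normal_density 0 (sqrt (t - s)))"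
      using std_brownian_motionD(4)[OF W] st by simp
    have zero: "(\<integral>\<omega>. (W s \<omega> - W 0 \<omega>) * (W t \<omega> - W s \<omega>) \<partial>\<Omega>) = 0"
    proof (cases "s = 0")
      case False
      then have s0: "0 < s" using st by auto
      define p where "p i = (if i = 0 then 0 else if i = 1 then s else t)" for i :: nat
      have "mono_on {..2} p" using st by (auto simp: p_def mono_on_def)
      moreover have "p ` {..2} \<subseteq> {0..1}" using st by (auto simp: p_def)
      ultimately have ind: "indep_vars (\<lambda>_. borel) (\<lambda>i \<omega>. W (p (Suc i)) \<omega> - W (p i) \<omega>) {..<2::nat}"
        by (rule std_brownian_motionD(5)[OF W])
      have "integrable \<Omega> (\<lambda>\<omega>. W (p (Suc i)) \<omega> - W (p i) \<omega>)" if "i \<in> {..<2}" for i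
      proof -
        have "i = 0 \<or> i = 1" using that by auto
        then show ?thesis
          using centred_normal_moments(1)[OF D] st s0
            centred_normal_moments(1)[OF std_brownian_motionD(4)[OF W order.refl s0]]
          by (auto simp: p_def)
      qed
      then have "(\<integral>\<omega>. (\<Prod>i<2. W (p (Suc i)) \<omega> - W (p i) \<omega>) \<partial>\<Omega>)
          = (\<Prod>i<2. \<integral>\<omega>. W (p (Suc i)) \<omega> - W (p i) \<omega> \<partial>\<Omega>)"
        by (intro indep_vars_lebesgue_integral ind) auto
      then show ?thesis using centred_normal_moments(2)[OF D] st
        by (simp add: numeral_2_eq_2 p_def)
    next
      case True
      then show ?thesis by simp
    qed
    have "(\<integral>\<omega>. W s \<omega> * W t \<omega> \<partial>\<Omega>)
        = (\<integral>\<omega>. (W s \<omega> - W 0 \<omega>) * (W t \<omega> - W s \<omega>) + (W s \<omega>)\<^sup>2 \<partial>\<Omega>)"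
    proof (rule integral_cong_AE)
      show "AE \<omega> in \<Omega>. W s \<omega> * W t \<omega> = (W s \<omega> - W 0 \<omega>) * (W t \<omega> - W s \<omega>) + (W s \<omega>)\<^sup>2"
        using std_brownian_motionD(3)[OF W]
        by eventually_elim (simp add: algebra_simps power2_eq_square)
    qed (use m in measurable)
    also have "\<dots> = (\<integral>\<omega>. (W s \<omega> - W 0 \<omega>) * (W t \<omega> - W s \<omega>) \<partial>\<Omega>) + (\<integral>\<omega>. (W s \<omega>)\<^sup>2 \<partial>\<Omega>)"
    proof (rule Bochner_Integration.integral_add)
      have "integrable \<Omega> (\<lambda>\<omega>. W s \<omega> * W t \<omega> - W s \<omega> * W s \<omega> - W 0 \<omega> * W t \<omega> + W 0 \<omega> * W s \<omega>)"
        using st by (intro Bochner_Integration.integrable_add Bochner_Integration.integrable_diff int) auto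
      then show "integrable \<Omega> (\<lambda>\<omega>. (W s \<omega> - W 0 \<omega>) * (W t \<omega> - W s \<omega>))"
        by (simp add: algebra_simps)
    qed (use brownian_second_moment[OF W] st in auto)
    finally show ?thesis using zero brownian_second_moment(2)[OF W] st by simp
  qed
  show "(\<integral>\<omega>. W s \<omega> * W t \<omega> \<partial>\<Omega>) = min s t"
    using *[of s t] *[of t s] st brownian_second_moment(2)[OF W, of s]
    by (cases s t rule: linorder_cases) (auto simp: mult.commute power2_eq_square)
qed

lemma elem_int_measurable:
  assumes W: "std_brownian_motion \<Omega> W" and "snd ` set xs \<subseteq> {0..1}"
  shows "elem_int W xs \<in> borel_measurable \<Omega>"
  using assms(2)
proof (induction xs)
  case Nil
  then show ?case by (simp add: elem_int_def)
next
  case (Cons x xs)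
  obtain a t where x: "x = (a, t)" by (cases x)
  have "elem_int W (x # xs) = (\<lambda>\<omega>. a * W t \<omega> + elem_int W xs \<omega>)"
    by (simp add: x fun_eq_iff)
  then show ?case using Cons std_brownian_motionD(2)[OF W, of t] by (simp add: x)
qed

text \<open>Both sides are bilinear, so two nested inductions reduce the claim to single intervals.
  There \<open>min s t\<close> is both the covariance of \<open>W s\<close> and \<open>W t\<close>
  and the length of the intersection of the intervals.\<close>

lemma elem_isometry_bilinear:
  assumes W: "std_brownian_motion \<Omega> W" and "snd ` set xs \<subseteq> {0..1}" "snd ` set ys \<subseteq> {0..1}"
  shows "integrable \<Omega> (\<lambda>\<omega>. elem_int W xs \<omega> * elem_int W ys \<omega>) \<and>
    integrable lborel (\<lambda>u. elem_fun xs u * elem_fun ys u) \<and>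
    (\<integral>\<omega>. elem_int W xs \<omega> * elem_int W ys \<omega> \<partial>\<Omega>) = (\<integral>u. elem_fun xs u * elem_fun ys u \<partial>lborel)"
  using assms(2)
proof (induction xs)
  case (Cons x xs)
  obtain a s where x: "x = (a, s)" by (cases x)
  have s: "s \<in> {0..1}" using Cons.prems x by auto
  have one: "integrable \<Omega> (\<lambda>\<omega>. W s \<omega> * elem_int W ys \<omega>) \<and>
    integrable lborel (\<lambda>u. indicator {0<..s} u * elem_fun ys u) \<and>
    (\<integral>\<omega>. W s \<omega> * elem_int W ys \<omega> \<partial>\<Omega>) = (\<integral>u. indicator {0<..s} u * elem_fun ys u \<partial>lborel)"
    using assms(3)
  proof (induction ys)
    case (Cons y ys)
    obtain b t where y: "y = (b, t)" by (cases y)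
    have t: "t \<in> {0..1}" using Cons.prems y by auto
    have IH: "integrable \<Omega> (\<lambda>\<omega>. W s \<omega> * elem_int W ys \<omega>)"
      "integrable lborel (\<lambda>u. indicator {0<..s} u * elem_fun ys u)"
      "(\<integral>\<omega>. W s \<omega> * elem_int W ys \<omega> \<partial>\<Omega>) = (\<integral>u. indicator {0<..s} u * elem_fun ys u \<partial>lborel)"
      using Cons by auto
    have ind: "(indicator {0<..s} u * indicator {0<..t} u :: real) = indicator {0<..min s t} u" for u
      by (auto simp: indicator_def)
    have iind: "integrable lborel (indicator {0<..min s t} :: real \<Rightarrow> real)"
      "(\<integral>u. indicator {0<..min s t} u \<partial>lborel) = min s t"
      using s t by (auto simp: min_def)
    have e1: "(\<lambda>\<omega>. W s \<omega> * elem_int W (y # ys) \<omega>)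
        = (\<lambda>\<omega>. b * (W s \<omega> * W t \<omega>) + W s \<omega> * elem_int W ys \<omega>)"
      by (auto simp: y fun_eq_iff algebra_simps)
    have e2: "(\<lambda>u. indicator {0<..s} u * elem_fun (y # ys) u)
        = (\<lambda>u. b * indicator {0<..min s t} u + indicator {0<..s} u * elem_fun ys u)"
      by (auto simp: y fun_eq_iff algebra_simps ind[symmetric])
    show ?case
      unfolding e1 e2 using IH brownian_covariance[OF W s t] iind
      by (simp add: Bochner_Integration.integral_add)
  qed simp
  have IH: "integrable \<Omega> (\<lambda>\<omega>. elem_int W xs \<omega> * elem_int W ys \<omega>)"
    "integrable lborel (\<lambda>u. elem_fun xs u * elem_fun ys u)"
    "(\<integral>\<omega>. elem_int W xs \<omega> * elem_int W ys \<omega> \<partial>\<Omega>) = (\<integral>u. elem_fun xs u * elem_fun ys u \<partial>lborel)"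
    using Cons by auto
  have e1: "(\<lambda>\<omega>. elem_int W (x # xs) \<omega> * elem_int W ys \<omega>)
      = (\<lambda>\<omega>. a * (W s \<omega> * elem_int W ys \<omega>) + elem_int W xs \<omega> * elem_int W ys \<omega>)"
    by (auto simp: x fun_eq_iff algebra_simps)
  have e2: "(\<lambda>u. elem_fun (x # xs) u * elem_fun ys u)
      = (\<lambda>u. a * (indicator {0<..s} u * elem_fun ys u) + elem_fun xs u * elem_fun ys u)"
    by (auto simp: x fun_eq_iff algebra_simps)
  show ?case unfolding e1 e2 using IH one by (simp add: Bochner_Integration.integral_add)
qed simp

lemma elem_isometry:
  assumes W: "std_brownian_motion \<Omega> W" and xs: "snd ` set xs \<subseteq> {0..1}"
  shows "(\<integral>\<^sup>+\<omega>. ennreal ((elem_int W xs \<omega>)\<^sup>2) \<partial>\<Omega>) = (\<integral>\<^sup>+u. ennreal ((elem_fun xs u)\<^sup>2) \<partial>lborel)"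
  using elem_isometry_bilinear[OF W xs xs]
  by (subst (1 2) nn_integral_eq_integral) (auto simp: power2_eq_square)

section \<open>Mean-square approximation by elementary integrals\<close>

lemma nn_integral_sq_diff3_le:
  fixes f g h :: "'a \<Rightarrow> real"
  assumes [measurable]: "f \<in> borel_measurable P" "g \<in> borel_measurable P" "h \<in> borel_measurable P"
  shows "(\<integral>\<^sup>+x. ennreal ((f x - g x - h x)\<^sup>2) \<partial>P) \<le>
    3 * ((\<integral>\<^sup>+x. ennreal ((f x)\<^sup>2) \<partial>P) + (\<integral>\<^sup>+x. ennreal ((g x)\<^sup>2) \<partial>P) + (\<integral>\<^sup>+x. ennreal ((h x)\<^sup>2) \<partial>P))"
proof -
  have "(a - b - c)\<^sup>2 \<le> 3 * (a\<^sup>2 + b\<^sup>2 + c\<^sup>2)" for a b c :: real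
  proof -
    \<comment> \<open>The right side of the claim minus its left side is exactly this sum of
      squares.\<close>
    have "0 \<le> (a + b)\<^sup>2 + (a + c)\<^sup>2 + (b - c)\<^sup>2" by simp
    then show ?thesis by (simp add: power2_eq_square algebra_simps)
  qed
  then have "(\<integral>\<^sup>+x. ennreal ((f x - g x - h x)\<^sup>2) \<partial>P) \<le> (\<integral>\<^sup>+x. ennreal (3 * ((f x)\<^sup>2 + (g x)\<^sup>2 + (h x)\<^sup>2)) \<partial>P)"
    by (intro nn_integral_mono ennreal_leI)
  also have "\<dots> = (\<integral>\<^sup>+x. 3 * (ennreal ((f x)\<^sup>2) + ennreal ((g x)\<^sup>2) + ennreal ((h x)\<^sup>2)) \<partial>P)"
    by (intro nn_integral_cong) (simp only: ennreal_mult'[of 3] zero_le_numeral ennreal_plus zero_le_power2 add_nonneg_nonneg ennreal_numeral)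
  also have "\<dots> = 3 * ((\<integral>\<^sup>+x. ennreal ((f x)\<^sup>2) \<partial>P) + (\<integral>\<^sup>+x. ennreal ((g x)\<^sup>2) \<partial>P) + (\<integral>\<^sup>+x. ennreal ((h x)\<^sup>2) \<partial>P))"
    by (simp add: nn_integral_cmult nn_integral_add)
  finally show ?thesis .
qed

lemma tendsto_zero_three:
  fixes X a b c :: "nat \<Rightarrow> ennreal"
  assumes "\<And>j. X j \<le> 3 * (a j + b j + c j)" "a \<longlonglongrightarrow> 0" "b \<longlonglongrightarrow> 0" "c \<longlonglongrightarrow> 0"
  shows "X \<longlonglongrightarrow> 0"
proof -
  have "(\<lambda>j. a j + b j + c j) \<longlonglongrightarrow> 0 + 0 + 0" by (intro tendsto_add assms)
  then have lim: "(\<lambda>j. 3 * (a j + b j + c j)) \<longlonglongrightarrow> 3 * (0 + 0 + 0)"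
    by (intro ennreal_tendsto_cmult) simp_all
  show ?thesis
  proof (rule tendsto_sandwich)
    show "\<forall>\<^sub>F j in sequentially. 0 \<le> X j" by simp
    show "\<forall>\<^sub>F j in sequentially. X j \<le> 3 * (a j + b j + c j)"
      by (intro always_eventually allI assms(1))
    show "(\<lambda>j. 3 * (a j + b j + c j)) \<longlonglongrightarrow> 0" using lim by simp
  qed simp
qed

text \<open>Restates the defining approximation in list form on the whole line. The closed interval
  of the definition and the half-open one here differ only in the null set
  \<open>{0}\<close>.\<close>

lemma wiener_integral_elem_approx:
  fixes W :: "real \<Rightarrow> 'a \<Rightarrow> real"
  assumes "is_wiener_integral \<Omega> W f t Y" "t \<in> {0..1}"
  obtains xs where "\<And>j. snd ` set (xs j) \<subseteq> {0..1}"
    "(\<lambda>j. \<integral>\<^sup>+u. ennreal ((elem_fun (xs j) u - f u * indicator {0<..t} u)\<^sup>2) \<partial>lborel) \<longlonglongrightarrow> 0"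
    "(\<lambda>j. \<integral>\<^sup>+\<omega>. ennreal ((elem_int W (xs j) \<omega> - Y \<omega>)\<^sup>2) \<partial>\<Omega>) \<longlonglongrightarrow> 0"
proof -
  obtain k p c where mono: "\<And>j. mono_on {..k j} (p j)" and p0: "\<And>j. p j 0 = 0" and pt: "\<And>j. p j (k j) = t"
    and l1: "(\<lambda>j. \<integral>\<^sup>+u\<in>{0..t}. ennreal ((step_fun (k j) (p j) (c j) u - f u)\<^sup>2) \<partial>lborel) \<longlonglongrightarrow> 0"
    and l2: "(\<lambda>j. \<integral>\<^sup>+\<omega>. ennreal ((step_integral W (k j) (p j) (c j) \<omega> - Y \<omega>)\<^sup>2) \<partial>\<Omega>) \<longlonglongrightarrow> 0"
    using assms(1) unfolding is_wiener_integral_def by auto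
  have "\<exists>xs. snd ` set xs \<subseteq> p j ` {..k j} \<and> elem_fun xs = step_fun (k j) (p j) (c j) \<and>
      elem_int W xs = step_integral W (k j) (p j) (c j)" for j
  proof -
    have "0 \<le> p j 0" using p0 by simp
    from step_fun_as_elem[OF mono this, of "c j"] obtain xs where "snd ` set xs \<subseteq> p j ` {..k j}"
      "elem_fun xs = step_fun (k j) (p j) (c j)"
      "\<And>W :: real \<Rightarrow> 'a \<Rightarrow> real. elem_int W xs = step_integral W (k j) (p j) (c j)" by blast
    then show ?thesis by (intro exI[of _ xs] conjI)
  qed
  then obtain xs where xs: "\<And>j. snd ` set (xs j) \<subseteq> p j ` {..k j}"
    "\<And>j. elem_fun (xs j) = step_fun (k j) (p j) (c j)"
    "\<And>j. elem_int W (xs j) = step_integral W (k j) (p j) (c j)" by metis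
  have pr: "p j i \<in> {0..t}" if "i \<le> k j" for i j
    using mono_onD[OF mono[of j], of 0 i] mono_onD[OF mono[of j], of i "k j"] that p0 pt by auto
  show ?thesis
  proof (rule that[of xs])
    show "snd ` set (xs j) \<subseteq> {0..1}" for j
    proof -
      have "p j ` {..k j} \<subseteq> {0..1}"
        using pr[of _ j] assms(2) by (intro image_subsetI) (meson atLeastAtMost_iff atMost_iff order_trans)
      then show ?thesis using xs(1)[of j] by (rule order_trans[rotated])
    qed
    have out: "step_fun (k j) (p j) (c j) u = 0" if "u \<notin> {0<..t}" for j u
    proof -
      have "u \<notin> {p j i<..p j (Suc i)}" if "i < k j" for i
        using pr[of i j] pr[of "Suc i" j] that \<open>u \<notin> {0<..t}\<close> by auto
      then show ?thesis unfolding step_fun_def by (intro sum.neutral) auto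
    qed
    have "(\<integral>\<^sup>+u. ennreal ((elem_fun (xs j) u - f u * indicator {0<..t} u)\<^sup>2) \<partial>lborel)
       = (\<integral>\<^sup>+u\<in>{0..t}. ennreal ((step_fun (k j) (p j) (c j) u - f u)\<^sup>2) \<partial>lborel)" for j
    proof (rule nn_integral_cong_AE)
      have "AE u in lborel. u \<noteq> (0 :: real)" by (rule AE_lborel_singleton)
      then show "AE u in lborel. ennreal ((elem_fun (xs j) u - f u * indicator {0<..t} u)\<^sup>2)
          = ennreal ((step_fun (k j) (p j) (c j) u - f u)\<^sup>2) * indicator {0..t} u"
      proof eventually_elim
        case (elim u)
        show ?case
        proof (cases "u \<in> {0<..t}")
          case True
          then show ?thesis by (simp add: xs(2))
        next
          case False
          then have "u \<notin> {0..t}" using elim by auto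
          then show ?thesis using False out[OF False, of j] by (simp add: xs(2) del: greaterThanAtMost_iff atLeastAtMost_iff)
        qed
      qed
    qed
    then show "(\<lambda>j. \<integral>\<^sup>+u. ennreal ((elem_fun (xs j) u - f u * indicator {0<..t} u)\<^sup>2) \<partial>lborel) \<longlonglongrightarrow> 0"
      using l1 by simp
    show "(\<lambda>j. \<integral>\<^sup>+\<omega>. ennreal ((elem_int W (xs j) \<omega> - Y \<omega>)\<^sup>2) \<partial>\<Omega>) \<longlonglongrightarrow> 0"
      using l2 by (simp add: xs(3))
  qed
qed

text \<open>The increment is the limit for every elementary approximation of \<open>f\<close> on
  \<open>{a<..b}\<close>, not just for those that the definition supplies. This gives the freedom to
  choose approximations with exactly the right variance.\<close>

lemma wiener_increment_approx:
  assumes W: "std_brownian_motion \<Omega> W" and f: "(\<lambda>u. f u * indicator {0<..1} u) \<in> borel_measurable borel"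
    and ab: "0 \<le> a" "a \<le> b" "b \<le> 1"
    and X: "is_wiener_integral \<Omega> W f a Xa" "is_wiener_integral \<Omega> W f b Xb"
    and zs: "\<And>j. snd ` set (zs j) \<subseteq> {0..1}"
      "(\<lambda>j. \<integral>\<^sup>+u. ennreal ((elem_fun (zs j) u - f u * indicator {a<..b} u)\<^sup>2) \<partial>lborel) \<longlonglongrightarrow> 0"
  shows "(\<lambda>j. \<integral>\<^sup>+\<omega>. ennreal ((Xb \<omega> - Xa \<omega> - elem_int W (zs j) \<omega>)\<^sup>2) \<partial>\<Omega>) \<longlonglongrightarrow> 0"
proof -
  have fm: "(\<lambda>u. f u * indicator {0<..t} u) \<in> borel_measurable borel" if "t \<le> 1" for t
  proof -
    have "(\<lambda>u. f u * indicator {0<..t} u) = (\<lambda>u. (f u * indicator {0<..1} u) * indicator {0<..t} u)"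
      using that by (auto simp: fun_eq_iff indicator_def)
    also have "\<dots> \<in> borel_measurable borel" using f by measurable
    finally show ?thesis .
  qed
  have fa[measurable]: "(\<lambda>u. f u * indicator {0<..a} u) \<in> borel_measurable borel"
    and fb[measurable]: "(\<lambda>u. f u * indicator {0<..b} u) \<in> borel_measurable borel"
    using fm ab by auto
  have fab: "f u * indicator {a<..b} u = f u * indicator {0<..b} u - f u * indicator {0<..a} u" for u
    using ab by (auto simp: indicator_def)
  have [measurable]: "Xa \<in> borel_measurable \<Omega>" "Xb \<in> borel_measurable \<Omega>"
    using X unfolding is_wiener_integral_def by auto
  obtain xs where xs: "\<And>j. snd ` set (xs j) \<subseteq> {0..1}"
    "(\<lambda>j. \<integral>\<^sup>+u. ennreal ((elem_fun (xs j) u - f u * indicator {0<..b} u)\<^sup>2) \<partial>lborel) \<longlonglongrightarrow> 0"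
    "(\<lambda>j. \<integral>\<^sup>+\<omega>. ennreal ((elem_int W (xs j) \<omega> - Xb \<omega>)\<^sup>2) \<partial>\<Omega>) \<longlonglongrightarrow> 0"
    using wiener_integral_elem_approx[OF X(2)] ab by auto
  obtain ys where ys: "\<And>j. snd ` set (ys j) \<subseteq> {0..1}"
    "(\<lambda>j. \<integral>\<^sup>+u. ennreal ((elem_fun (ys j) u - f u * indicator {0<..a} u)\<^sup>2) \<partial>lborel) \<longlonglongrightarrow> 0"
    "(\<lambda>j. \<integral>\<^sup>+\<omega>. ennreal ((elem_int W (ys j) \<omega> - Xa \<omega>)\<^sup>2) \<partial>\<Omega>) \<longlonglongrightarrow> 0"
    using wiener_integral_elem_approx[OF X(1)] ab by auto
  \<comment> \<open>The integrand of \<open>d j\<close> tends to 0 in L2, because the three target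
    functions cancel; the isometry carries this over to its integral.\<close>
  define d where "d j = elem_diff (elem_diff (xs j) (ys j)) (zs j)" for j
  have d01: "snd ` set (d j) \<subseteq> {0..1}" for j using xs(1) ys(1) zs(1) by (simp add: d_def)
  have m[measurable]: "elem_int W (xs j) \<in> borel_measurable \<Omega>" "elem_int W (ys j) \<in> borel_measurable \<Omega>"
    "elem_int W (zs j) \<in> borel_measurable \<Omega>" "elem_int W (d j) \<in> borel_measurable \<Omega>" for j
    using elem_int_measurable[OF W] xs(1) ys(1) zs(1) d01 by auto
  have d0: "(\<lambda>j. \<integral>\<^sup>+\<omega>. ennreal ((elem_int W (d j) \<omega>)\<^sup>2) \<partial>\<Omega>) \<longlonglongrightarrow> 0"
  proof -
    have "(\<integral>\<^sup>+\<omega>. ennreal ((elem_int W (d j) \<omega>)\<^sup>2) \<partial>\<Omega>) \<le>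
      3 * ((\<integral>\<^sup>+u. ennreal ((elem_fun (xs j) u - f u * indicator {0<..b} u)\<^sup>2) \<partial>lborel)
         + (\<integral>\<^sup>+u. ennreal ((elem_fun (ys j) u - f u * indicator {0<..a} u)\<^sup>2) \<partial>lborel)
         + (\<integral>\<^sup>+u. ennreal ((elem_fun (zs j) u - f u * indicator {a<..b} u)\<^sup>2) \<partial>lborel))" for j
    proof -
      have "(\<integral>\<^sup>+\<omega>. ennreal ((elem_int W (d j) \<omega>)\<^sup>2) \<partial>\<Omega>) = (\<integral>\<^sup>+u. ennreal ((elem_fun (d j) u)\<^sup>2) \<partial>lborel)"
        by (rule elem_isometry[OF W d01])
      also have "\<dots> = (\<integral>\<^sup>+u. ennreal (((elem_fun (xs j) u - f u * indicator {0<..b} u)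
          - (elem_fun (ys j) u - f u * indicator {0<..a} u)
          - (elem_fun (zs j) u - f u * indicator {a<..b} u))\<^sup>2) \<partial>lborel)"
        by (intro nn_integral_cong) (simp add: d_def fab algebra_simps)
      also have "\<dots> \<le> 3 * ((\<integral>\<^sup>+u. ennreal ((elem_fun (xs j) u - f u * indicator {0<..b} u)\<^sup>2) \<partial>lborel)
         + (\<integral>\<^sup>+u. ennreal ((elem_fun (ys j) u - f u * indicator {0<..a} u)\<^sup>2) \<partial>lborel)
         + (\<integral>\<^sup>+u. ennreal ((elem_fun (zs j) u - f u * indicator {a<..b} u)\<^sup>2) \<partial>lborel))"
        by (rule nn_integral_sq_diff3_le) (simp_all add: fab)
      finally show ?thesis .
    qed
    then show ?thesis by (rule tendsto_zero_three) (use xs ys zs in auto)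
  qed
  have "(\<integral>\<^sup>+\<omega>. ennreal ((Xb \<omega> - Xa \<omega> - elem_int W (zs j) \<omega>)\<^sup>2) \<partial>\<Omega>) \<le>
      3 * ((\<integral>\<^sup>+\<omega>. ennreal ((elem_int W (d j) \<omega>)\<^sup>2) \<partial>\<Omega>)
         + (\<integral>\<^sup>+\<omega>. ennreal ((elem_int W (xs j) \<omega> - Xb \<omega>)\<^sup>2) \<partial>\<Omega>)
         + (\<integral>\<^sup>+\<omega>. ennreal ((Xa \<omega> - elem_int W (ys j) \<omega>)\<^sup>2) \<partial>\<Omega>))" for j
  proof -
    have "Xb \<omega> - Xa \<omega> - elem_int W (zs j) \<omega> = elem_int W (d j) \<omega> - (elem_int W (xs j) \<omega> - Xb \<omega>)
      - (Xa \<omega> - elem_int W (ys j) \<omega>)" for \<omega>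
      by (simp add: d_def)
    then show ?thesis by (simp only:) (rule nn_integral_sq_diff3_le; measurable)
  qed
  then show ?thesis
    by (rule tendsto_zero_three) (use d0 xs ys in \<open>auto simp: power2_commute\<close>)
qed

section \<open>Square-exponential moments of the increments\<close>

lemma step_fun_on_cell:
  assumes p: "mono_on {..k} p" and l: "l < k" "u \<in> {p l<..p (Suc l)}"
  shows "step_fun k p c u = c l"
proof -
  have other: "u \<notin> {p i<..p (Suc i)}" if "i < k" "i \<noteq> l" for i
  proof (cases "i < l")
    case True
    then have "p (Suc i) \<le> p l" using p l that by (intro mono_onD[OF p]) auto
    then show ?thesis using l by auto
  next
    case False
    then have "p (Suc l) \<le> p i" using p l that by (intro mono_onD[OF p]) auto
    then show ?thesis using l by auto
  qed
  have "step_fun k p c u = (\<Sum>i<k. if i = l then c l else 0)"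
    unfolding step_fun_def using l other by (intro sum.cong) (auto simp: indicator_def)
  then show ?thesis using l by simp
qed

lemma step_fun_outside:
  assumes p: "mono_on {..k} p" and u: "u \<notin> {p 0<..p k}"
  shows "step_fun k p c u = 0"
  unfolding step_fun_def
proof (intro sum.neutral ballI)
  fix i assume "i \<in> {..<k}"
  then have "p 0 \<le> p i" "p (Suc i) \<le> p k" by (auto intro!: mono_onD[OF p])
  then show "c i * indicator {p i<..p (Suc i)} u = 0" using u by auto
qed

lemma exists_cell:
  fixes p :: "nat \<Rightarrow> real"
  assumes "u \<in> {p 0<..p k}" shows "\<exists>l<k. u \<in> {p l<..p (Suc l)}"
  using assms
proof (induction k)
  case (Suc k)
  show ?case
  proof (cases "u \<le> p k")
    case True
    then have "\<exists>l<k. u \<in> {p l<..p (Suc l)}" using Suc by simp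
    then show ?thesis by (meson less_SucI)
  next
    case False
    then have "u \<in> {p k<..p (Suc k)}" using Suc.prems by simp
    then show ?thesis by blast
  qed
qed simp

context
  fixes \<Omega> :: "'w measure" and W :: "real \<Rightarrow> 'w \<Rightarrow> real" and s\<^sub>0 :: "real \<Rightarrow> real" and \<kappa> K M :: real
  assumes W: "std_brownian_motion \<Omega> W" and s0: "s\<^sub>0 \<in> vol_class \<kappa> K M" and \<kappa>: "0 < \<kappa>"
begin

text \<open>The root mean square of \<open>s\<^sub>0\<close> over the cell. With it, instead of a
  sampled value, the integral over a block of cells has exactly the variance of the corresponding
  increment of \<open>X\<close>, so that no approximation error enters the Gaussian moments.\<close>

definition grid_coeff :: "nat \<Rightarrow> nat \<Rightarrow> real" where
  "grid_coeff N l = sqrt (real N * ivar s\<^sub>0 (real l / real N) (real (Suc l) / real N))"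

definition block_int :: "nat \<Rightarrow> nat \<Rightarrow> nat \<Rightarrow> 'w \<Rightarrow> real" where
  "block_int N a b \<omega> = (\<Sum>l\<in>{a..<b}. grid_coeff N l * (W (real (Suc l) / real N) \<omega> - W (real l / real N) \<omega>))"

lemma ivar_pos:
  assumes "0 \<le> a" "a < b" "b \<le> 1" shows "0 < ivar s\<^sub>0 a b"
proof -
  have "0 < \<kappa>\<^sup>2 * (b - a)" using assms \<kappa> by simp
  also have "\<dots> \<le> ivar s\<^sub>0 a b" using ivar_bounds(1)[OF s0] assms \<kappa> by simp
  finally show ?thesis .
qed

lemma grid_coeff_mean_value:
  assumes "l < N"
  obtains \<xi> where "\<xi> \<in> {real l / real N..real (Suc l) / real N}" "grid_coeff N l = s\<^sub>0 \<xi>"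
proof -
  have b: "0 \<le> real l / real N" "real l / real N < real (Suc l) / real N" "real (Suc l) / real N \<le> 1"
    using assms by (auto simp: field_simps)
  obtain \<xi> where x: "\<xi> \<in> {real l / real N..real (Suc l) / real N}"
    "ivar s\<^sub>0 (real l / real N) (real (Suc l) / real N) = (real (Suc l) / real N - real l / real N) * (s\<^sub>0 \<xi>)\<^sup>2"
    using ivar_mean_value[OF s0 b] by blast
  have "\<xi> \<in> {0..1}" using x(1) b unfolding atLeastAtMost_iff by linarith
  then have "s\<^sub>0 \<xi> > 0" using vol_class_bounds(1)[OF s0, of \<xi>] \<kappa> by linarith
  moreover have "real (Suc l) / real N - real l / real N = 1 / real N"
    by (simp add: diff_divide_distrib[symmetric])
  ultimately have "grid_coeff N l = s\<^sub>0 \<xi>"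
    unfolding grid_coeff_def x(2) using assms by simp
  with x that show ?thesis by blast
qed

lemma sum_ivar_grid:
  assumes "a \<le> b" "b \<le> N"
  shows "(\<Sum>l\<in>{a..<b}. ivar s\<^sub>0 (real l / real N) (real (Suc l) / real N)) = ivar s\<^sub>0 (real a / real N) (real b / real N)"
  using assms
proof (induction b rule: dec_induct)
  case base
  then show ?case by (simp add: ivar_def)
next
  case (step b)
  have "ivar s\<^sub>0 (real a / real N) (real b / real N) + ivar s\<^sub>0 (real b / real N) (real (Suc b) / real N)
      = ivar s\<^sub>0 (real a / real N) (real (Suc b) / real N)"
    using step by (intro ivar_combine[OF s0]) (auto simp: divide_right_mono field_simps)
  then show ?case using step by simp
qed

lemma block_int_normal:
  assumes ab: "a < b" "b \<le> N"
  shows "distributed \<Omega> lborel (block_int N a b)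
    (normal_density 0 (sqrt (ivar s\<^sub>0 (real a / real N) (real b / real N))))"
    and "prob_space.indep_vars \<Omega> (\<lambda>_. borel) (\<lambda>l \<omega>. grid_coeff N l * (W (real (Suc l) / real N) \<omega> - W (real l / real N) \<omega>)) {..<N}"
proof -
  interpret prob_space \<Omega> using std_brownian_motionD(1)[OF W] .
  let ?X = "\<lambda>l \<omega>. grid_coeff N l * (W (real (Suc l) / real N) \<omega> - W (real l / real N) \<omega>)"
  have N: "0 < N" using ab by simp
  have "mono_on {..N} (\<lambda>l. real l / real N)" by (auto simp: mono_on_def divide_right_mono)
  moreover have "(\<lambda>l. real l / real N) ` {..N} \<subseteq> {0..1}" using N by auto
  ultimately have "indep_vars (\<lambda>_. borel) (\<lambda>l \<omega>. W (real (Suc l) / real N) \<omega> - W (real l / real N) \<omega>) {..<N}"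
    by (rule std_brownian_motionD(5)[OF W])
  from indep_vars_compose2[OF this, of "\<lambda>l x. grid_coeff N l * x" "\<lambda>_. borel"]
  show ind: "indep_vars (\<lambda>_. borel) ?X {..<N}" by simp
  have c: "0 < grid_coeff N l" if "l < N" for l
    unfolding grid_coeff_def using ivar_pos[of "real l / real N" "real (Suc l) / real N"] that
    by (auto simp: field_simps)
  have D: "distributed \<Omega> lborel (?X l) (normal_density 0 (grid_coeff N l * sqrt (1 / real N)))" if "l < N" for l
  proof -
    have "distributed \<Omega> lborel (\<lambda>\<omega>. W (real (Suc l) / real N) \<omega> - W (real l / real N) \<omega>)
        (normal_density 0 (sqrt (real (Suc l) / real N - real l / real N)))"
      using that by (intro std_brownian_motionD(4)[OF W]) (auto simp: field_simps)
    moreover have "real (Suc l) / real N - real l / real N = 1 / real N"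
      by (simp add: diff_divide_distrib[symmetric])
    ultimately have "distributed \<Omega> lborel (\<lambda>\<omega>. W (real (Suc l) / real N) \<omega> - W (real l / real N) \<omega>)
        (normal_density 0 (sqrt (1 / real N)))" by simp
    from normal_density_affine[OF this, of "grid_coeff N l" 0] c[OF that] N
    show ?thesis by simp
  qed
  have "distributed \<Omega> lborel (\<lambda>\<omega>. \<Sum>l\<in>{a..<b}. ?X l \<omega>)
     (normal_density (\<Sum>l\<in>{a..<b}. 0) (sqrt (\<Sum>l\<in>{a..<b}. (grid_coeff N l * sqrt (1 / real N))\<^sup>2)))"
    using ab c D N
    by (intro sum_indep_normal indep_vars_subset[OF ind]) auto
  moreover have "(grid_coeff N l * sqrt (1 / real N))\<^sup>2 = ivar s\<^sub>0 (real l / real N) (real (Suc l) / real N)"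
    if "l \<in> {a..<b}" for l
    using ivar_pos[of "real l / real N" "real (Suc l) / real N"] that ab N unfolding grid_coeff_def
    by (simp add: power_mult_distrib field_simps)
  ultimately show "distributed \<Omega> lborel (block_int N a b)
    (normal_density 0 (sqrt (ivar s\<^sub>0 (real a / real N) (real b / real N))))"
    using sum_ivar_grid[of a b N] ab by (simp add: block_int_def[abs_def])
qed

text \<open>The coefficient on a cell is a value of \<open>s\<^sub>0\<close> at some point of that
  cell, so the pointwise error is at most \<open>M / N\<close>.\<close>

lemma block_int_as_elem:
  assumes ab: "a \<le> b" "b \<le> N" "0 < N" and M: "0 \<le> M"
  obtains xs where "snd ` set xs \<subseteq> {0..1}" "elem_int W xs = block_int N a b"
    "(\<integral>\<^sup>+u. ennreal ((elem_fun xs u - s\<^sub>0 u * indicator {real a / real N<..real b / real N} u)\<^sup>2) \<partial>lborel)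
      \<le> ennreal ((M / real N)\<^sup>2)"
proof -
  define p where "p l = real (a + l) / real N" for l
  define c where "c l = grid_coeff N (a + l)" for l
  let ?k = "b - a"
  have p: "mono_on {..?k} p" by (auto simp: mono_on_def p_def divide_right_mono)
  have p0: "0 \<le> p 0" by (simp add: p_def)
  have pk: "p ?k = real b / real N" "p 0 = real a / real N" using ab by (auto simp: p_def)
  from step_fun_as_elem[OF p p0, of c] obtain xs where xs: "snd ` set xs \<subseteq> p ` {..?k}"
      "elem_fun xs = step_fun ?k p c"
      "\<And>W :: real \<Rightarrow> 'w \<Rightarrow> real. elem_int W xs = step_integral W ?k p c" by blast
  show ?thesis
  proof (rule that[of xs])
    have "p ` {..?k} \<subseteq> {0..1}" using ab by (auto simp: p_def)
    then show "snd ` set xs \<subseteq> {0..1}" using xs(1) by (rule order_trans[rotated])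
    have "block_int N a b \<omega> = step_integral W ?k p c \<omega>" for \<omega>
      unfolding block_int_def step_integral_def p_def c_def
      using sum.shift_bounds_nat_ivl[of "\<lambda>l. grid_coeff N l * (W (real (Suc l) / real N) \<omega> - W (real l / real N) \<omega>)" 0 a "b - a"] ab
      by (simp add: lessThan_atLeast0 add.commute)
    then show "elem_int W xs = block_int N a b" using xs(3) by auto
    have le: "(elem_fun xs u - s\<^sub>0 u * indicator {real a / real N<..real b / real N} u)\<^sup>2
        \<le> (M / real N)\<^sup>2 * indicator {0..1} u" for u
    proof (cases "u \<in> {p 0<..p ?k}")
      case True
      then obtain l where l: "l < ?k" "u \<in> {p l<..p (Suc l)}" using exists_cell by blast
      have sf: "elem_fun xs u = grid_coeff N (a + l)"
        using step_fun_on_cell[OF p l, of c] xs(2) by (simp add: c_def)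
      have "a + l < N" using l ab by auto
      then obtain \<xi> where x: "\<xi> \<in> {real (a + l) / real N..real (Suc (a + l)) / real N}" "grid_coeff N (a + l) = s\<^sub>0 \<xi>"
        using grid_coeff_mean_value by blast
      have u: "u \<in> {real (a + l) / real N..real (Suc (a + l)) / real N}" using l(2) by (auto simp: p_def)
      have sub: "{real (a + l) / real N..real (Suc (a + l)) / real N} \<subseteq> {0..1}"
        using \<open>a + l < N\<close> by (auto simp: field_simps intro: order_trans)
      have "real (Suc (a + l)) / real N - real (a + l) / real N = 1 / real N"
        by (simp add: diff_divide_distrib[symmetric])
      then have "\<bar>\<xi> - u\<bar> \<le> 1 / real N" using x(1) u unfolding atLeastAtMost_iff by linarith
      then have "M * \<bar>\<xi> - u\<bar> \<le> M * (1 / real N)" using M by (rule mult_left_mono)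
      moreover have "\<bar>s\<^sub>0 \<xi> - s\<^sub>0 u\<bar> \<le> M * \<bar>\<xi> - u\<bar>"
        using vol_class_Lipschitz[OF s0, of \<xi> u] x(1) u sub by blast
      ultimately have "\<bar>s\<^sub>0 \<xi> - s\<^sub>0 u\<bar> \<le> \<bar>M / real N\<bar>" using M by simp
      then have "(s\<^sub>0 \<xi> - s\<^sub>0 u)\<^sup>2 \<le> (M / real N)\<^sup>2" by (simp only: abs_le_square_iff)
      moreover have "u \<in> {0..1}" using u sub by blast
      moreover have "u \<in> {real a / real N<..real b / real N}" using True by (simp only: pk)
      ultimately show ?thesis unfolding sf x(2) by (simp only: indicator_simps mult_1_right)
    next
      case False
      then show ?thesis using step_fun_outside[OF p False, of c] unfolding xs(2) pk by simp
    qed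
    have "(\<integral>\<^sup>+u. ennreal ((elem_fun xs u - s\<^sub>0 u * indicator {real a / real N<..real b / real N} u)\<^sup>2) \<partial>lborel)
        \<le> (\<integral>\<^sup>+u. ennreal ((M / real N)\<^sup>2) * indicator {0..1 :: real} u \<partial>lborel)"
    proof (intro nn_integral_mono)
      fix u :: real
      show "ennreal ((elem_fun xs u - s\<^sub>0 u * indicator {real a / real N<..real b / real N} u)\<^sup>2)
          \<le> ennreal ((M / real N)\<^sup>2) * indicator {0..1 :: real} u"
        using ennreal_leI[OF le[of u]] by (cases "u \<in> {0..1}") (simp_all del: atLeastAtMost_iff)
    qed
    also have "\<dots> = ennreal ((M / real N)\<^sup>2)" by (simp add: nn_integral_cmult)
    finally show "(\<integral>\<^sup>+u. ennreal ((elem_fun xs u - s\<^sub>0 u * indicator {real a / real N<..real b / real N} u)\<^sup>2) \<partial>lborel)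
      \<le> ennreal ((M / real N)\<^sup>2)" .
  qed
qed

text \<open>The grid of width \<open>1 / (n * j)\<close> refines the observation grid: the fine
  cells with index from \<open>(i - 1) * j\<close> up to, but excluding, \<open>i * j\<close> make
  up the observation cell \<open>i\<close>.\<close>

lemma block_cell:
  assumes "i \<in> {1..n}" "0 < j"
  shows "real ((i - 1) * j) / real (n * j) = (real i - 1) / real n" "real (i * j) / real (n * j) = real i / real n"
    "(i - 1) * j < i * j" "i * j \<le> n * j"
  using assms by (auto simp: of_nat_diff)

text \<open>Different observation cells use disjoint sets of independent fine increments, so the
  mean of the product factorises.\<close>

lemma block_moment:
  assumes j: "0 < j" and c: "\<And>i. i \<in> {1..n} \<Longrightarrow> 0 \<le> c i"
    and l: "\<And>i. i \<in> {1..n} \<Longrightarrow> 2 * l i * ivar s\<^sub>0 ((real i - 1) / real n) (real i / real n) < 1"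
  shows "(\<integral>\<^sup>+\<omega>. (\<Prod>i=1..n. ennreal (c i * exp (l i * (block_int (n * j) ((i - 1) * j) (i * j) \<omega>)\<^sup>2))) \<partial>\<Omega>)
    = (\<Prod>i=1..n. ennreal (c i / sqrt (1 - 2 * l i * ivar s\<^sub>0 ((real i - 1) / real n) (real i / real n))))"
proof (cases "n = 0")
  case True
  then show ?thesis using prob_space.emeasure_space_1[OF std_brownian_motionD(1)[OF W]] by simp
next
  case False
  interpret prob_space \<Omega> using std_brownian_motionD(1)[OF W] .
  let ?X = "\<lambda>k \<omega>. grid_coeff (n * j) k * (W (real (Suc k) / real (n * j)) \<omega> - W (real k / real (n * j)) \<omega>)"
  let ?B = "\<lambda>i. {(i - 1) * j..<i * j}"
  have ind: "indep_vars (\<lambda>_. borel) ?X {..<n * j}"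
    using block_int_normal(2)[of 0 "n * j" "n * j"] j False by simp
  have dis: "disjoint_family_on ?B {1..n}"
  proof (unfold disjoint_family_on_def, intro ballI impI)
    have *: "?B a \<inter> ?B b = {}" if "a < b" for a b :: nat
    proof -
      have "a * j \<le> (b - 1) * j" using that by (intro mult_right_mono) auto
      then show ?thesis by auto
    qed
    fix a b :: nat assume "a \<noteq> b"
    then show "?B a \<inter> ?B b = {}" using *[of a b] *[of b a] by (cases "a < b") (auto simp: Int_commute)
  qed
  have sub: "?B i \<subseteq> {..<n * j}" if "i \<in> {1..n}" for i
    using block_cell(4)[OF that j] by (auto intro: less_le_trans)
  have "indep_vars (\<lambda>i. PiM (?B i) (\<lambda>_. borel)) (\<lambda>i \<omega>. restrict (\<lambda>k. ?X k \<omega>) (?B i)) {1..n}"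
    by (rule indep_vars_restrict[OF ind sub dis])
  then have "indep_vars (\<lambda>_. borel) (\<lambda>i \<omega>. ennreal (c i * exp (l i * (\<Sum>k\<in>?B i. restrict (\<lambda>k. ?X k \<omega>) (?B i) k)\<^sup>2))) {1..n}"
    by (rule indep_vars_compose2[where Y="\<lambda>i f. ennreal (c i * exp (l i * (\<Sum>k\<in>?B i. f k)\<^sup>2))"]) measurable
  then have ind': "indep_vars (\<lambda>_. borel) (\<lambda>i \<omega>. ennreal (c i * exp (l i * (block_int (n * j) ((i - 1) * j) (i * j) \<omega>)\<^sup>2))) {1..n}"
    by (simp add: block_int_def)
  have "(\<integral>\<^sup>+\<omega>. (\<Prod>i=1..n. ennreal (c i * exp (l i * (block_int (n * j) ((i - 1) * j) (i * j) \<omega>)\<^sup>2))) \<partial>\<Omega>)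
     = (\<Prod>i=1..n. \<integral>\<^sup>+\<omega>. ennreal (c i * exp (l i * (block_int (n * j) ((i - 1) * j) (i * j) \<omega>)\<^sup>2)) \<partial>\<Omega>)"
    by (rule indep_vars_nn_integral[OF _ ind']) auto
  also have "\<dots> = (\<Prod>i=1..n. ennreal (c i / sqrt (1 - 2 * l i * ivar s\<^sub>0 ((real i - 1) / real n) (real i / real n))))"
  proof (rule prod.cong[OF refl])
    fix i assume i: "i \<in> {1..n}"
    let ?v = "ivar s\<^sub>0 ((real i - 1) / real n) (real i / real n)"
    have v: "0 < ?v" using i by (intro ivar_pos) (auto simp: field_simps)
    have "distributed \<Omega> lborel (block_int (n * j) ((i - 1) * j) (i * j)) (normal_density 0 (sqrt ?v))"
      using block_int_normal(1)[OF block_cell(3,4)[OF i j]] unfolding block_cell(1,2)[OF i j] .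
    from normal_exp_square_moment[OF this, of "l i" "c i"] v l[OF i] c[OF i]
    show "(\<integral>\<^sup>+\<omega>. ennreal (c i * exp (l i * (block_int (n * j) ((i - 1) * j) (i * j) \<omega>)\<^sup>2)) \<partial>\<Omega>)
       = ennreal (c i / sqrt (1 - 2 * l i * ?v))" by simp
  qed
  finally show ?thesis .
qed

text \<open>Only the inequality is needed, so Fatou's lemma along an almost surely convergent
  subsequence replaces the identification of the joint law of the increments.\<close>

lemma increment_moment:
  assumes X: "solves_sde \<Omega> W s\<^sub>0 X" and M: "0 \<le> M" and c: "\<And>i. i \<in> {1..n} \<Longrightarrow> 0 \<le> c i"
    and l: "\<And>i. i \<in> {1..n} \<Longrightarrow> 2 * l i * ivar s\<^sub>0 ((real i - 1) / real n) (real i / real n) < 1"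
  shows "(\<integral>\<^sup>+\<omega>. (\<Prod>i=1..n. ennreal (c i * exp (l i * (X (real i / real n) \<omega> - X ((real i - 1) / real n) \<omega>)\<^sup>2))) \<partial>\<Omega>)
    \<le> (\<Prod>i=1..n. ennreal (c i / sqrt (1 - 2 * l i * ivar s\<^sub>0 ((real i - 1) / real n) (real i / real n))))"
proof -
  let ?D = "\<lambda>i \<omega>. X (real i / real n) \<omega> - X ((real i - 1) / real n) \<omega>"
  \<comment> \<open>Refining by the factor \<open>Suc j\<close> keeps the grid meaningful at
    \<open>j = 0\<close>.\<close>
  let ?G = "\<lambda>j i. block_int (n * Suc j) ((i - 1) * Suc j) (i * Suc j)"
  let ?R = "\<Prod>i=1..n. ennreal (c i / sqrt (1 - 2 * l i * ivar s\<^sub>0 ((real i - 1) / real n) (real i / real n)))"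
  have Xi: "is_wiener_integral \<Omega> W s\<^sub>0 t (X t)" if "t \<in> {0..1}" for t
    using X that unfolding solves_sde_def by auto
  have t01: "(real i - 1) / real n \<in> {0..1}" "real i / real n \<in> {0..1}" if "i \<in> {1..n}" for i
    using that by (auto simp: field_simps)
  have [measurable]: "X t \<in> borel_measurable \<Omega>" if "t \<in> {0..1}" for t
    using Xi[OF that] unfolding is_wiener_integral_def by auto
  have Dm: "?D i \<in> borel_measurable \<Omega>" if "i \<in> {1..n}" for i
    using t01[OF that] by measurable
  have s0m: "(\<lambda>u. s\<^sub>0 u * indicator {0<..1} u) \<in> borel_measurable borel"
  proof -
    have "(\<lambda>u. indicator {0..1} u *\<^sub>R s\<^sub>0 u) \<in> borel_measurable borel"
      by (intro borel_measurable_continuous_on_indicator vol_class_continuous_on[OF s0]) auto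
    then have "(\<lambda>u. (indicator {0..1} u *\<^sub>R s\<^sub>0 u) * indicator {0<..1} u) \<in> borel_measurable borel"
      by measurable
    also have "(\<lambda>u. (indicator {0..1} u *\<^sub>R s\<^sub>0 u) * indicator {0<..1} u) = (\<lambda>u. s\<^sub>0 u * indicator {0<..1} u)"
      by (auto simp: fun_eq_iff indicator_def)
    finally show ?thesis .
  qed
  have conv: "(\<lambda>j. \<integral>\<^sup>+\<omega>. ennreal ((?D i \<omega> - ?G j i \<omega>)\<^sup>2) \<partial>\<Omega>) \<longlonglongrightarrow> 0" 
    and Gm: "\<And>j. ?G j i \<in> borel_measurable \<Omega>" if i: "i \<in> {1..n}" for i
  proof -
    have n: "0 < n" using i by auto
    have "\<exists>xs. snd ` set xs \<subseteq> {0..1} \<and> elem_int W xs = ?G j i \<and>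
      (\<integral>\<^sup>+u. ennreal ((elem_fun xs u - s\<^sub>0 u * indicator {(real i - 1) / real n<..real i / real n} u)\<^sup>2) \<partial>lborel)
      \<le> ennreal ((M / real (n * Suc j))\<^sup>2)" for j
    proof -
      have "0 < n * Suc j" using n by simp
      obtain xs where "snd ` set xs \<subseteq> {0..1}" "elem_int W xs = ?G j i"
        "(\<integral>\<^sup>+u. ennreal ((elem_fun xs u - s\<^sub>0 u * indicator {real ((i - 1) * Suc j) / real (n * Suc j)<..real (i * Suc j) / real (n * Suc j)} u)\<^sup>2) \<partial>lborel)
          \<le> ennreal ((M / real (n * Suc j))\<^sup>2)"
        by (rule block_int_as_elem[OF less_imp_le[OF block_cell(3)[OF i zero_less_Suc]]
          block_cell(4)[OF i zero_less_Suc] \<open>0 < n * Suc j\<close> M])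
      then show ?thesis unfolding block_cell(1,2)[OF i zero_less_Suc] by (intro exI[of _ xs] conjI)
    qed
    then have "\<exists>xs. \<forall>j. snd ` set (xs j) \<subseteq> {0..1} \<and> elem_int W (xs j) = ?G j i \<and>
      (\<integral>\<^sup>+u. ennreal ((elem_fun (xs j) u - s\<^sub>0 u * indicator {(real i - 1) / real n<..real i / real n} u)\<^sup>2) \<partial>lborel)
      \<le> ennreal ((M / real (n * Suc j))\<^sup>2)"
      by (intro choice allI)
    then obtain xs where xs: "\<And>j. snd ` set (xs j) \<subseteq> {0..1}" "\<And>j. elem_int W (xs j) = ?G j i"
      and le: "\<And>j. (\<integral>\<^sup>+u. ennreal ((elem_fun (xs j) u - s\<^sub>0 u * indicator {(real i - 1) / real n<..real i / real n} u)\<^sup>2) \<partial>lborel)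
      \<le> ennreal ((M / real (n * Suc j))\<^sup>2)" by blast
    show "?G j i \<in> borel_measurable \<Omega>" for j
      using elem_int_measurable[OF W xs(1)[of j]] unfolding xs(2) .
    have "(\<lambda>j. M / real n * inverse (real (Suc j))) \<longlonglongrightarrow> M / real n * 0"
      by (intro tendsto_mult tendsto_const LIMSEQ_inverse_real_of_nat)
    then have "(\<lambda>j. (M / real (n * Suc j))\<^sup>2) \<longlonglongrightarrow> 0\<^sup>2"
      unfolding of_nat_mult by (intro tendsto_power) (simp add: divide_inverse mult.assoc del: of_nat_Suc)
    then have lim: "(\<lambda>j. ennreal ((M / real (n * Suc j))\<^sup>2)) \<longlonglongrightarrow> ennreal (0\<^sup>2)"
      by (rule tendsto_ennrealI)
    have "(\<lambda>j. \<integral>\<^sup>+u. ennreal ((elem_fun (xs j) u - s\<^sub>0 u * indicator {(real i - 1) / real n<..real i / real n} u)\<^sup>2) \<partial>lborel) \<longlonglongrightarrow> 0"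
    proof (rule tendsto_sandwich[OF _ _ tendsto_const])
      show "(\<lambda>j. ennreal ((M / real (n * Suc j))\<^sup>2)) \<longlonglongrightarrow> 0"
        using lim unfolding zero_power2 ennreal_0 .
    qed (intro always_eventually allI le zero_le)+
    moreover have "0 \<le> (real i - 1) / real n" "(real i - 1) / real n \<le> real i / real n" "real i / real n \<le> 1"
      using t01[OF i] by (auto simp: divide_right_mono)
    ultimately show "(\<lambda>j. \<integral>\<^sup>+\<omega>. ennreal ((?D i \<omega> - ?G j i \<omega>)\<^sup>2) \<partial>\<Omega>) \<longlonglongrightarrow> 0"
      using wiener_increment_approx[where zs = xs, OF W s0m _ _ _ Xi[OF t01(1)[OF i]] Xi[OF t01(2)[OF i]] xs(1)]
      unfolding xs(2) by blast
  qed
  \<comment> \<open>The errors of all cells are added up so that one subsequence serves every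
    increment.\<close>
  let ?S = "\<lambda>j \<omega>. \<Sum>i=1..n. (?D i \<omega> - ?G j i \<omega>)\<^sup>2"
  have Sm: "?S j \<in> borel_measurable \<Omega>" for j
    by (intro borel_measurable_sum borel_measurable_power borel_measurable_diff Dm Gm) auto
  have "(\<integral>\<^sup>+\<omega>. ennreal (?S j \<omega>) \<partial>\<Omega>) = (\<Sum>i=1..n. \<integral>\<^sup>+\<omega>. ennreal ((?D i \<omega> - ?G j i \<omega>)\<^sup>2) \<partial>\<Omega>)" for j
  proof -
    have "(\<integral>\<^sup>+\<omega>. ennreal (?S j \<omega>) \<partial>\<Omega>) = (\<integral>\<^sup>+\<omega>. (\<Sum>i=1..n. ennreal ((?D i \<omega> - ?G j i \<omega>)\<^sup>2)) \<partial>\<Omega>)"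
      by (intro nn_integral_cong) (simp add: sum_ennreal)
    also have "\<dots> = (\<Sum>i=1..n. \<integral>\<^sup>+\<omega>. ennreal ((?D i \<omega> - ?G j i \<omega>)\<^sup>2) \<partial>\<Omega>)"
      by (rule nn_integral_sum) (use Dm Gm in simp)
    finally show ?thesis .
  qed
  moreover have "(\<lambda>j. \<Sum>i=1..n. \<integral>\<^sup>+\<omega>. ennreal ((?D i \<omega> - ?G j i \<omega>)\<^sup>2) \<partial>\<Omega>) \<longlonglongrightarrow> (\<Sum>i=1..n. 0)"
    by (intro tendsto_sum conv)
  ultimately have S0: "(\<lambda>j. \<integral>\<^sup>+\<omega>. ennreal (?S j \<omega>) \<partial>\<Omega>) \<longlonglongrightarrow> 0" by simp
  then have "\<forall>\<^sub>F j in sequentially. (\<integral>\<^sup>+\<omega>. ennreal (?S j \<omega>) \<partial>\<Omega>) < 1"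
    by (rule order_tendstoD(2)) simp
  \<comment> \<open>Passing from convergence in L1 to an almost surely convergent subsequence asks
    for integrable functions. Finiteness is known from \<open>J\<close> on, hence the shift of the
    index.\<close>
  then obtain J where J: "\<And>j. J \<le> j \<Longrightarrow> (\<integral>\<^sup>+\<omega>. ennreal (?S j \<omega>) \<partial>\<Omega>) < 1"
    unfolding eventually_sequentially by auto
  have Sint: "integrable \<Omega> (?S (j + J))" for j
    unfolding integrable_iff_bounded
  proof
    have "(\<integral>\<^sup>+\<omega>. ennreal (norm (?S (j + J) \<omega>)) \<partial>\<Omega>) = (\<integral>\<^sup>+\<omega>. ennreal (?S (j + J) \<omega>) \<partial>\<Omega>)"
      by (intro nn_integral_cong) (simp add: sum_nonneg)
    also have "\<dots> < \<infinity>" using J[of "j + J"] by (auto intro: order.strict_trans)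
    finally show "(\<integral>\<^sup>+\<omega>. ennreal (norm (?S (j + J) \<omega>)) \<partial>\<Omega>) < \<infinity>" .
  qed (rule Sm)
  have "(\<lambda>j. \<integral>\<omega>. norm (?S (j + J) \<omega>) \<partial>\<Omega>) \<longlonglongrightarrow> 0"
  proof -
    have eq: "(\<integral>\<omega>. norm (?S (j + J) \<omega>) \<partial>\<Omega>) = enn2real (\<integral>\<^sup>+\<omega>. ennreal (?S (j + J) \<omega>) \<partial>\<Omega>)" for j
      by (subst integral_eq_nn_integral) (use Sm in \<open>auto simp: sum_nonneg\<close>)
    have "(\<lambda>j. enn2real (\<integral>\<^sup>+\<omega>. ennreal (?S (j + J) \<omega>) \<partial>\<Omega>)) \<longlonglongrightarrow> 0"
      using LIMSEQ_ignore_initial_segment[OF S0] by (intro tendsto_enn2real) simp_all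
    then show ?thesis unfolding eq by simp
  qed
  from tendsto_L1_AE_subseq[OF Sint this] obtain r where r: "strict_mono r"
    and ae: "AE \<omega> in \<Omega>. (\<lambda>j. ?S (r j + J) \<omega>) \<longlonglongrightarrow> 0" by auto
  let ?P = "\<lambda>j \<omega>. \<Prod>i=1..n. ennreal (c i * exp (l i * (?G (r j + J) i \<omega>)\<^sup>2))"
  have Pm: "?P j \<in> borel_measurable \<Omega>" for j
  proof (rule borel_measurable_prod_ennreal)
    fix i assume "i \<in> {1..n}"
    from Gm[OF this, of "r j + J"]
    show "(\<lambda>\<omega>. ennreal (c i * exp (l i * (?G (r j + J) i \<omega>)\<^sup>2))) \<in> borel_measurable \<Omega>" by simp
  qed
  have "AE \<omega> in \<Omega>. (\<Prod>i=1..n. ennreal (c i * exp (l i * (?D i \<omega>)\<^sup>2))) = liminf (\<lambda>j. ?P j \<omega>)"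
    using ae
  proof eventually_elim
    case (elim \<omega>)
    have G: "(\<lambda>j. ?G (r j + J) i \<omega>) \<longlonglongrightarrow> ?D i \<omega>" if i: "i \<in> {1..n}" for i
    proof -
      have "(\<lambda>j. (?D i \<omega> - ?G (r j + J) i \<omega>)\<^sup>2) \<longlonglongrightarrow> 0"
      proof (rule tendsto_sandwich[OF _ _ tendsto_const elim])
        show "\<forall>\<^sub>F j in sequentially. (?D i \<omega> - ?G (r j + J) i \<omega>)\<^sup>2 \<le> ?S (r j + J) \<omega>"
          by (intro always_eventually allI member_le_sum) (use i in auto)
      qed simp
      then have "(\<lambda>j. sqrt ((?D i \<omega> - ?G (r j + J) i \<omega>)\<^sup>2)) \<longlonglongrightarrow> sqrt 0" by (rule tendsto_real_sqrt)
      then have "(\<lambda>j. ?D i \<omega> - ?G (r j + J) i \<omega>) \<longlonglongrightarrow> 0"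
        by (simp add: tendsto_rabs_zero_iff)
      then have "(\<lambda>j. ?D i \<omega> - (?D i \<omega> - ?G (r j + J) i \<omega>)) \<longlonglongrightarrow> ?D i \<omega> - 0"
        by (intro tendsto_diff tendsto_const)
      then show ?thesis by simp
    qed
    have "(\<lambda>j. \<Prod>i=1..n. c i * exp (l i * (?G (r j + J) i \<omega>)\<^sup>2)) \<longlonglongrightarrow> (\<Prod>i=1..n. c i * exp (l i * (?D i \<omega>)\<^sup>2))"
      by (intro tendsto_prod tendsto_intros G)
    then have "(\<lambda>j. ennreal (\<Prod>i=1..n. c i * exp (l i * (?G (r j + J) i \<omega>)\<^sup>2))) \<longlonglongrightarrow> ennreal (\<Prod>i=1..n. c i * exp (l i * (?D i \<omega>)\<^sup>2))"
      by (rule tendsto_ennrealI)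
    moreover have "ennreal (\<Prod>i=1..n. c i * exp (l i * (h i)\<^sup>2)) = (\<Prod>i=1..n. ennreal (c i * exp (l i * (h i)\<^sup>2)))" for h :: "nat \<Rightarrow> real"
      using c by (intro prod_ennreal[symmetric]) auto
    ultimately have "(\<lambda>j. ?P j \<omega>) \<longlonglongrightarrow> (\<Prod>i=1..n. ennreal (c i * exp (l i * (?D i \<omega>)\<^sup>2)))" by simp
    then show ?case by (simp add: lim_imp_Liminf)
  qed
  then have "(\<integral>\<^sup>+\<omega>. (\<Prod>i=1..n. ennreal (c i * exp (l i * (?D i \<omega>)\<^sup>2))) \<partial>\<Omega>) = (\<integral>\<^sup>+\<omega>. liminf (\<lambda>j. ?P j \<omega>) \<partial>\<Omega>)"
    by (rule nn_integral_cong_AE)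
  also have "\<dots> \<le> liminf (\<lambda>j. \<integral>\<^sup>+\<omega>. ?P j \<omega> \<partial>\<Omega>)"
    by (rule nn_integral_liminf[OF Pm])
  also have "(\<lambda>j. \<integral>\<^sup>+\<omega>. ?P j \<omega> \<partial>\<Omega>) = (\<lambda>j. ?R)"
    by (intro ext block_moment c l) auto
  also have "liminf (\<lambda>j. ?R) = ?R" by (rule Liminf_const) simp
  finally show ?thesis .
qed

end

section \<open>Posterior mass and the likelihood ratio\<close>

lemma (in prob_space) Markov_prob_bound:
  assumes [measurable]: "f \<in> borel_measurable M" and "(\<integral>\<^sup>+x. f x \<partial>M) \<le> ennreal c" and t: "0 < t" and c: "0 \<le> c"
  shows "prob {x \<in> space M. ennreal t < f x} \<le> c / t"
proof -
  have "{x \<in> space M. ennreal t < f x} \<subseteq> {x \<in> space M. 1 \<le> ennreal (1 / t) * f x}"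
  proof
    fix x assume x: "x \<in> {x \<in> space M. ennreal t < f x}"
    have "1 = ennreal (1 / t) * ennreal t" using t by (simp add: ennreal_mult'[symmetric])
    also have "\<dots> \<le> ennreal (1 / t) * f x" using x by (intro mult_left_mono) auto
    finally show "x \<in> {x \<in> space M. 1 \<le> ennreal (1 / t) * f x}" using x by simp
  qed
  then have "emeasure M {x \<in> space M. ennreal t < f x} \<le> emeasure M {x \<in> space M. 1 \<le> ennreal (1 / t) * f x}"
    by (rule emeasure_mono) simp
  also have "\<dots> \<le> ennreal (1 / t) * (\<integral>\<^sup>+x. f x * indicator (space M) x \<partial>M)"
    by (rule nn_integral_Markov_inequality) simp_all
  also have "(\<integral>\<^sup>+x. f x * indicator (space M) x \<partial>M) = (\<integral>\<^sup>+x. f x \<partial>M)"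
    by (intro nn_integral_cong) simp
  also have "ennreal (1 / t) * (\<integral>\<^sup>+x. f x \<partial>M) \<le> ennreal (1 / t) * ennreal c"
    using assms by (intro mult_left_mono) auto
  also have "\<dots> = ennreal (c / t)" using t by (simp add: ennreal_mult'[symmetric])
  finally show ?thesis using c t by (simp add: emeasure_eq_measure)
qed

text \<open>The evidence is bounded below through \<open>R \<ge> 2 / g - 1 / (g\<^sup>2 R)\<close>, which needs only a bound on
  the mean of \<open>1 / R\<close>.\<close>

lemma ratio_bound:
  fixes r :: "'b \<Rightarrow> real"
  assumes \<pi>: "prob_space \<pi>" and r: "r \<in> borel_measurable \<pi>" "integrable \<pi> r" "\<And>s. s \<in> space \<pi> \<Longrightarrow> 0 < r s"
    and S: "S \<in> sets \<pi>" and V: "V \<in> sets \<pi>" and p: "0 < measure \<pi> V"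
    and a: "0 \<le> a" and g: "0 < g"
    and num: "(\<integral>\<^sup>+s. ennreal (r s) * indicator S s \<partial>\<pi>) \<le> ennreal a"
    and den: "(\<integral>\<^sup>+s. ennreal (1 / r s) * indicator V s \<partial>\<pi>) \<le> ennreal (g * measure \<pi> V)"
  shows "\<bar>(LINT s:S|\<pi>. r s) / (LINT s|\<pi>. r s)\<bar> \<le> a * g / measure \<pi> V"
proof -
  interpret prob_space \<pi> by fact
  note [measurable] = r(1) S V
  let ?p = "measure \<pi> V"
  have num0: "0 \<le> (LINT s:S|\<pi>. r s)"
    unfolding set_lebesgue_integral_def using r(3)
    by (intro Bochner_Integration.integral_nonneg_AE AE_I2) (auto simp: indicator_def less_imp_le)
  have "ennreal (LINT s:S|\<pi>. r s) = (\<integral>\<^sup>+s. ennreal (indicator S s *\<^sub>R r s) \<partial>\<pi>)"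
    unfolding set_lebesgue_integral_def
    by (rule nn_integral_eq_integral[symmetric])
      (use r S integrable_mult_indicator[OF S r(2)] in \<open>auto simp: indicator_def less_imp_le\<close>)
  also have "\<dots> = (\<integral>\<^sup>+s. ennreal (r s) * indicator S s \<partial>\<pi>)"
    by (intro nn_integral_cong) (simp add: indicator_def)
  finally have "ennreal (LINT s:S|\<pi>. r s) \<le> ennreal a" using num by (rule ord_eq_le_trans)
  then have num1: "(LINT s:S|\<pi>. r s) \<le> a" unfolding ennreal_le_iff[OF a] .
  define H where "H s = indicator V s * (1 / r s)" for s
  have [measurable]: "H \<in> borel_measurable \<pi>" unfolding H_def by measurable
  have H0: "0 \<le> H s" if "s \<in> space \<pi>" for s
    using r(3)[OF that] by (simp add: H_def)
  have "(\<integral>\<^sup>+s. ennreal (H s) \<partial>\<pi>) = (\<integral>\<^sup>+s. ennreal (1 / r s) * indicator V s \<partial>\<pi>)"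
    by (intro nn_integral_cong) (simp add: H_def indicator_def)
  then have Hle: "(\<integral>\<^sup>+s. ennreal (H s) \<partial>\<pi>) \<le> ennreal (g * ?p)" using den by simp
  have Hint: "integrable \<pi> H"
    by (rule integrableI_nonneg) (use H0 Hle in \<open>auto simp: AE_I2 intro: le_less_trans\<close>)
  have Vint: "integrable \<pi> (indicator V :: 'b \<Rightarrow> real)"
    by (rule integrable_real_indicator) (use V in \<open>auto simp: emeasure_eq_measure\<close>)
  then have Vint': "integrable \<pi> (\<lambda>s. 2 / g * indicator V s)" by (rule integrable_mult_right)
  have "ennreal (\<integral>s. H s \<partial>\<pi>) \<le> ennreal (g * ?p)"
    using Hle by (subst nn_integral_eq_integral[OF Hint, symmetric]) (use H0 in auto)
  then have HI: "(\<integral>s. H s \<partial>\<pi>) \<le> g * ?p" using g p by (simp add: ennreal_le_iff)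
  have low: "?p / g \<le> (LINT s|\<pi>. r s)"
  proof -
    \<comment> \<open>With the mean of \<open>H\<close> at its largest admissible value
      \<open>g * ?p\<close>, the second term takes away half of the first.\<close>
    have "?p / g = 2 / g * ?p - 1 / g\<^sup>2 * (g * ?p)" using g by (simp add: field_simps power2_eq_square)
    also have "\<dots> \<le> 2 / g * ?p - 1 / g\<^sup>2 * (\<integral>s. H s \<partial>\<pi>)"
      using HI by (intro diff_left_mono mult_left_mono) auto
    also have "\<dots> = (\<integral>s. 2 / g * indicator V s - 1 / g\<^sup>2 * H s \<partial>\<pi>)"
      using Hint V Vint' by (subst Bochner_Integration.integral_diff) auto
    also have "\<dots> \<le> (LINT s|\<pi>. r s)"
    proof (rule integral_mono)
      show "integrable \<pi> (\<lambda>s. 2 / g * indicator V s - 1 / g\<^sup>2 * H s)"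
        by (intro Bochner_Integration.integrable_diff Vint' integrable_mult_right Hint)
      fix s assume "s \<in> space \<pi>"
      then have rs: "0 < r s" by (rule r(3))
      show "2 / g * indicator V s - 1 / g\<^sup>2 * H s \<le> r s"
      proof (cases "s \<in> V")
        case True
        have "0 \<le> (g * r s - 1)\<^sup>2 / (g\<^sup>2 * r s)" using rs by simp
        also have "\<dots> = r s - (2 / g - 1 / g\<^sup>2 * (1 / r s))"
          using rs g by (simp add: power2_eq_square field_simps)
        finally show ?thesis using True by (simp add: H_def)
      next
        case False
        then show ?thesis using rs by (simp add: H_def)
      qed
    qed (rule r(2))
    finally show ?thesis .
  qed
  have "0 < ?p / g" using p g by simp
  then have "(LINT s:S|\<pi>. r s) / (LINT s|\<pi>. r s) \<le> a / (?p / g)"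
    using num0 num1 low a by (intro frac_le) auto
  moreover have "0 < (LINT s|\<pi>. r s)" using low \<open>0 < ?p / g\<close> by linarith
  ultimately show ?thesis using num0 by simp
qed

text \<open>The bad event is covered by three: \<phi> exceeds 1, the integral of
  \<open>R / \<phi>\<close> over \<open>S\<close> exceeds \<open>a\<close>, or the integral of
  \<open>1 / R\<close> over \<open>V\<close> exceeds \<open>g\<close> times the mass of
  \<open>V\<close>. Markov's inequality bounds each, for the last two after exchanging the integrals
  over paths and volatilities, so that mean bounds for each fixed \<open>s\<close> suffice. Outside
  these events \<open>R \<le> R / \<phi>\<close>, which makes \<open>a\<close> a bound for the
  numerator.\<close>

lemma posterior_mass_bound:
  fixes R :: "'a \<Rightarrow> 'b \<Rightarrow> real" and \<phi> :: "'a \<Rightarrow> real"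
  assumes P: "prob_space P" and \<pi>: "prob_space \<pi>"
    and Rm: "case_prod R \<in> borel_measurable (P \<Otimes>\<^sub>M \<pi>)"
    and Rpos: "\<And>x s. x \<in> space P \<Longrightarrow> s \<in> space \<pi> \<Longrightarrow> 0 < R x s"
    and Rint: "\<And>x. x \<in> space P \<Longrightarrow> integrable \<pi> (R x)"
    and \<phi>m: "\<phi> \<in> borel_measurable P" and \<phi>pos: "\<And>x. x \<in> space P \<Longrightarrow> 0 < \<phi> x"
    and S: "S \<in> sets \<pi>" and V: "V \<in> sets \<pi>" "0 < measure \<pi> V"
    and E\<phi>: "(\<integral>\<^sup>+x. ennreal (\<phi> x) \<partial>P) \<le> ennreal \<alpha>"
    and ES: "\<And>s. s \<in> S \<Longrightarrow> (\<integral>\<^sup>+x. ennreal (R x s / \<phi> x) \<partial>P) \<le> ennreal \<beta>"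
    and EV: "\<And>s. s \<in> V \<Longrightarrow> (\<integral>\<^sup>+x. ennreal (1 / R x s) \<partial>P) \<le> ennreal \<gamma>"
    and nonneg: "0 \<le> \<alpha>" "0 \<le> \<beta>" "0 \<le> \<gamma>" and ag: "0 < a" "0 < g" and \<eta>: "a * g / measure \<pi> V \<le> \<eta>"
  shows "measure P {x \<in> space P. \<bar>(LINT s:S|\<pi>. R x s) / (LINT s|\<pi>. R x s)\<bar> > \<eta>} \<le> \<alpha> + \<beta> / a + \<gamma> / g"
proof -
  interpret P: prob_space P by fact
  interpret \<pi>: prob_space \<pi> by fact
  interpret PP: pair_sigma_finite P \<pi> ..
  note [measurable] = Rm \<phi>m S V(1)
  let ?p = "measure \<pi> V"
  define A where "A x = (\<integral>\<^sup>+s. ennreal (R x s / \<phi> x) * indicator S s \<partial>\<pi>)" for x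
  define G where "G x = (\<integral>\<^sup>+s. ennreal (1 / R x s) * indicator V s \<partial>\<pi>)" for x
  have [measurable]: "A \<in> borel_measurable P" "G \<in> borel_measurable P"
    unfolding A_def G_def by measurable
  have "(\<integral>\<^sup>+x. A x \<partial>P) = (\<integral>\<^sup>+s. (\<integral>\<^sup>+x. ennreal (R x s / \<phi> x) * indicator S s \<partial>P) \<partial>\<pi>)"
    unfolding A_def by (rule PP.Fubini'[symmetric]) measurable
  also have "\<dots> \<le> (\<integral>\<^sup>+s. ennreal \<beta> \<partial>\<pi>)"
    by (intro nn_integral_mono) (use ES in \<open>auto simp: indicator_def\<close>)
  finally have EA: "(\<integral>\<^sup>+x. A x \<partial>P) \<le> ennreal \<beta>" by (simp add: \<pi>.emeasure_space_1)
  have "(\<integral>\<^sup>+x. G x \<partial>P) = (\<integral>\<^sup>+s. (\<integral>\<^sup>+x. ennreal (1 / R x s) * indicator V s \<partial>P) \<partial>\<pi>)"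
    unfolding G_def by (rule PP.Fubini'[symmetric]) measurable
  also have "\<dots> \<le> (\<integral>\<^sup>+s. ennreal \<gamma> * indicator V s \<partial>\<pi>)"
    by (intro nn_integral_mono) (use EV in \<open>auto simp: indicator_def\<close>)
  also have "\<dots> = ennreal (\<gamma> * ?p)"
    using nonneg V by (simp add: nn_integral_cmult \<pi>.emeasure_eq_measure ennreal_mult'')
  finally have EG: "(\<integral>\<^sup>+x. G x \<partial>P) \<le> ennreal (\<gamma> * ?p)" .
  let ?E1 = "{x \<in> space P. ennreal 1 < ennreal (\<phi> x)}"
  let ?E2 = "{x \<in> space P. ennreal a < A x}"
  let ?E3 = "{x \<in> space P. ennreal (g * ?p) < G x}"
  let ?E = "{x \<in> space P. \<bar>(LINT s:S|\<pi>. R x s) / (LINT s|\<pi>. R x s)\<bar> > \<eta>}"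
  have "?E \<subseteq> ?E1 \<union> ?E2 \<union> ?E3"
  proof (rule ccontr)
    assume "\<not> ?E \<subseteq> ?E1 \<union> ?E2 \<union> ?E3"
    then obtain x where xE: "x \<in> ?E" "x \<notin> ?E1" "x \<notin> ?E2" "x \<notin> ?E3" by blast
    then have x: "x \<in> space P" "\<bar>(LINT s:S|\<pi>. R x s) / (LINT s|\<pi>. R x s)\<bar> > \<eta>"
      "\<phi> x \<le> 1" "A x \<le> ennreal a" "G x \<le> ennreal (g * ?p)"
      using ennreal_less_iff[of 1 "\<phi> x"] by (auto simp only: mem_Collect_eq not_less)
    have [measurable]: "R x \<in> borel_measurable \<pi>" using x(1) by measurable
    have "(\<integral>\<^sup>+s. ennreal (R x s) * indicator S s \<partial>\<pi>) \<le> A x"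
      unfolding A_def
    proof (intro nn_integral_mono mult_right_mono ennreal_leI)
      fix s assume "s \<in> space \<pi>"
      then show "R x s \<le> R x s / \<phi> x"
        using Rpos[OF x(1)] \<phi>pos[OF x(1)] x(3) by (simp add: pos_le_divide_eq mult_left_le)
    qed simp
    then have "(\<integral>\<^sup>+s. ennreal (R x s) * indicator S s \<partial>\<pi>) \<le> ennreal a" using x(4) by (rule order_trans)
    then have "\<bar>(LINT s:S|\<pi>. R x s) / (LINT s|\<pi>. R x s)\<bar> \<le> a * g / ?p"
      using x(1,5) ag by (intro ratio_bound \<pi> S V Rint Rpos) (auto simp: G_def)
    then show False using x(2) \<eta> by simp
  qed
  then have "measure P ?E \<le> measure P (?E1 \<union> ?E2 \<union> ?E3)"
    by (rule P.finite_measure_mono) measurable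
  also have "\<dots> \<le> measure P ?E1 + measure P ?E2 + measure P ?E3"
    by (intro order_trans[OF measure_Un_le] add_right_mono) (auto intro: measure_Un_le)
  also have "measure P ?E1 \<le> \<alpha> / 1"
    by (rule P.Markov_prob_bound) (use E\<phi> nonneg in auto)
  also have "measure P ?E2 \<le> \<beta> / a"
    by (rule P.Markov_prob_bound) (use EA nonneg ag in auto)
  also have "measure P ?E3 \<le> \<gamma> * ?p / (g * ?p)"
    by (rule P.Markov_prob_bound) (use EG nonneg ag V in auto)
  also have "\<gamma> * ?p / (g * ?p) = \<gamma> / g" using V by simp
  finally show ?thesis by simp
qed

section \<open>Cell variances and the likelihood ratio of a path\<close>

definition cvar :: "nat \<Rightarrow> (real \<Rightarrow> real) \<Rightarrow> nat \<Rightarrow> real" where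
  "cvar n s i = ivar s ((real i - 1) / real n) (real i / real n)"

definition increment :: "nat \<Rightarrow> nat \<Rightarrow> (real \<Rightarrow> real) \<Rightarrow> real" where
  "increment n i x = x (real i / real n) - x ((real i - 1) / real n)"

definition LR :: "(real \<Rightarrow> real) \<Rightarrow> nat \<Rightarrow> (real \<Rightarrow> real) \<Rightarrow> (real \<Rightarrow> real) \<Rightarrow> real" where
  "LR s\<^sub>0 n x s = (\<Prod>i=1..n. lr (cvar n s\<^sub>0 i) (cvar n s i) (increment n i x))"

lemma cell_endpoints:
  assumes "i \<in> {1..n}"
  shows "(real i - 1) / real n \<in> {0..1}" "real i / real n \<in> {0..1}"
    "(real i - 1) / real n \<le> real i / real n" "real i / real n - (real i - 1) / real n = 1 / real n"
  using assms by (auto simp: field_simps)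

lemma cvar_bounds:
  assumes "s \<in> vol_class \<kappa> K M" "0 < \<kappa>" "i \<in> {1..n}"
  shows "\<kappa>\<^sup>2 / real n \<le> cvar n s i" "cvar n s i \<le> K\<^sup>2 / real n" "0 < cvar n s i"
proof -
  note c = cell_endpoints[OF assms(3)]
  show 1: "\<kappa>\<^sup>2 / real n \<le> cvar n s i" "cvar n s i \<le> K\<^sup>2 / real n"
    using ivar_bounds[OF assms(1), of "(real i - 1) / real n" "real i / real n"] c assms(2)
    by (auto simp: cvar_def)
  have "0 < \<kappa>\<^sup>2 / real n" using assms by simp
  then show "0 < cvar n s i" using 1 by linarith
qed

lemma cvar_diff_le:
  assumes "s \<in> vol_class \<kappa> K M" "s' \<in> vol_class \<kappa> K M" "0 < \<kappa>" "i \<in> {1..n}"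
    and "\<And>u. u \<in> {0..1} \<Longrightarrow> \<bar>s u - s' u\<bar> \<le> d"
  shows "\<bar>cvar n s i - cvar n s' i\<bar> \<le> 2 * K * d / real n"
proof -
  note c = cell_endpoints[OF assms(4)]
  have "\<bar>cvar n s i - cvar n s' i\<bar> \<le> 2 * K * d * (real i / real n - (real i - 1) / real n)"
    unfolding cvar_def by (rule ivar_diff_le[OF assms(1,2)]) (use c assms in auto)
  then show ?thesis unfolding c(4) by simp
qed

lemma cvar_ratio:
  assumes "s \<in> vol_class \<kappa> K M" "s' \<in> vol_class \<kappa> K M" "0 < \<kappa>" "i \<in> {1..n}"
    and "\<And>u. u \<in> {0..1} \<Longrightarrow> \<bar>s u - s' u\<bar> \<le> d"
  shows "\<bar>cvar n s i / cvar n s' i - 1\<bar> \<le> 2 * K * d / \<kappa>\<^sup>2"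
proof -
  note b = cvar_bounds[OF assms(2-4)]
  have d: "0 \<le> d" using assms(5)[of 0] by (rule order_trans[rotated]) auto
  have K: "0 \<le> K" using vol_class_bounds[OF assms(1), of 0] assms(3) by auto
  have "\<bar>cvar n s i / cvar n s' i - 1\<bar> = \<bar>cvar n s i - cvar n s' i\<bar> / cvar n s' i"
    using b(3) by (simp add: field_simps abs_if)
  also have "\<dots> \<le> (2 * K * d / real n) / (\<kappa>\<^sup>2 / real n)"
    using cvar_diff_le[OF assms] b assms(3,4) d K by (intro frac_le) auto
  also have "\<dots> = 2 * K * d / \<kappa>\<^sup>2" using assms(4) by simp
  finally show ?thesis .
qed

lemma cvar_measurable:
  assumes "i \<in> {1..n}" "0 < \<kappa>" "vol_class \<kappa> K M \<noteq> {}"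
  shows "(\<lambda>s. cvar n s i) \<in> borel_measurable (vol_borel \<kappa> K M)"
proof (rule sup_Lipschitz_measurable)
  obtain s where "s \<in> vol_class \<kappa> K M" using assms by blast
  then have "0 \<le> K" using vol_class_bounds[of s \<kappa> K M 0] assms(2) by auto
  then show "0 \<le> 2 * K / real n" by simp
  show "\<bar>cvar n s i - cvar n s' i\<bar> \<le> 2 * K / real n * d"
    if "s \<in> vol_class \<kappa> K M" "s' \<in> vol_class \<kappa> K M" "\<And>u. u \<in> {0..1} \<Longrightarrow> \<bar>s u - s' u\<bar> \<le> d" for s s' d
    using cvar_diff_le[OF that(1,2) assms(2,1) that(3)] by simp
qed

lemma likelihood_LR:
  assumes s0: "s\<^sub>0 \<in> vol_class \<kappa> K M" and s: "s \<in> vol_class \<kappa> K M" and \<kappa>: "0 < \<kappa>"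
  shows "likelihood n x s = likelihood n x s\<^sub>0 * LR s\<^sub>0 n x s" "0 < likelihood n x s\<^sub>0"
proof -
  let ?f = "\<lambda>s i. 1 / sqrt (2 * pi * cvar n s i) * psi (increment n i x / sqrt (cvar n s i))"
  have L: "likelihood n x s = (\<Prod>i=1..n. ?f s i)" if s: "s \<in> vol_class \<kappa> K M" for s
    unfolding likelihood_def Let_def
  proof (rule prod.cong[OF refl])
    fix i assume i: "i \<in> {1..n}"
    have "(LBINT u:{(real i - 1) / real n..real i / real n}. (s u)\<^sup>2) = cvar n s i"
      using LBINT_eq_ivar[OF s, of "(real i - 1) / real n" "real i / real n"] cell_endpoints[OF i]
      by (auto simp: cvar_def)
    then show "1 / sqrt (2 * pi * (LBINT u:{(real i - 1) / real n..real i / real n}. (s u)\<^sup>2)) *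
        psi ((x (real i / real n) - x ((real i - 1) / real n)) / sqrt (LBINT u:{(real i - 1) / real n..real i / real n}. (s u)\<^sup>2))
      = ?f s i" by (simp add: increment_def)
  qed
  have "?f s i = ?f s\<^sub>0 i * lr (cvar n s\<^sub>0 i) (cvar n s i) (increment n i x)" if i: "i \<in> {1..n}" for i
  proof -
    define v w y where "v = cvar n s\<^sub>0 i" and "w = cvar n s i" and "y = increment n i x"
    have vw: "0 < v" "0 < w" using cvar_bounds(3)[OF s0 \<kappa> i] cvar_bounds(3)[OF s \<kappa> i] by (auto simp: v_def w_def)
    have e: "- (y / sqrt v)\<^sup>2 / 2 + - y\<^sup>2 * (1 / w - 1 / v) / 2 = - (y / sqrt w)\<^sup>2 / 2"
      using vw by (simp add: power_divide field_simps)
    have "psi (y / sqrt v) * exp (- y\<^sup>2 * (1 / w - 1 / v) / 2) = psi (y / sqrt w)"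
      unfolding psi_def exp_add[symmetric] e ..
    moreover have "1 / sqrt (2 * pi * v) * sqrt (v / w) = 1 / sqrt (2 * pi * w)"
      using vw by (simp add: real_sqrt_mult real_sqrt_divide)
    ultimately have "1 / sqrt (2 * pi * w) * psi (y / sqrt w)
       = (1 / sqrt (2 * pi * v) * sqrt (v / w)) * (psi (y / sqrt v) * exp (- y\<^sup>2 * (1 / w - 1 / v) / 2))"
      by simp
    also have "\<dots> = 1 / sqrt (2 * pi * v) * psi (y / sqrt v) * lr v w y"
      unfolding lr_def by (simp only: mult_ac)
    finally show ?thesis unfolding v_def w_def y_def .
  qed
  then show "likelihood n x s = likelihood n x s\<^sub>0 * LR s\<^sub>0 n x s"
    unfolding L[OF s] L[OF s0] LR_def prod.distrib[symmetric] by (rule prod.cong[OF refl])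
  show "0 < likelihood n x s\<^sub>0"
    unfolding L[OF s0] by (intro prod_pos) (use cvar_bounds(3)[OF s0 \<kappa>] in \<open>auto simp: psi_def\<close>)
qed

text \<open>The likelihood at \<open>s\<^sub>0\<close> is positive and constant in the integration
  variable, so it cancels between numerator and denominator.\<close>

lemma posterior_LR:
  assumes s0: "s\<^sub>0 \<in> vol_class \<kappa> K M" and \<kappa>: "0 < \<kappa>" and sp: "space \<pi> = vol_class \<kappa> K M"
  shows "posterior \<pi> n x S = (LINT s:S|\<pi>. LR s\<^sub>0 n x s) / (LINT s|\<pi>. LR s\<^sub>0 n x s)"
proof -
  have "(LINT s:S|\<pi>. likelihood n x s) = (LINT s:S|\<pi>. likelihood n x s\<^sub>0 * LR s\<^sub>0 n x s)"
    "(LINT s|\<pi>. likelihood n x s) = (LINT s|\<pi>. likelihood n x s\<^sub>0 * LR s\<^sub>0 n x s)"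
    unfolding set_lebesgue_integral_def
    by (intro Bochner_Integration.integral_cong refl arg_cong2[where f=scaleR];
        use likelihood_LR(1)[OF s0 _ \<kappa>] sp in simp)+
  then show ?thesis unfolding posterior_def using likelihood_LR(2)[OF s0 s0 \<kappa>, of n x] by simp
qed

lemma LR_pos:
  assumes "s\<^sub>0 \<in> vol_class \<kappa> K M" "s \<in> vol_class \<kappa> K M" "0 < \<kappa>"
  shows "0 < LR s\<^sub>0 n x s"
  unfolding LR_def by (intro prod_pos lr_pos cvar_bounds(3)[OF assms(1,3)] cvar_bounds(3)[OF assms(2,3)])

lemma increment_measurable:
  assumes "i \<in> {1..n}"
  shows "increment n i \<in> borel_measurable (PiM {0..1} (\<lambda>_. borel))"
  unfolding increment_def using cell_endpoints[OF assms] by measurable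

lemma LR_measurable:
  assumes s0: "s\<^sub>0 \<in> vol_class \<kappa> K M" and \<kappa>: "0 < \<kappa>" and sets: "sets \<pi> = sets (vol_borel \<kappa> K M)"
    and setsP: "sets P = sets (PiM {0..1} (\<lambda>_. borel))"
  shows "(\<lambda>(x, s). LR s\<^sub>0 n x s) \<in> borel_measurable (P \<Otimes>\<^sub>M \<pi>)"
proof -
  have "(\<lambda>z. lr (cvar n s\<^sub>0 i) (cvar n (snd z) i) (increment n i (fst z))) \<in> borel_measurable (P \<Otimes>\<^sub>M \<pi>)"
    if i: "i \<in> {1..n}" for i
  proof -
    have c: "(\<lambda>s. cvar n s i) \<in> borel_measurable \<pi>"
      using cvar_measurable[OF i \<kappa>, of K M] s0 measurable_cong_sets[OF sets refl] by auto
    have d: "increment n i \<in> borel_measurable P"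
      using increment_measurable[OF i] measurable_cong_sets[OF setsP refl] by auto
    have [measurable]: "(\<lambda>z. cvar n (snd z) i) \<in> borel_measurable (P \<Otimes>\<^sub>M \<pi>)"
      "(\<lambda>z. increment n i (fst z)) \<in> borel_measurable (P \<Otimes>\<^sub>M \<pi>)"
      using measurable_compose[OF measurable_snd c] measurable_compose[OF measurable_fst d] by auto
    show ?thesis unfolding lr_def by measurable
  qed
  then show ?thesis unfolding LR_def case_prod_beta' by (intro borel_measurable_prod)
qed

text \<open>For a fixed path the ratio is bounded uniformly in \<open>s\<close>: the cell variances
  are at least \<open>\<kappa>\<^sup>2 / n\<close>, and dropping the negative part of the exponent
  leaves a term free of \<open>s\<close>.\<close>

lemma LR_integrable:
  assumes s0: "s\<^sub>0 \<in> vol_class \<kappa> K M" and \<kappa>: "0 < \<kappa>" and \<pi>: "prob_space \<pi>"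
    and sets: "sets \<pi> = sets (vol_borel \<kappa> K M)"
  shows "integrable \<pi> (LR s\<^sub>0 n x)"
proof -
  interpret prob_space \<pi> by fact
  have sp: "space \<pi> = vol_class \<kappa> K M" using sets_eq_imp_space_eq[OF sets] space_vol_borel by simp
  show ?thesis
  proof (rule integrable_const_bound)
    have c: "(\<lambda>s. cvar n s i) \<in> borel_measurable \<pi>" if i: "i \<in> {1..n}" for i
      using cvar_measurable[OF i \<kappa>, of K M] s0 measurable_cong_sets[OF sets refl] by auto
    have "(\<lambda>s. lr (cvar n s\<^sub>0 i) (cvar n s i) (increment n i x)) \<in> borel_measurable \<pi>" if i: "i \<in> {1..n}" for i
      unfolding lr_def using c[OF i] by measurable
    then show "LR s\<^sub>0 n x \<in> borel_measurable \<pi>" unfolding LR_def[abs_def] by (intro borel_measurable_prod)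
    show "AE s in \<pi>. norm (LR s\<^sub>0 n x s) \<le>
      (\<Prod>i=1..n. sqrt (cvar n s\<^sub>0 i / (\<kappa>\<^sup>2 / real n)) * exp ((increment n i x)\<^sup>2 / (2 * cvar n s\<^sub>0 i)))"
    proof (intro AE_I2)
      fix s assume "s \<in> space \<pi>"
      then have s: "s \<in> vol_class \<kappa> K M" by (simp add: sp)
      have "LR s\<^sub>0 n x s \<le> (\<Prod>i=1..n. sqrt (cvar n s\<^sub>0 i / (\<kappa>\<^sup>2 / real n)) * exp ((increment n i x)\<^sup>2 / (2 * cvar n s\<^sub>0 i)))"
        unfolding LR_def
      proof (intro prod_mono conjI)
        fix i assume i: "i \<in> {1..n}"
        note b0 = cvar_bounds[OF s0 \<kappa> i] and b = cvar_bounds[OF s \<kappa> i]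
        show "0 \<le> lr (cvar n s\<^sub>0 i) (cvar n s i) (increment n i x)" using lr_pos[OF b0(3) b(3)] by (rule less_imp_le)
        have "- (increment n i x)\<^sup>2 * (1 / cvar n s i - 1 / cvar n s\<^sub>0 i) / 2
            = (increment n i x)\<^sup>2 / (2 * cvar n s\<^sub>0 i) - (increment n i x)\<^sup>2 / (2 * cvar n s i)"
          using b0(3) b(3) by (simp add: field_simps)
        also have "\<dots> \<le> (increment n i x)\<^sup>2 / (2 * cvar n s\<^sub>0 i)" using b(3) by simp
        finally have "exp (- (increment n i x)\<^sup>2 * (1 / cvar n s i - 1 / cvar n s\<^sub>0 i) / 2)
          \<le> exp ((increment n i x)\<^sup>2 / (2 * cvar n s\<^sub>0 i))" by simp
        moreover have "sqrt (cvar n s\<^sub>0 i / cvar n s i) \<le> sqrt (cvar n s\<^sub>0 i / (\<kappa>\<^sup>2 / real n))"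
          using b0 b \<kappa> i by (intro real_sqrt_le_mono divide_left_mono mult_pos_pos) auto
        moreover have "0 \<le> sqrt (cvar n s\<^sub>0 i / (\<kappa>\<^sup>2 / real n))" using b0(3) by simp
        ultimately show "lr (cvar n s\<^sub>0 i) (cvar n s i) (increment n i x)
          \<le> sqrt (cvar n s\<^sub>0 i / (\<kappa>\<^sup>2 / real n)) * exp ((increment n i x)\<^sup>2 / (2 * cvar n s\<^sub>0 i))"
          unfolding lr_def by (intro mult_mono) auto
      qed
      then show "norm (LR s\<^sub>0 n x s) \<le> (\<Prod>i=1..n. sqrt (cvar n s\<^sub>0 i / (\<kappa>\<^sup>2 / real n)) * exp ((increment n i x)\<^sup>2 / (2 * cvar n s\<^sub>0 i)))"
        using LR_pos[OF s0 s \<kappa>, of n x] by simp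
    qed
  qed
qed

section \<open>Means under the law of the path\<close>

lemma path_measurable:
  assumes "solves_sde \<Omega> W s\<^sub>0 X"
  shows "(\<lambda>\<omega>. \<lambda>t\<in>{0..1}. X t \<omega>) \<in> measurable \<Omega> (PiM {0..1} (\<lambda>_. borel))"
  using assms unfolding solves_sde_def is_wiener_integral_def by (intro measurable_restrict) auto

lemma path_law_prob_space:
  assumes "std_brownian_motion \<Omega> W" "solves_sde \<Omega> W s\<^sub>0 X"
  shows "prob_space (path_law \<Omega> X)"
  unfolding path_law_def
  by (rule prob_space.prob_space_distr[OF std_brownian_motionD(1)[OF assms(1)] path_measurable[OF assms(2)]])

text \<open>The existential \<open>c\<close> and \<open>l\<close> are what the three moment lemmas
  for \<open>lr\<close> deliver, so each kind of ratio can be inserted as \<open>h\<close>. Cellwise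
  bounds then multiply to an exponential of a sum.\<close>

lemma path_law_moment:
  assumes W: "std_brownian_motion \<Omega> W" and X: "solves_sde \<Omega> W s\<^sub>0 X"
    and s0: "s\<^sub>0 \<in> vol_class \<kappa> K M" and \<kappa>: "0 < \<kappa>" and M: "0 \<le> M"
    and h: "\<And>i. i \<in> {1..n} \<Longrightarrow> \<exists>c l. 0 \<le> c \<and> 2 * l * cvar n s\<^sub>0 i < 1 \<and> (\<forall>y. h i y = c * exp (l * y\<^sup>2)) \<and>
        c / sqrt (1 - 2 * l * cvar n s\<^sub>0 i) \<le> exp (e i)"
  shows "(\<integral>\<^sup>+x. ennreal (\<Prod>i=1..n. h i (increment n i x)) \<partial>path_law \<Omega> X) \<le> ennreal (exp (\<Sum>i=1..n. e i))"
proof -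
  have "\<exists>c l. \<forall>i. i \<in> {1..n} \<longrightarrow> 0 \<le> c i \<and> 2 * l i * cvar n s\<^sub>0 i < 1 \<and> (\<forall>y. h i y = c i * exp (l i * y\<^sup>2)) \<and>
        c i / sqrt (1 - 2 * l i * cvar n s\<^sub>0 i) \<le> exp (e i)"
    using h by metis
  then obtain c l where c: "\<And>i. i \<in> {1..n} \<Longrightarrow> 0 \<le> c i" and l: "\<And>i. i \<in> {1..n} \<Longrightarrow> 2 * l i * cvar n s\<^sub>0 i < 1"
    and hcl: "\<And>i y. i \<in> {1..n} \<Longrightarrow> h i y = c i * exp (l i * y\<^sup>2)"
    and le: "\<And>i. i \<in> {1..n} \<Longrightarrow> c i / sqrt (1 - 2 * l i * cvar n s\<^sub>0 i) \<le> exp (e i)" by blast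
  have h0: "0 \<le> h i y" if "i \<in> {1..n}" for i y using hcl[OF that] c[OF that] by simp
  have hm: "(\<lambda>x. ennreal (\<Prod>i=1..n. h i (increment n i x))) \<in> borel_measurable (PiM {0..1} (\<lambda>_. borel))"
  proof -
    have "(\<lambda>x. h i (increment n i x)) \<in> borel_measurable (PiM {0..1} (\<lambda>_. borel))" if i: "i \<in> {1..n}" for i
      unfolding hcl[OF i] using increment_measurable[OF i] by measurable
    then have "(\<lambda>x. \<Prod>i=1..n. h i (increment n i x)) \<in> borel_measurable (PiM {0..1} (\<lambda>_. borel))"
      by (rule borel_measurable_prod)
    then show ?thesis by simp
  qed
  have "(\<integral>\<^sup>+x. ennreal (\<Prod>i=1..n. h i (increment n i x)) \<partial>path_law \<Omega> X)
      = (\<integral>\<^sup>+\<omega>. ennreal (\<Prod>i=1..n. h i (increment n i (\<lambda>t\<in>{0..1}. X t \<omega>))) \<partial>\<Omega>)"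
    unfolding path_law_def using hm by (subst nn_integral_distr[OF path_measurable[OF X]]) simp_all
  also have "\<dots> = (\<integral>\<^sup>+\<omega>. (\<Prod>i=1..n. ennreal (c i * exp (l i * (X (real i / real n) \<omega> - X ((real i - 1) / real n) \<omega>)\<^sup>2))) \<partial>\<Omega>)"
  proof (intro nn_integral_cong)
    fix \<omega>
    have "ennreal (\<Prod>i=1..n. h i (increment n i (\<lambda>t\<in>{0..1}. X t \<omega>)))
       = (\<Prod>i=1..n. ennreal (h i (increment n i (\<lambda>t\<in>{0..1}. X t \<omega>))))"
      by (intro prod_ennreal[symmetric] h0)
    also have "\<dots> = (\<Prod>i=1..n. ennreal (c i * exp (l i * (X (real i / real n) \<omega> - X ((real i - 1) / real n) \<omega>)\<^sup>2)))"
    proof (rule prod.cong[OF refl])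
      fix i assume i: "i \<in> {1..n}"
      have "increment n i (\<lambda>t\<in>{0..1}. X t \<omega>) = X (real i / real n) \<omega> - X ((real i - 1) / real n) \<omega>"
        unfolding increment_def using cell_endpoints(1,2)[OF i] by (simp only: restrict_apply')
      then show "ennreal (h i (increment n i (\<lambda>t\<in>{0..1}. X t \<omega>)))
        = ennreal (c i * exp (l i * (X (real i / real n) \<omega> - X ((real i - 1) / real n) \<omega>)\<^sup>2))"
        by (simp only: hcl[OF i])
    qed
    finally show "ennreal (\<Prod>i=1..n. h i (increment n i (\<lambda>t\<in>{0..1}. X t \<omega>)))
       = (\<Prod>i=1..n. ennreal (c i * exp (l i * (X (real i / real n) \<omega> - X ((real i - 1) / real n) \<omega>)\<^sup>2)))" .
  qed
  also have "\<dots> \<le> (\<Prod>i=1..n. ennreal (c i / sqrt (1 - 2 * l i * cvar n s\<^sub>0 i)))"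
    unfolding cvar_def by (rule increment_moment[OF W s0 \<kappa> X M c]) (use l in \<open>simp add: cvar_def\<close>)+
  also have "\<dots> \<le> (\<Prod>i=1..n. ennreal (exp (e i)))"
    by (intro prod_mono_ennreal ennreal_leI le)
  also have "\<dots> = ennreal (exp (\<Sum>i=1..n. e i))"
    by (simp add: prod_ennreal exp_sum)
  finally show ?thesis .
qed

section \<open>Contraction\<close>

text \<open>A volatility is coded by its values at \<open>m + 1\<close> grid points, rounded down to
  multiples of \<open>e\<close>, and one representative of each occurring code is kept.
  Representatives are taken from \<open>S\<close>, so the net inherits the separation from
  \<open>s\<^sub>0\<close>. Rounding each value without regard to its neighbours produces the
  logarithmic factor. In the radius, \<open>1\<close> accounts for the rounding and
  \<open>2 * M\<close> for moving both functions to a grid point.\<close>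

lemma vol_class_net:
  assumes S: "S \<subseteq> vol_class \<kappa> K M" and \<kappa>: "0 < \<kappa>" "\<kappa> < K" and M: "0 \<le> M" and e: "0 < e"
  obtains F where "finite F" "F \<subseteq> S" "real (card F) \<le> exp ((1 / e + 2) * ln (K / e + 1))"
    "\<And>s. s \<in> S \<Longrightarrow> \<exists>t\<in>F. \<forall>u\<in>{0..1}. \<bar>s u - t u\<bar> \<le> (1 + 2 * M) * e"
proof -
  define m where "m = nat \<lceil>1 / e\<rceil>"
  have m: "1 / e \<le> real m" "real m \<le> 1 / e + 1" using e by (auto simp: m_def of_nat_nat intro: less_imp_le)
  have m0: "0 < real m" using m(1) e by (meson less_le_trans zero_less_divide_1_iff)
  have me: "1 / real m \<le> e" using m(1) m0 e by (simp add: field_simps)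
  define q where "q = nat \<lfloor>K / e\<rfloor>"
  have q: "real q \<le> K / e" using e \<kappa> by (simp add: q_def)
  define code where "code s = (\<lambda>k\<in>{..m}. nat \<lfloor>s (real k / real m) / e\<rfloor>)" for s :: "real \<Rightarrow> real"
  define rep where "rep c = (SOME s. s \<in> S \<and> code s = c)" for c
  have grid: "real k / real m \<in> {0..1}" if "k \<le> m" for k using that m0 by auto
  have codeS: "code ` S \<subseteq> {..m} \<rightarrow>\<^sub>E {..q}"
  proof
    fix c assume "c \<in> code ` S"
    then obtain s where s: "s \<in> S" "c = code s" by auto
    have "nat \<lfloor>s (real k / real m) / e\<rfloor> \<le> q" if "k \<le> m" for k
    proof -
      have "s (real k / real m) \<le> K" using vol_class_bounds(2) S s(1) grid[OF that] by blast
      then show ?thesis unfolding q_def using e by (intro nat_mono floor_mono divide_right_mono) auto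
    qed
    then show "c \<in> {..m} \<rightarrow>\<^sub>E {..q}" by (auto simp: s(2) code_def)
  qed
  have finE: "finite ({..m} \<rightarrow>\<^sub>E {..q})" by (intro finite_PiE) auto
  have rep: "rep (code s) \<in> S \<and> code (rep (code s)) = code s" if "s \<in> S" for s
    unfolding rep_def by (rule someI[of _ s]) (use that in simp)
  show ?thesis
  proof (rule that[of "rep ` code ` S"])
    show "finite (rep ` code ` S)" using finite_subset[OF codeS finE] by simp
    show "rep ` code ` S \<subseteq> S" using rep by auto
    have "card (rep ` code ` S) \<le> card (code ` S)"
      by (rule card_image_le[OF finite_subset[OF codeS finE]])
    also have "\<dots> \<le> card ({..m} \<rightarrow>\<^sub>E {..q})" by (rule card_mono[OF finE codeS])
    also have "\<dots> = (q + 1) ^ (m + 1)" by (simp add: card_funcsetE)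
    finally have "real (card (rep ` code ` S)) \<le> (real q + 1) ^ (m + 1)"
      by (metis of_nat_1 of_nat_add of_nat_le_iff of_nat_power)
    also have "\<dots> \<le> (K / e + 1) ^ (m + 1)" using q by (intro power_mono) auto
    also have "\<dots> = exp (real (m + 1) * ln (K / e + 1))"
    proof -
      have "0 < K / e + 1" using \<kappa> e by (simp add: add_pos_pos)
      then show ?thesis by (simp only: exp_of_nat_mult exp_ln)
    qed
    \<comment> \<open>As \<open>m\<close> is \<open>1 / e\<close> rounded up, \<open>m + 1\<close>
      is at most \<open>1 / e + 2\<close>.\<close>
    also have "\<dots> \<le> exp ((1 / e + 2) * ln (K / e + 1))"
    proof -
      have "0 \<le> ln (K / e + 1)" using \<kappa> e by (intro ln_ge_zero) simp
      then show ?thesis using m(2) by (simp add: mult_right_mono)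
    qed
    finally show "real (card (rep ` code ` S)) \<le> exp ((1 / e + 2) * ln (K / e + 1))" .
    fix s assume s: "s \<in> S"
    let ?t = "rep (code s)"
    have t: "?t \<in> S" "code ?t = code s" using rep[OF s] by auto
    have sX: "s \<in> vol_class \<kappa> K M" and tX: "?t \<in> vol_class \<kappa> K M" using S s t(1) by auto
    have "\<bar>s u - ?t u\<bar> \<le> (1 + 2 * M) * e" if u: "u \<in> {0..1}" for u
    proof -
      define k where "k = nat \<lfloor>u * real m\<rfloor>"
      have um: "0 \<le> u * real m" "u * real m \<le> real m" using u m0 by (auto simp: mult_left_le_one_le)
      have rk: "real k = of_int \<lfloor>u * real m\<rfloor>" using um by (simp add: k_def)
      have k: "real k \<le> u * real m" "u * real m < real k + 1" unfolding rk by linarith+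
      have km: "k \<le> m" using k um by linarith
      have "\<bar>u - real k / real m\<bar> \<le> 1 / real m"
      proof -
        have "u - real k / real m = (u * real m - real k) / real m" using m0 by (simp add: field_simps)
        moreover have "\<bar>u * real m - real k\<bar> \<le> 1" using k by linarith
        ultimately show ?thesis using m0 by (simp add: abs_divide divide_right_mono)
      qed
      then have "M * \<bar>u - real k / real m\<bar> \<le> M * e" using M me by (intro mult_left_mono) auto
      then have l: "\<bar>s u - s (real k / real m)\<bar> \<le> M * e" "\<bar>?t u - ?t (real k / real m)\<bar> \<le> M * e"
        using vol_class_Lipschitz[OF sX u grid[OF km]] vol_class_Lipschitz[OF tX u grid[OF km]] by linarith+
      have "code s k = code ?t k" using t by simp
      then have "nat \<lfloor>s (real k / real m) / e\<rfloor> = nat \<lfloor>?t (real k / real m) / e\<rfloor>" using km by (simp add: code_def)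
      \<comment> \<open>Nonnegativity turns equality of the codes, which pass through
        \<open>nat\<close>, into equality of the floors.\<close>
      moreover have "0 \<le> s (real k / real m) / e" "0 \<le> ?t (real k / real m) / e"
        using vol_class_bounds(1)[OF sX grid[OF km]] vol_class_bounds(1)[OF tX grid[OF km]] e \<kappa> by simp_all
      ultimately have "\<lfloor>s (real k / real m) / e\<rfloor> = \<lfloor>?t (real k / real m) / e\<rfloor>"
        by (subst (asm) eq_nat_nat_iff) (simp_all only: zero_le_floor)
      then have "\<bar>s (real k / real m) / e - ?t (real k / real m) / e\<bar> < 1" by linarith
      then have "\<bar>(s (real k / real m) - ?t (real k / real m)) / e\<bar> < 1" by (simp add: diff_divide_distrib)
      then have "\<bar>s (real k / real m) - ?t (real k / real m)\<bar> < e"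
        using e by (simp add: abs_divide)
      then show ?thesis using l by (simp add: algebra_simps)
    qed
    then show "\<exists>t\<in>rep ` code ` S. \<forall>u\<in>{0..1}. \<bar>s u - t u\<bar> \<le> (1 + 2 * M) * e"
      using s by blast
  qed
qed

section \<open>Means of the three likelihood expressions and the tail bound\<close>

lemma sqrt_prod: "sqrt (\<Prod>i\<in>A. f i) = (\<Prod>i\<in>A. sqrt (f i))"
  by (induction A rule: infinite_finite_induct) (auto simp: real_sqrt_mult)

context
  fixes \<Omega> :: "'w measure" and W X :: "real \<Rightarrow> 'w \<Rightarrow> real" and s\<^sub>0 :: "real \<Rightarrow> real" and \<kappa> K M :: real
  assumes W: "std_brownian_motion \<Omega> W" and X: "solves_sde \<Omega> W s\<^sub>0 X"
    and s0: "s\<^sub>0 \<in> vol_class \<kappa> K M" and \<kappa>: "0 < \<kappa>" "\<kappa> < K" and M: "0 < M"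
begin

lemma sum_cvar_diff_ge:
  assumes s: "s \<in> vol_class \<kappa> K M - U_nbhd \<kappa> K M s\<^sub>0 r" and n: "1 \<le> n" and r: "0 \<le> r"
  shows "2 * \<kappa>\<^sup>2 * r\<^sup>2 * real n - 16 * K\<^sup>2 * M\<^sup>2 / real n \<le> (\<Sum>i=1..n. (real n * (cvar n s i - cvar n s\<^sub>0 i))\<^sup>2)"
proof -
  have "r \<le> L2_norm01 (\<lambda>u. s u - s\<^sub>0 u)" "s \<in> vol_class \<kappa> K M" using s by (auto simp: U_nbhd_def)
  then have "r\<^sup>2 \<le> (L2_norm01 (\<lambda>u. s u - s\<^sub>0 u))\<^sup>2" using r by (intro power_mono)
  then have "2 * \<kappa>\<^sup>2 * r\<^sup>2 * real n \<le> 2 * \<kappa>\<^sup>2 * (L2_norm01 (\<lambda>u. s u - s\<^sub>0 u))\<^sup>2 * real n"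
    by (intro mult_right_mono mult_left_mono) auto
  also have "\<dots> \<le> (\<Sum>i=1..n. (real n * (cvar n s i - cvar n s\<^sub>0 i))\<^sup>2) + 16 * K\<^sup>2 * M\<^sup>2 / real n"
    unfolding cvar_def using L2_dist_le_sum_ivar[OF \<open>s \<in> vol_class \<kappa> K M\<close> s0 \<kappa>(1) n] M by simp
  finally show ?thesis by simp
qed

text \<open>The constant \<open>16 * K ^ 4\<close> combines the \<open>1 / 4\<close> of the affinity
  bound with \<open>w + v \<le> 2 * K\<^sup>2 / n\<close>, whose right side has square
  \<open>4 * K ^ 4 / n\<^sup>2\<close>.\<close>

lemma sqrt_LR_mean:
  assumes s: "s \<in> vol_class \<kappa> K M"
  shows "(\<integral>\<^sup>+x. ennreal (sqrt (LR s\<^sub>0 n x s)) \<partial>path_law \<Omega> X)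
    \<le> ennreal (exp (- (\<Sum>i=1..n. (real n * (cvar n s i - cvar n s\<^sub>0 i))\<^sup>2) / (16 * K ^ 4)))"
proof -
  let ?d = "\<lambda>i. real n * (cvar n s i - cvar n s\<^sub>0 i)"
  have "(\<integral>\<^sup>+x. ennreal (\<Prod>i=1..n. sqrt (lr (cvar n s\<^sub>0 i) (cvar n s i) (increment n i x))) \<partial>path_law \<Omega> X)
     \<le> ennreal (exp (\<Sum>i=1..n. - (?d i)\<^sup>2 / (16 * K ^ 4)))"
  proof (rule path_law_moment[OF W X s0 \<kappa>(1) less_imp_le[OF M]])
    fix i assume i: "i \<in> {1..n}"
    note b = cvar_bounds[OF s \<kappa>(1) i] and b0 = cvar_bounds[OF s0 \<kappa>(1) i]
    define v w where "v = cvar n s\<^sub>0 i" and "w = cvar n s i"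
    have vw: "0 < v" "0 < w" "w + v \<le> 2 * K\<^sup>2 / real n" using b b0 by (auto simp: v_def w_def)
    have n: "0 < real n" using i by auto
    obtain c l where cl: "0 \<le> c" "2 * l * v < 1" "\<And>x. sqrt (lr v w x) = c * exp (l * x\<^sup>2)"
      "c / sqrt (1 - 2 * l * v) \<le> exp (- ((w - v) / (w + v))\<^sup>2 / 4)"
      using sqrt_lr_moment[OF vw(1,2)] by blast
    have "(real n * (w - v))\<^sup>2 / (4 * K ^ 4) = (w - v)\<^sup>2 / (2 * K\<^sup>2 / real n)\<^sup>2"
      using n by (simp add: power_divide power_mult_distrib)
    also have "\<dots> \<le> (w - v)\<^sup>2 / (w + v)\<^sup>2"
      using vw by (intro divide_left_mono power_mono mult_pos_pos zero_less_power) auto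
    finally have "- ((w - v) / (w + v))\<^sup>2 / 4 \<le> - (real n * (w - v))\<^sup>2 / (16 * K ^ 4)"
      by (simp add: power_divide)
    then have "c / sqrt (1 - 2 * l * v) \<le> exp (- (real n * (w - v))\<^sup>2 / (16 * K ^ 4))"
      using cl(4) by (meson exp_le_cancel_iff order_trans)
    then show "\<exists>c l. 0 \<le> c \<and> 2 * l * cvar n s\<^sub>0 i < 1 \<and>
        (\<forall>y. sqrt (lr (cvar n s\<^sub>0 i) (cvar n s i) y) = c * exp (l * y\<^sup>2)) \<and>
        c / sqrt (1 - 2 * l * cvar n s\<^sub>0 i) \<le> exp (- (?d i)\<^sup>2 / (16 * K ^ 4))"
      using cl(1-3) unfolding v_def w_def by blast
  qed
  also have "(\<Sum>i=1..n. - (?d i)\<^sup>2 / (16 * K ^ 4)) = - (\<Sum>i=1..n. (?d i)\<^sup>2) / (16 * K ^ 4)"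
    by (simp add: sum_divide_distrib sum_negf)
  finally show ?thesis unfolding LR_def sqrt_prod .
qed

text \<open>Here \<open>t\<close> is a net point near \<open>s\<close>. The loss is of second order
  in the mesh, a multiple of \<open>n * d\<^sup>2\<close>, while the gain is measured by the
  distance of \<open>t\<close>, not of \<open>s\<close>, from \<open>s\<^sub>0\<close>. The
  constants come from \<open>v \<le> K\<^sup>2 / n\<close> and
  \<open>w' / v \<le> K\<^sup>2 / \<kappa>\<^sup>2\<close>.\<close>

lemma LR_div_sqrt_LR_mean:
  assumes s: "s \<in> vol_class \<kappa> K M" and t: "t \<in> vol_class \<kappa> K M"
    and near: "\<And>u. u \<in> {0..1} \<Longrightarrow> \<bar>s u - t u\<bar> \<le> d" and d: "2 * K * d / \<kappa>\<^sup>2 \<le> 1 / 2"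
  shows "(\<integral>\<^sup>+x. ennreal (LR s\<^sub>0 n x s / sqrt (LR s\<^sub>0 n x t)) \<partial>path_law \<Omega> X)
    \<le> ennreal (exp (real n * (32 * (2 * K * d / \<kappa>\<^sup>2)\<^sup>2)
        - (\<Sum>i=1..n. (real n * (cvar n t i - cvar n s\<^sub>0 i))\<^sup>2) / (128 * (1 + K\<^sup>2 / \<kappa>\<^sup>2)\<^sup>2 * K ^ 4)))"
proof -
  let ?d = "\<lambda>i. real n * (cvar n t i - cvar n s\<^sub>0 i)" and ?B = "K\<^sup>2 / \<kappa>\<^sup>2"
  let ?c = "32 * (2 * K * d / \<kappa>\<^sup>2)\<^sup>2" and ?C = "128 * (1 + ?B)\<^sup>2 * K ^ 4"
  have "(\<integral>\<^sup>+x. ennreal (\<Prod>i=1..n. lr (cvar n s\<^sub>0 i) (cvar n s i) (increment n i x)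
        / sqrt (lr (cvar n s\<^sub>0 i) (cvar n t i) (increment n i x))) \<partial>path_law \<Omega> X)
     \<le> ennreal (exp (\<Sum>i=1..n. ?c - (?d i)\<^sup>2 / ?C))"
  proof (rule path_law_moment[OF W X s0 \<kappa>(1) less_imp_le[OF M]])
    fix i assume i: "i \<in> {1..n}"
    note b = cvar_bounds[OF s \<kappa>(1) i] and b0 = cvar_bounds[OF s0 \<kappa>(1) i] and bt = cvar_bounds[OF t \<kappa>(1) i]
    define v w w' where "v = cvar n s\<^sub>0 i" and "w = cvar n s i" and "w' = cvar n t i"
    have vw: "0 < v" "0 < w" "0 < w'" "v \<le> K\<^sup>2 / real n" using b b0 bt by (auto simp: v_def w_def w'_def)
    have n: "0 < real n" using i by auto
    have q: "\<bar>w / w' - 1\<bar> \<le> 2 * K * d / \<kappa>\<^sup>2"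
      unfolding w_def w'_def by (rule cvar_ratio[OF s t \<kappa>(1) i near])
    have "w' / v \<le> (K\<^sup>2 / real n) / (\<kappa>\<^sup>2 / real n)"
      unfolding w'_def v_def using bt b0 \<kappa> n by (intro frac_le) auto
    then have B: "w' / v \<le> ?B" using n by simp
    obtain c l where cl: "0 \<le> c" "2 * l * v < 1" "\<And>x. lr v w x / sqrt (lr v w' x) = c * exp (l * x\<^sup>2)"
      "c / sqrt (1 - 2 * l * v) \<le> exp (32 * (w / w' - 1)\<^sup>2 - (w' / v - 1)\<^sup>2 / (128 * (1 + ?B)\<^sup>2))"
      using lr_div_sqrt_lr_moment[OF vw(1-3) order_trans[OF q d] B] by blast
    have "(w / w' - 1)\<^sup>2 \<le> (2 * K * d / \<kappa>\<^sup>2)\<^sup>2"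
      using q by (metis abs_ge_zero power2_abs power_mono)
    moreover have "(real n * (w' - v))\<^sup>2 / ?C \<le> (w' / v - 1)\<^sup>2 / (128 * (1 + ?B)\<^sup>2)"
    proof -
      have "(real n * (w' - v))\<^sup>2 / K ^ 4 = (w' - v)\<^sup>2 / (K\<^sup>2 / real n)\<^sup>2"
        using n by (simp add: power_divide power_mult_distrib)
      also have "\<dots> \<le> (w' - v)\<^sup>2 / v\<^sup>2"
        using vw by (intro divide_left_mono power_mono mult_pos_pos zero_less_power) auto
      also have "\<dots> = (w' / v - 1)\<^sup>2" using vw by (simp add: power_divide[symmetric] diff_divide_distrib)
      finally have "(real n * (w' - v))\<^sup>2 / K ^ 4 / (128 * (1 + ?B)\<^sup>2) \<le> (w' / v - 1)\<^sup>2 / (128 * (1 + ?B)\<^sup>2)"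
        by (rule divide_right_mono) simp
      then show ?thesis by (simp add: mult.commute)
    qed
    ultimately have "32 * (w / w' - 1)\<^sup>2 - (w' / v - 1)\<^sup>2 / (128 * (1 + ?B)\<^sup>2) \<le> ?c - (real n * (w' - v))\<^sup>2 / ?C"
      by linarith
    then have "c / sqrt (1 - 2 * l * v) \<le> exp (?c - (real n * (w' - v))\<^sup>2 / ?C)"
      using cl(4) by (meson exp_le_cancel_iff order_trans)
    then show "\<exists>c l. 0 \<le> c \<and> 2 * l * cvar n s\<^sub>0 i < 1 \<and>
        (\<forall>y. lr (cvar n s\<^sub>0 i) (cvar n s i) y / sqrt (lr (cvar n s\<^sub>0 i) (cvar n t i) y) = c * exp (l * y\<^sup>2)) \<and>
        c / sqrt (1 - 2 * l * cvar n s\<^sub>0 i) \<le> exp (?c - (?d i)\<^sup>2 / ?C)"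
      using cl(1-3) unfolding v_def w_def w'_def by blast
  qed
  also have "(\<Sum>i=1..n. ?c - (?d i)\<^sup>2 / ?C) = real n * ?c - (\<Sum>i=1..n. (?d i)\<^sup>2) / ?C"
    by (simp add: sum_subtractf sum_divide_distrib)
  finally show ?thesis unfolding LR_def sqrt_prod prod_dividef[symmetric] .
qed

text \<open>With \<open>d\<close> the radius of the sup-norm ball around \<open>s\<^sub>0\<close>,
  the exponent is a constant times \<open>n * d\<^sup>2\<close>, the same order as the exponent of
  the prior mass.\<close>

lemma inverse_LR_mean:
  assumes s: "s \<in> vol_class \<kappa> K M"
    and near: "\<And>u. u \<in> {0..1} \<Longrightarrow> \<bar>s\<^sub>0 u - s u\<bar> \<le> d" and d: "2 * K * d / \<kappa>\<^sup>2 \<le> 1 / 2"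
  shows "(\<integral>\<^sup>+x. ennreal (1 / LR s\<^sub>0 n x s) \<partial>path_law \<Omega> X) \<le> ennreal (exp (real n * (2 * K * d / \<kappa>\<^sup>2)\<^sup>2))"
proof -
  have "(\<integral>\<^sup>+x. ennreal (\<Prod>i=1..n. 1 / lr (cvar n s\<^sub>0 i) (cvar n s i) (increment n i x)) \<partial>path_law \<Omega> X)
     \<le> ennreal (exp (\<Sum>i=1..n. (2 * K * d / \<kappa>\<^sup>2)\<^sup>2))"
  proof (rule path_law_moment[OF W X s0 \<kappa>(1) less_imp_le[OF M]])
    fix i assume i: "i \<in> {1..n}"
    define v w where "v = cvar n s\<^sub>0 i" and "w = cvar n s i"
    have vw: "0 < v" "0 < w" using cvar_bounds(3)[OF s \<kappa>(1) i] cvar_bounds(3)[OF s0 \<kappa>(1) i] by (auto simp: v_def w_def)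
    have q: "\<bar>v / w - 1\<bar> \<le> 2 * K * d / \<kappa>\<^sup>2"
      unfolding w_def v_def by (rule cvar_ratio[OF s0 s \<kappa>(1) i near])
    obtain c l where cl: "0 \<le> c" "2 * l * v < 1" "\<And>x. 1 / lr v w x = c * exp (l * x\<^sup>2)"
      "c / sqrt (1 - 2 * l * v) \<le> exp ((v / w - 1)\<^sup>2)"
      using inverse_lr_moment[OF vw order_trans[OF q d]] by blast
    have "(v / w - 1)\<^sup>2 \<le> (2 * K * d / \<kappa>\<^sup>2)\<^sup>2"
      using q by (metis abs_ge_zero power2_abs power_mono)
    then have "c / sqrt (1 - 2 * l * v) \<le> exp ((2 * K * d / \<kappa>\<^sup>2)\<^sup>2)"
      using cl(4) by (meson exp_le_cancel_iff order_trans)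
    then show "\<exists>c l. 0 \<le> c \<and> 2 * l * cvar n s\<^sub>0 i < 1 \<and>
        (\<forall>y. 1 / lr (cvar n s\<^sub>0 i) (cvar n s i) y = c * exp (l * y\<^sup>2)) \<and>
        c / sqrt (1 - 2 * l * cvar n s\<^sub>0 i) \<le> exp ((2 * K * d / \<kappa>\<^sup>2)\<^sup>2)"
      using cl(1-3) unfolding v_def w_def by blast
  qed
  then show ?thesis unfolding LR_def by (simp add: prod_dividef)
qed

lemma posterior_measurable:
  assumes \<pi>: "prior \<kappa> K M \<pi>"
  shows "(\<lambda>x. posterior \<pi> n x (vol_class \<kappa> K M - U_nbhd \<kappa> K M s\<^sub>0 r)) \<in> borel_measurable (path_law \<Omega> X)"
proof -
  interpret prob_space \<pi> using \<pi> by (simp add: prior_def)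
  have sets: "sets \<pi> = sets (vol_borel \<kappa> K M)" using \<pi> by (simp add: prior_def)
  then have sp: "space \<pi> = vol_class \<kappa> K M" using sets_eq_imp_space_eq space_vol_borel by metis
  have [measurable]: "vol_class \<kappa> K M - U_nbhd \<kappa> K M s\<^sub>0 r \<in> sets \<pi>"
    using U_nbhd_compl_measurable[OF s0 \<kappa>(1)] sets by simp
  have [measurable]: "(\<lambda>(x, s). LR s\<^sub>0 n x s) \<in> borel_measurable (path_law \<Omega> X \<Otimes>\<^sub>M \<pi>)"
    by (rule LR_measurable[OF s0 \<kappa>(1) sets]) (simp add: path_law_def)
  show ?thesis
    unfolding posterior_LR[OF s0 \<kappa>(1) sp] set_lebesgue_integral_def by measurable
qed

text \<open>A bound for a single \<open>n\<close>, with all exponents in units of \<open>D\<close>.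
  \<open>Q\<close> is the guaranteed separation per unit of \<open>D\<close>. \<open>Q1\<close>
  makes the mean of each root at most \<open>exp (- 2 * D)\<close>, of which one \<open>D\<close>
  pays for the net. \<open>Q2\<close> makes the separation outweigh the mesh cost
  \<open>c\<^sub>1\<close>, the evidence cost \<open>c\<^sub>4\<close> and the prior exponent
  \<open>Cbar\<close>, with a margin of 3.\<close>

lemma posterior_tail_bound:
  assumes \<pi>: "prior \<kappa> K M \<pi>" and n: "1 \<le> n" and e: "0 < e" and D: "D = real n * e\<^sup>2" "1 \<le> D"
    and small: "2 * K * ((1 + 2 * M) * e) / \<kappa>\<^sup>2 \<le> 1 / 2"
    and entropy: "(1 / e + 2) * ln (K / e + 1) \<le> D"
    and c4: "c\<^sub>4 = (2 * K / \<kappa>\<^sup>2)\<^sup>2" and c1: "c\<^sub>1 = 32 * (2 * K * (1 + 2 * M) / \<kappa>\<^sup>2)\<^sup>2"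
    and c3: "c\<^sub>3 = 128 * (1 + K\<^sup>2 / \<kappa>\<^sup>2)\<^sup>2 * K ^ 4"
    and Mt: "0 \<le> Mt" and Q: "Q = 2 * \<kappa>\<^sup>2 * Mt\<^sup>2 - 16 * K\<^sup>2 * M\<^sup>2"
    and Q1: "32 * K ^ 4 \<le> Q" and Q2: "c\<^sub>3 * (c\<^sub>1 + c\<^sub>4 + Cbar + 3) \<le> Q"
    and A: "0 < A" "exp (- Cbar * D) \<le> A * measure \<pi> (V_nbhd \<kappa> K M s\<^sub>0 e)" and \<eta>: "A * exp (- D) \<le> \<eta>" "0 < \<eta>"
  shows "measure (path_law \<Omega> X) {x \<in> space (path_law \<Omega> X).
      \<bar>posterior \<pi> n x (vol_class \<kappa> K M - U_nbhd \<kappa> K M s\<^sub>0 (Mt * e))\<bar> > \<eta>} \<le> 3 * exp (- D)"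
proof -
  let ?P = "path_law \<Omega> X"
  let ?S = "vol_class \<kappa> K M - U_nbhd \<kappa> K M s\<^sub>0 (Mt * e)" and ?V = "V_nbhd \<kappa> K M s\<^sub>0 e"
  let ?p = "measure \<pi> ?V"
  have \<pi>p: "prob_space \<pi>" and sets: "sets \<pi> = sets (vol_borel \<kappa> K M)" using \<pi> by (auto simp: prior_def)
  then have sp: "space \<pi> = vol_class \<kappa> K M" using sets_eq_imp_space_eq space_vol_borel by metis
  have setsP: "sets ?P = sets (PiM {0..1} (\<lambda>_. borel))" by (simp add: path_law_def)
  have K: "0 < K" using \<kappa> by simp
  have c3pos: "0 < c\<^sub>3"
  proof -
    have "0 < 1 + K\<^sup>2 / \<kappa>\<^sup>2" by (intro add_pos_nonneg) auto
    then show ?thesis using K by (simp add: c3)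
  qed
  have p: "0 < ?p" using A by (smt (verit) exp_gt_zero zero_less_mult_pos)
  \<comment> \<open>\<open>measure\<close> is 0 on nonmeasurable sets, so positive mass already
    forces the ball to be measurable.\<close>
  then have V: "?V \<in> sets \<pi>" using measure_notin_sets by fastforce
  have S: "?S \<in> sets \<pi>" using U_nbhd_compl_measurable[OF s0 \<kappa>(1)] sets by simp
  obtain F where F: "finite F" "F \<subseteq> ?S" "real (card F) \<le> exp ((1 / e + 2) * ln (K / e + 1))"
    and net: "\<And>s. s \<in> ?S \<Longrightarrow> \<exists>t\<in>F. \<forall>u\<in>{0..1}. \<bar>s u - t u\<bar> \<le> (1 + 2 * M) * e"
    using vol_class_net[of ?S \<kappa> K M e] \<kappa> M e by auto
  have sep: "Q * D \<le> (\<Sum>i=1..n. (real n * (cvar n t i - cvar n s\<^sub>0 i))\<^sup>2)" if t: "t \<in> ?S" for t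
  proof -
    \<comment> \<open>As \<open>D \<ge> 1\<close>, the discretisation remainder is at most a
      multiple of \<open>D\<close> and can be charged to \<open>Q\<close>.\<close>
    have "16 * K\<^sup>2 * M\<^sup>2 / real n \<le> 16 * K\<^sup>2 * M\<^sup>2 / 1" using n by (intro divide_left_mono) auto
    also have "\<dots> \<le> 16 * K\<^sup>2 * M\<^sup>2 * D" using mult_left_mono[OF D(2), of "16 * K\<^sup>2 * M\<^sup>2"] by simp
    finally have "Q * D \<le> 2 * \<kappa>\<^sup>2 * (Mt * e)\<^sup>2 * real n - 16 * K\<^sup>2 * M\<^sup>2 / real n"
      by (simp add: Q D(1) power_mult_distrib algebra_simps)
    also have "\<dots> \<le> (\<Sum>i=1..n. (real n * (cvar n t i - cvar n s\<^sub>0 i))\<^sup>2)"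
      using Mt e by (intro sum_cvar_diff_ge[OF t n]) simp
    finally show ?thesis .
  qed
  show ?thesis
  \<comment> \<open>For empty \<open>?S\<close> the net is empty and \<phi> would be 0, hence the
    separate case.\<close>
  proof (cases "?S = {}")
    case True
    have "posterior \<pi> n x ?S = 0" for x
      unfolding True by (simp add: posterior_def set_lebesgue_integral_def)
    then show ?thesis using \<eta>(2) by simp
  next
    case False
    define \<phi> where "\<phi> x = (\<Sum>t\<in>F. sqrt (LR s\<^sub>0 n x t))" for x
    have FX: "t \<in> vol_class \<kappa> K M" if "t \<in> F" for t using F(2) that by auto
    have F0: "F \<noteq> {}" using net False by blast
    have LRm: "(\<lambda>x. LR s\<^sub>0 n x s) \<in> borel_measurable ?P" if s: "s \<in> vol_class \<kappa> K M" for s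
      using measurable_compose[OF measurable_Pair2'[of s \<pi> ?P] LR_measurable[OF s0 \<kappa>(1) sets setsP, of n]] s sp
      by simp
    have \<phi>m: "\<phi> \<in> borel_measurable ?P"
      unfolding \<phi>_def[abs_def] using LRm[OF FX] by (intro borel_measurable_sum) measurable
    have LR0: "0 < LR s\<^sub>0 n x s" if "s \<in> vol_class \<kappa> K M" for x s by (rule LR_pos[OF s0 that \<kappa>(1)])
    have \<phi>pos: "0 < \<phi> x" for x
      unfolding \<phi>_def using F(1) F0 LR0 FX by (intro sum_pos) auto
    have E\<phi>: "(\<integral>\<^sup>+x. ennreal (\<phi> x) \<partial>?P) \<le> ennreal (exp (- D))"
    proof -
      have "(\<integral>\<^sup>+x. ennreal (\<phi> x) \<partial>?P) = (\<integral>\<^sup>+x. (\<Sum>t\<in>F. ennreal (sqrt (LR s\<^sub>0 n x t))) \<partial>?P)"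
        unfolding \<phi>_def using LR0 FX by (intro nn_integral_cong sum_ennreal[symmetric]) (simp add: less_imp_le)
      also have "\<dots> = (\<Sum>t\<in>F. \<integral>\<^sup>+x. ennreal (sqrt (LR s\<^sub>0 n x t)) \<partial>?P)"
        using LRm[OF FX] by (intro nn_integral_sum) measurable
      also have "\<dots> \<le> (\<Sum>t\<in>F. ennreal (exp (- 2 * D)))"
      proof (intro sum_mono)
        fix t assume t: "t \<in> F"
        have "32 * K ^ 4 * D \<le> Q * D" using Q1 D(2) by (intro mult_right_mono) auto
        also have "\<dots> \<le> (\<Sum>i=1..n. (real n * (cvar n t i - cvar n s\<^sub>0 i))\<^sup>2)" using sep t F(2) by auto
        finally have "- (\<Sum>i=1..n. (real n * (cvar n t i - cvar n s\<^sub>0 i))\<^sup>2) / (16 * K ^ 4) \<le> - (32 * K ^ 4 * D) / (16 * K ^ 4)"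
          using K by (intro divide_right_mono) auto
        also have "\<dots> = - 2 * D" using K by simp
        finally have "ennreal (exp (- (\<Sum>i=1..n. (real n * (cvar n t i - cvar n s\<^sub>0 i))\<^sup>2) / (16 * K ^ 4))) \<le> ennreal (exp (- 2 * D))"
          by (intro ennreal_leI) simp
        with sqrt_LR_mean[OF FX[OF t], of n] show "(\<integral>\<^sup>+x. ennreal (sqrt (LR s\<^sub>0 n x t)) \<partial>?P) \<le> ennreal (exp (- 2 * D))"
          by (rule order_trans)
      qed
      also have "\<dots> = ennreal (real (card F) * exp (- 2 * D))"
        by (simp add: ennreal_of_nat_eq_real_of_nat ennreal_mult')
      also have "\<dots> \<le> ennreal (exp D * exp (- 2 * D))"
        using order_trans[OF F(3)] entropy by (intro ennreal_leI mult_right_mono) auto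
      also have "exp D * exp (- 2 * D) = exp (- D)" by (simp add: exp_add[symmetric])
      finally show ?thesis .
    qed
    have ES: "(\<integral>\<^sup>+x. ennreal (LR s\<^sub>0 n x s / \<phi> x) \<partial>?P) \<le> ennreal (exp (- (c\<^sub>4 + Cbar + 3) * D))" if s: "s \<in> ?S" for s
    proof -
      obtain t where t: "t \<in> F" "\<And>u. u \<in> {0..1} \<Longrightarrow> \<bar>s u - t u\<bar> \<le> (1 + 2 * M) * e" using net[OF s] by blast
      have sX: "s \<in> vol_class \<kappa> K M" using s by simp
      have "(\<integral>\<^sup>+x. ennreal (LR s\<^sub>0 n x s / \<phi> x) \<partial>?P) \<le> (\<integral>\<^sup>+x. ennreal (LR s\<^sub>0 n x s / sqrt (LR s\<^sub>0 n x t)) \<partial>?P)"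
      proof (intro nn_integral_mono ennreal_leI divide_left_mono)
        fix x
        show "sqrt (LR s\<^sub>0 n x t) \<le> \<phi> x"
          unfolding \<phi>_def using F(1) t(1) LR0 FX by (intro member_le_sum) (auto simp: less_imp_le)
        show "0 \<le> LR s\<^sub>0 n x s" using LR0[OF sX] by (rule less_imp_le)
        show "0 < \<phi> x * sqrt (LR s\<^sub>0 n x t)" using \<phi>pos LR0[OF FX[OF t(1)]] by simp
      qed
      also note LR_div_sqrt_LR_mean[OF sX FX[OF t(1)] t(2) small]
      also have "ennreal (exp (real n * (32 * (2 * K * ((1 + 2 * M) * e) / \<kappa>\<^sup>2)\<^sup>2)
        - (\<Sum>i=1..n. (real n * (cvar n t i - cvar n s\<^sub>0 i))\<^sup>2) / (128 * (1 + K\<^sup>2 / \<kappa>\<^sup>2)\<^sup>2 * K ^ 4)))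
        \<le> ennreal (exp (- (c\<^sub>4 + Cbar + 3) * D))"
      proof -
        have "(c\<^sub>1 + c\<^sub>4 + Cbar + 3) * D * c\<^sub>3 \<le> Q * D"
          using mult_right_mono[OF Q2, of D] D(2) by (simp add: mult_ac)
        also have "\<dots> \<le> (\<Sum>i=1..n. (real n * (cvar n t i - cvar n s\<^sub>0 i))\<^sup>2)" using sep t(1) F(2) by auto
        finally have "(c\<^sub>1 + c\<^sub>4 + Cbar + 3) * D \<le> (\<Sum>i=1..n. (real n * (cvar n t i - cvar n s\<^sub>0 i))\<^sup>2) / c\<^sub>3"
          using c3pos by (simp add: pos_le_divide_eq)
        moreover have "real n * (32 * (2 * K * ((1 + 2 * M) * e) / \<kappa>\<^sup>2)\<^sup>2) = c\<^sub>1 * D"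
          by (simp add: c1 D(1) power_mult_distrib power_divide)
        ultimately show ?thesis unfolding c3[symmetric] by (intro ennreal_leI) (simp add: algebra_simps)
      qed
      finally show ?thesis .
    qed
    have EV: "(\<integral>\<^sup>+x. ennreal (1 / LR s\<^sub>0 n x s) \<partial>?P) \<le> ennreal (exp (c\<^sub>4 * D))" if s: "s \<in> ?V" for s
    proof -
      have sX: "s \<in> vol_class \<kappa> K M" and "mdist C01 s s\<^sub>0 < e" using s by (auto simp: V_nbhd_def)
      then have near: "\<bar>s\<^sub>0 u - s u\<bar> \<le> e" if "u \<in> {0..1}" for u
        using C01_mdist[OF sX s0 that] by (simp add: abs_minus_commute)
      have "e \<le> (1 + 2 * M) * e" using M e by (simp add: mult_le_cancel_right1)
      then have "2 * K * e / \<kappa>\<^sup>2 \<le> 2 * K * ((1 + 2 * M) * e) / \<kappa>\<^sup>2"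
        using K by (intro divide_right_mono mult_left_mono) auto
      then have "2 * K * e / \<kappa>\<^sup>2 \<le> 1 / 2" using small by linarith
      from inverse_LR_mean[OF sX near this, of n]
      have "(\<integral>\<^sup>+x. ennreal (1 / LR s\<^sub>0 n x s) \<partial>?P) \<le> ennreal (exp (real n * (2 * K * e / \<kappa>\<^sup>2)\<^sup>2))" .
      also have "real n * (2 * K * e / \<kappa>\<^sup>2)\<^sup>2 = c\<^sub>4 * D"
        by (simp add: c4 D(1) power_mult_distrib power_divide)
      finally show ?thesis .
    qed
    \<comment> \<open>Each threshold exceeds the corresponding mean by a factor
      \<open>exp D\<close>, which Markov's inequality turns into \<open>exp (- D)\<close>. The
      product \<open>a * g\<close> is \<open>exp (- (Cbar + 1) * D)\<close>, smaller than the lower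
      bound for the prior mass by \<open>exp (- D)\<close> up to the factor
      \<open>A\<close>.\<close>
    define a where "a = exp (- (c\<^sub>4 + Cbar + 2) * D)"
    define g where "g = exp ((c\<^sub>4 + 1) * D)"
    have "measure ?P {x \<in> space ?P. \<bar>(LINT s:?S|\<pi>. LR s\<^sub>0 n x s) / (LINT s|\<pi>. LR s\<^sub>0 n x s)\<bar> > \<eta>}
      \<le> exp (- D) + exp (- (c\<^sub>4 + Cbar + 3) * D) / a + exp (c\<^sub>4 * D) / g"
    proof (rule posterior_mass_bound[OF path_law_prob_space[OF W X] \<pi>p _ _ _ \<phi>m \<phi>pos S V p E\<phi> ES EV])
      show "(\<lambda>(x, s). LR s\<^sub>0 n x s) \<in> borel_measurable (?P \<Otimes>\<^sub>M \<pi>)" by (rule LR_measurable[OF s0 \<kappa>(1) sets setsP])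
      show "0 < LR s\<^sub>0 n x s" if "s \<in> space \<pi>" for x s using LR0 that sp by simp
      show "integrable \<pi> (LR s\<^sub>0 n x)" for x by (rule LR_integrable[OF s0 \<kappa>(1) \<pi>p sets])
      have "a * g = exp (- Cbar * D) * exp (- D)"
        unfolding a_def g_def exp_add[symmetric] by (simp add: algebra_simps)
      also have "\<dots> \<le> (A * ?p) * exp (- D)" using A(2) by (intro mult_right_mono) auto
      finally have "a * g / ?p \<le> A * exp (- D)" using p by (simp add: pos_divide_le_eq mult_ac)
      then show "a * g / ?p \<le> \<eta>" using \<eta> by linarith
    qed (simp_all add: a_def g_def)
    also have "exp (- (c\<^sub>4 + Cbar + 3) * D) / a = exp (- D)"
      unfolding a_def exp_diff[symmetric] by (simp add: algebra_simps)
    also have "exp (c\<^sub>4 * D) / g = exp (- D)"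
      unfolding g_def exp_diff[symmetric] by (simp add: algebra_simps)
    finally show ?thesis unfolding posterior_LR[OF s0 \<kappa>(1) sp] by simp
  qed
qed

end

theorem theorem1:
  fixes \<kappa> K M Cbar :: real
    and s\<^sub>0 :: "real \<Rightarrow> real"
    and \<Omega> :: "'w measure"
    and W X :: "real \<Rightarrow> 'w \<Rightarrow> real"
    and \<epsilon> :: "nat \<Rightarrow> real"
    and \<pi> :: "(real \<Rightarrow> real) measure"
  assumes "0 < \<kappa>" and "\<kappa> < K" and "0 < M"
    and "s\<^sub>0 \<in> vol_class \<kappa> K M"
    and "std_brownian_motion \<Omega> W"
    and "solves_sde \<Omega> W s\<^sub>0 X"
    and "\<And>n. n \<ge> 1 \<Longrightarrow> 0 < \<epsilon> n"
    and "same_order \<epsilon> (\<lambda>n. real n powr (- 1 / 3) * ln (real n))"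
    and "prior \<kappa> K M \<pi>"
    and "0 < Cbar"
    and "gtrsim (\<lambda>n. measure \<pi> (V_nbhd \<kappa> K M s\<^sub>0 (\<epsilon> n))) (\<lambda>n. exp (- Cbar * real n * (\<epsilon> n)\<^sup>2))"
  shows "\<exists>M\<^sub>0>0. \<forall>Mt\<ge>M\<^sub>0.
           tendsto_in_prob (path_law \<Omega> X)
             (\<lambda>n x. posterior \<pi> n x (vol_class \<kappa> K M - U_nbhd \<kappa> K M s\<^sub>0 (Mt * \<epsilon> n))) 0"
proof -
  note \<kappa> = assms(1,2) and M = assms(3) and s0 = assms(4) and W = assms(5) and X = assms(6) and \<epsilon> = assms(7)
  have K: "0 < K" using \<kappa> by simp
  define \<rho> where "\<rho> n = real n powr (- 1 / 3) * ln (real n)" for n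
  have so: "0 < liminf (\<lambda>n. ereal (\<epsilon> n / \<rho> n))" "limsup (\<lambda>n. ereal (\<epsilon> n / \<rho> n)) < \<infinity>"
    using assms(8) by (auto simp: same_order_def \<rho>_def)
  \<comment> \<open>For \<open>n \<le> 1\<close> the rate \<open>\<rho> n\<close> is 0 and the
    quotient has the default value 0; the lower and upper limits ignore these terms.\<close>
  obtain a where a: "0 < a" "ereal a < liminf (\<lambda>n. ereal (\<epsilon> n / \<rho> n))"
    using ereal_dense2[OF so(1)] by auto
  obtain b where b: "limsup (\<lambda>n. ereal (\<epsilon> n / \<rho> n)) < ereal b"
    using ereal_dense2[OF so(2)] by auto
  have \<rho>pos: "\<forall>\<^sub>F n in sequentially. 0 < \<rho> n" unfolding \<rho>_def by real_asymp
  have low: "\<forall>\<^sub>F n in sequentially. a * \<rho> n \<le> \<epsilon> n"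
    using less_LiminfD[OF a(2)] \<rho>pos by eventually_elim (simp add: pos_less_divide_eq)
  have up: "\<forall>\<^sub>F n in sequentially. \<epsilon> n \<le> b * \<rho> n"
    using Limsup_lessD[OF b] \<rho>pos by eventually_elim (simp add: pos_divide_less_eq)
  obtain A where A: "0 < A" "\<And>n. 1 \<le> n \<Longrightarrow> exp (- Cbar * real n * (\<epsilon> n)\<^sup>2) \<le> A * measure \<pi> (V_nbhd \<kappa> K M s\<^sub>0 (\<epsilon> n))"
    using assms(11) unfolding gtrsim_def by blast
  define D where "D n = real n * (\<epsilon> n)\<^sup>2" for n
  have ev1: "\<forall>\<^sub>F n in sequentially. 1 \<le> n" by (rule eventually_ge_at_top)
  have Dlow: "\<forall>\<^sub>F n in sequentially. real n * (a * \<rho> n)\<^sup>2 \<le> D n"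
    using low \<rho>pos unfolding D_def
    by eventually_elim (intro mult_left_mono power_mono, use a in auto)
  have "filterlim (\<lambda>n. real n * (a * \<rho> n)\<^sup>2) at_top sequentially"
    unfolding \<rho>_def using a by real_asymp
  then have Dinf: "filterlim D at_top sequentially" by (rule filterlim_at_top_mono[OF _ Dlow])
  have b0: "(\<lambda>n. b * \<rho> n) \<longlonglongrightarrow> 0" unfolding \<rho>_def by real_asymp
  have "\<forall>\<^sub>F n in sequentially. 0 \<le> \<epsilon> n" using ev1 by eventually_elim (use \<epsilon> in \<open>simp add: less_imp_le\<close>)
  from tendsto_sandwich[OF this up tendsto_const b0] have \<epsilon>0: "\<epsilon> \<longlonglongrightarrow> 0" .
  have "(\<lambda>n. 2 * K * ((1 + 2 * M) * \<epsilon> n) / \<kappa>\<^sup>2) \<longlonglongrightarrow> 2 * K * ((1 + 2 * M) * 0) / \<kappa>\<^sup>2"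
    using \<kappa> by (intro tendsto_intros \<epsilon>0) simp
  then have "(\<lambda>n. 2 * K * ((1 + 2 * M) * \<epsilon> n) / \<kappa>\<^sup>2) \<longlonglongrightarrow> 0" by simp
  then have "\<forall>\<^sub>F n in sequentially. 2 * K * ((1 + 2 * M) * \<epsilon> n) / \<kappa>\<^sup>2 < 1 / 2"
    by (rule order_tendstoD(2)) simp
  then have small: "\<forall>\<^sub>F n in sequentially. 2 * K * ((1 + 2 * M) * \<epsilon> n) / \<kappa>\<^sup>2 \<le> 1 / 2"
    by eventually_elim simp
  \<comment> \<open>The entropy decreases and \<open>D\<close> increases in \<epsilon>, so it
    suffices to compare them at the lower bound \<open>a * \<rho> n\<close>. There the left side is
    of order n^(1/3) and the right side of order n^(1/3) (log n)^2.\<close>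
  have "\<forall>\<^sub>F n in sequentially. (1 / (a * \<rho> n) + 2) * ln (K / (a * \<rho> n) + 1) \<le> real n * (a * \<rho> n)\<^sup>2"
    unfolding \<rho>_def using a K by real_asymp
  then have entropy: "\<forall>\<^sub>F n in sequentially. (1 / \<epsilon> n + 2) * ln (K / \<epsilon> n + 1) \<le> D n"
    using Dlow low \<rho>pos
  proof eventually_elim
    case (elim n)
    have ar: "0 < a * \<rho> n" using a elim by simp
    then have e: "0 < \<epsilon> n" using elim by linarith
    have "1 / \<epsilon> n \<le> 1 / (a * \<rho> n)" "K / \<epsilon> n \<le> K / (a * \<rho> n)"
      using ar e elim K by (auto intro!: divide_left_mono mult_pos_pos)
    moreover have "0 < K / \<epsilon> n" using K e by simp
    ultimately have "(1 / \<epsilon> n + 2) * ln (K / \<epsilon> n + 1) \<le> (1 / (a * \<rho> n) + 2) * ln (K / (a * \<rho> n) + 1)"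
      using ar e by (intro mult_mono) auto
    then show ?case using elim by linarith
  qed
  define c\<^sub>4 where "c\<^sub>4 = (2 * K / \<kappa>\<^sup>2)\<^sup>2"
  define c\<^sub>1 where "c\<^sub>1 = 32 * (2 * K * (1 + 2 * M) / \<kappa>\<^sup>2)\<^sup>2"
  define c\<^sub>3 where "c\<^sub>3 = 128 * (1 + K\<^sup>2 / \<kappa>\<^sup>2)\<^sup>2 * K ^ 4"
  \<comment> \<open>The last summand compensates the remainder that the tail bound subtracts; the
    absolute values let one sum dominate both thresholds.\<close>
  define Q where "Q = \<bar>32 * K ^ 4\<bar> + \<bar>c\<^sub>3 * (c\<^sub>1 + c\<^sub>4 + Cbar + 3)\<bar> + 16 * K\<^sup>2 * M\<^sup>2"
  have Q0: "0 \<le> Q" unfolding Q_def by simp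
  \<comment> \<open>The summand 1 ensures \<open>Mt \<le> Mt\<^sup>2\<close>, so that a condition
    linear in \<open>Mt\<close> yields the quadratic one, for every larger \<open>Mt\<close> as
    well.\<close>
  define M\<^sub>0 where "M\<^sub>0 = 1 + Q / (2 * \<kappa>\<^sup>2)"
  have M0: "1 \<le> M\<^sub>0" unfolding M\<^sub>0_def using Q0 by simp
  show ?thesis
  proof (intro exI[of _ M\<^sub>0] conjI allI impI)
    show "0 < M\<^sub>0" using M0 by simp
    fix Mt assume Mt: "M\<^sub>0 \<le> Mt"
    have "Q / (2 * \<kappa>\<^sup>2) \<le> Mt" using Mt unfolding M\<^sub>0_def by simp
    also have "Mt \<le> Mt\<^sup>2" using Mt M0 by (simp add: power2_eq_square)
    finally have Q: "Q \<le> 2 * \<kappa>\<^sup>2 * Mt\<^sup>2" using \<kappa> by (simp add: pos_divide_le_eq mult.commute)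
    have Q12: "32 * K ^ 4 \<le> 2 * \<kappa>\<^sup>2 * Mt\<^sup>2 - 16 * K\<^sup>2 * M\<^sup>2"
      "c\<^sub>3 * (c\<^sub>1 + c\<^sub>4 + Cbar + 3) \<le> 2 * \<kappa>\<^sup>2 * Mt\<^sup>2 - 16 * K\<^sup>2 * M\<^sup>2"
      using Q unfolding Q_def by linarith+
    let ?Z = "\<lambda>n x. posterior \<pi> n x (vol_class \<kappa> K M - U_nbhd \<kappa> K M s\<^sub>0 (Mt * \<epsilon> n))"
    show "tendsto_in_prob (path_law \<Omega> X) ?Z 0"
      unfolding tendsto_in_prob_def
    proof (intro conjI allI impI)
      show "?Z n \<in> borel_measurable (path_law \<Omega> X)" for n
        by (rule posterior_measurable[OF W X s0 \<kappa> M assms(9)])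
      fix \<eta> :: real assume \<eta>: "0 < \<eta>"
      have expD: "(\<lambda>n. exp (- D n)) \<longlonglongrightarrow> 0"
        using Dinf by (intro filterlim_compose[OF exp_at_bot] filterlim_compose[OF filterlim_uminus_at_bot_at_top])
      have "(\<lambda>n. A * exp (- D n)) \<longlonglongrightarrow> A * 0" by (intro tendsto_intros expD)
      then have "\<forall>\<^sub>F n in sequentially. A * exp (- D n) < \<eta>" using \<eta> by (intro order_tendstoD(2)) auto
      moreover have "\<forall>\<^sub>F n in sequentially. 1 \<le> D n" using Dinf by (simp add: filterlim_at_top)
      ultimately have bound: "\<forall>\<^sub>F n in sequentially. measure (path_law \<Omega> X) {x \<in> space (path_law \<Omega> X). \<bar>?Z n x - 0\<bar> > \<eta>}
        \<le> 3 * exp (- D n)"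
        using small entropy ev1
      proof eventually_elim
        case (elim n)
        have AD: "exp (- Cbar * D n) \<le> A * measure \<pi> (V_nbhd \<kappa> K M s\<^sub>0 (\<epsilon> n))"
          using A(2)[of n] elim by (simp add: D_def mult.assoc)
        show ?case unfolding diff_zero
          by (rule posterior_tail_bound[OF W X s0 \<kappa> M assms(9) _ _ D_def _ _ _ c\<^sub>4_def c\<^sub>1_def c\<^sub>3_def _ refl Q12 A(1) AD])
            (use elim \<epsilon> Mt M0 \<eta> in auto)
      qed
      have lim: "(\<lambda>n. 3 * exp (- D n)) \<longlonglongrightarrow> 0" using tendsto_mult[OF tendsto_const[of 3] expD] by simp
      show "(\<lambda>n. measure (path_law \<Omega> X) {x \<in> space (path_law \<Omega> X). \<bar>?Z n x - 0\<bar> > \<eta>}) \<longlonglongrightarrow> 0"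
        by (rule tendsto_sandwich[OF _ bound tendsto_const lim]) (simp add: always_eventually)
    qed
  qed
qed

end
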